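(* Let $k$ be a field of characteristic not $2$, let $\mathbf{q}$ be a nondegenerate quadratic form on an $n$-dimensional $k$-vector space $V$ with orthogonal basis $e_1,\dots,e_n$ and $\mathbf{q}(e_i)=q_i\neq 0$. Let $F:\mathbb{Z}_2^n\times\mathbb{Z}_2^n\to k$ be $$F(x,y)=(-1)^{\sum_{j<i}x_iy_j}\prod_{i=1}^n q_i^{x_iy_i}.$$ Then the algebra $k_F\mathbb{Z}_2^n$ can be identified with the Clifford algebra $C(V,\mathbf{q})$ (with the basis element of $k_F\mathbb{Z}_2^n$ labelled by the $i$-th standard generator of $\mathbb{Z}_2^n$ identified with $e_i$); that is, $C(V,\mathbf{q})$ is an algebra in the symmetric monoidal category of $\mathbb{Z}_2^n$-graded spaces defined by $\mathcal{R}(x,y)=(-1)^{\rho(x)\rho(y)+x\cdot y}$.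
   Context: $C(V,\mathbf{q})$ is the associative unital algebra generated by $e_1,\dots,e_n$ with relations $e_i^2=q_i\cdot 1$ and $e_ie_j+e_je_i=0$ for $i\ne j$. For a group $G$ and a nowhere-zero function $F:G\times G\to k$ with $F(e,x)=F(x,e)=1$, $k_FG$ is the vector space $kG$ (with basis labelled by $G$) with the new product $a\cdot b=F(a,b)\,ab$ for $a,b\in G$. Components of $x\in\mathbb{Z}_2^n$ are represented by $0,1$ in exponents; $\rho(x)=\sum_i x_i\in\mathbb{Z}$ and $x\cdot y=\sum_i x_iy_i$. The symmetric monoidal category of $\mathbb{Z}_2^n$-graded spaces defined by $\mathcal{R}$ has the usual tensor product, trivial associativity, and generalised transposition $\Psi(v\otimes w)=\mathcal{R}(x,y)\,w\otimes v$ for $v,w$ homogeneous of degrees $x,y$; an algebra in it is an algebra whose structure maps are morphisms (degree-preserving maps). The basis element labelled by $x$ has degree $x$. *)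

theory Defs
  imports "HOL-Algebra.Module" "HOL-Algebra.QuotRing" "HOL-Algebra.Product_Groups"
begin

section \<open>Linear algebra over a field given as a ring record\<close>

(* A vector space over K is a module record M with "module K M".  Such a record also has ring
   multiplication components; they carry no information unless M is an algebra. *)

locale assoc_algebra = module + ring M +
  assumes smult_mult_left:
      "\<lbrakk>a \<in> carrier R; x \<in> carrier M; y \<in> carrier M\<rbrakk> \<Longrightarrow>
      (a \<odot>\<^bsub>M\<^esub> x) \<otimes>\<^bsub>M\<^esub> y = a \<odot>\<^bsub>M\<^esub> (x \<otimes>\<^bsub>M\<^esub> y)"
    and smult_mult_right:
      "\<lbrakk>a \<in> carrier R; x \<in> carrier M; y \<in> carrier M\<rbrakk> \<Longrightarrow>
      x \<otimes>\<^bsub>M\<^esub> (a \<odot>\<^bsub>M\<^esub> y) = a \<odot>\<^bsub>M\<^esub> (x \<otimes>\<^bsub>M\<^esub> y)"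

definition linear_maps ::
    "('k, 'm) ring_scheme \<Rightarrow> ('k, 'v, 'a) module_scheme \<Rightarrow> ('k, 'w, 'b) module_scheme
      \<Rightarrow> ('v \<Rightarrow> 'w) set"
  where "linear_maps K V W = {h. h \<in> carrier V \<rightarrow> carrier W
    \<and> (\<forall>u\<in>carrier V. \<forall>v\<in>carrier V. h (u \<oplus>\<^bsub>V\<^esub> v) = h u \<oplus>\<^bsub>W\<^esub> h v)
    \<and> (\<forall>a\<in>carrier K. \<forall>v\<in>carrier V. h (a \<odot>\<^bsub>V\<^esub> v) = a \<odot>\<^bsub>W\<^esub> h v)}"

definition algebra_iso ::
    "('k, 'm) ring_scheme \<Rightarrow> ('k, 'v, 'a) module_scheme \<Rightarrow> ('k, 'w, 'b) module_scheme
      \<Rightarrow> ('v \<Rightarrow> 'w) set"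
  where "algebra_iso K A B = ring_iso A B \<inter> linear_maps K A B"

definition submodule_gen ::
    "('k, 'm) ring_scheme \<Rightarrow> ('k, 'v, 'a) module_scheme \<Rightarrow> 'v set \<Rightarrow> 'v set"
  where "submodule_gen K M S = \<Inter>{N. submodule N K M \<and> S \<subseteq> N}"

(* Used both for a submodule N of a vector space and for a two-sided ideal N of an algebra. *)
definition quotient_module ::
    "('k, 'v, 'a) module_scheme \<Rightarrow> 'v set \<Rightarrow> ('k, 'v set) module"
  where "quotient_module M N =
    ring.extend (M Quot N) (module.fields (\<lambda>a C. \<Union>x\<in>C. N +>\<^bsub>M\<^esub> (a \<odot>\<^bsub>M\<^esub> x)))"

definition free_module :: "('k, 'm) ring_scheme \<Rightarrow> 's set \<Rightarrow> ('k, 's \<Rightarrow> 'k) module"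
  where "free_module K S =
    \<lparr>carrier = {f. (\<forall>s\<in>S. f s \<in> carrier K) \<and> (\<forall>s. s \<notin> S \<longrightarrow> f s = \<zero>\<^bsub>K\<^esub>)
                  \<and> finite {s. f s \<noteq> \<zero>\<^bsub>K\<^esub>}},
     mult = undefined, one = undefined,
     zero = (\<lambda>s. \<zero>\<^bsub>K\<^esub>), add = (\<lambda>f g s. f s \<oplus>\<^bsub>K\<^esub> g s),
     smult = (\<lambda>a f s. a \<otimes>\<^bsub>K\<^esub> f s)\<rparr>"

definition basis_elt :: "('k, 'm) ring_scheme \<Rightarrow> 's \<Rightarrow> 's \<Rightarrow> 'k"
  where "basis_elt K s = (\<lambda>t. if t = s then \<one>\<^bsub>K\<^esub> else \<zero>\<^bsub>K\<^esub>)"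

(* The product is the bilinear extension of  a . b = F(a,b) ab  on basis elements; the unit is
   the basis element of the neutral element, as F(e,x) = F(x,e) = 1.  G may be a monoid. *)
definition twisted_algebra ::
    "('k, 'm) ring_scheme \<Rightarrow> ('g, 'c) monoid_scheme \<Rightarrow> ('g \<Rightarrow> 'g \<Rightarrow> 'k)
      \<Rightarrow> ('k, 'g \<Rightarrow> 'k) module"
  where "twisted_algebra K G F = (free_module K (carrier G))
    \<lparr>monoid.mult := (\<lambda>f g z.
        finsum K (\<lambda>(x, y). F x y \<otimes>\<^bsub>K\<^esub> (f x \<otimes>\<^bsub>K\<^esub> g y))
          {(x, y). x \<in> carrier G \<and> y \<in> carrier G \<and> f x \<noteq> \<zero>\<^bsub>K\<^esub> \<and> g y \<noteq> \<zero>\<^bsub>K\<^esub>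
                   \<and> x \<otimes>\<^bsub>G\<^esub> y = z}),
     one := basis_elt K \<one>\<^bsub>G\<^esub>\<rparr>"

section \<open>Quadratic forms and the Clifford algebra\<close>

definition is_basis ::
    "('k, 'm) ring_scheme \<Rightarrow> ('k, 'v, 'a) module_scheme \<Rightarrow> nat \<Rightarrow> (nat \<Rightarrow> 'v) \<Rightarrow> bool"
  where "is_basis K V n e \<longleftrightarrow> (\<forall>i<n. e i \<in> carrier V) \<and>
    (\<forall>v\<in>carrier V. \<exists>!c. c \<in> {..<n} \<rightarrow>\<^sub>E carrier K \<and> v = (\<Oplus>\<^bsub>V\<^esub>i\<in>{..<n}. c i \<odot>\<^bsub>V\<^esub> e i))"

definition polar ::
    "('k, 'm) ring_scheme \<Rightarrow> ('k, 'v, 'a) module_scheme \<Rightarrow> ('v \<Rightarrow> 'k) \<Rightarrow> 'v \<Rightarrow> 'v \<Rightarrow> 'k"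
  where "polar K V Q u v = Q (u \<oplus>\<^bsub>V\<^esub> v) \<ominus>\<^bsub>K\<^esub> Q u \<ominus>\<^bsub>K\<^esub> Q v"

(* Linearity in the second argument follows, since the polar form is symmetric. *)
definition quadratic_form ::
    "('k, 'm) ring_scheme \<Rightarrow> ('k, 'v, 'a) module_scheme \<Rightarrow> ('v \<Rightarrow> 'k) \<Rightarrow> bool"
  where "quadratic_form K V Q \<longleftrightarrow> Q \<in> carrier V \<rightarrow> carrier K
    \<and> (\<forall>a\<in>carrier K. \<forall>v\<in>carrier V. Q (a \<odot>\<^bsub>V\<^esub> v) = a \<otimes>\<^bsub>K\<^esub> a \<otimes>\<^bsub>K\<^esub> Q v)
    \<and> (\<forall>u\<in>carrier V. \<forall>v\<in>carrier V. \<forall>w\<in>carrier V.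
         polar K V Q (u \<oplus>\<^bsub>V\<^esub> v) w = polar K V Q u w \<oplus>\<^bsub>K\<^esub> polar K V Q v w)
    \<and> (\<forall>a\<in>carrier K. \<forall>u\<in>carrier V. \<forall>v\<in>carrier V.
         polar K V Q (a \<odot>\<^bsub>V\<^esub> u) v = a \<otimes>\<^bsub>K\<^esub> polar K V Q u v)"

definition nondegenerate ::
    "('k, 'm) ring_scheme \<Rightarrow> ('k, 'v, 'a) module_scheme \<Rightarrow> ('v \<Rightarrow> 'k) \<Rightarrow> bool"
  where "nondegenerate K V Q \<longleftrightarrow>
    (\<forall>u\<in>carrier V. (\<forall>v\<in>carrier V. polar K V Q u v = \<zero>\<^bsub>K\<^esub>) \<longrightarrow> u = \<zero>\<^bsub>V\<^esub>)"

(* Noncommutative polynomials: the monoid algebra of the words in the letters 0, ..., n-1. *)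
definition free_algebra :: "('k, 'm) ring_scheme \<Rightarrow> nat \<Rightarrow> ('k, nat list \<Rightarrow> 'k) module"
  where "free_algebra K n =
    twisted_algebra K \<lparr>carrier = lists {..<n}, monoid.mult = (@), one = []\<rparr> (\<lambda>u v. \<one>\<^bsub>K\<^esub>)"

definition clifford_relators ::
    "('k, 'm) ring_scheme \<Rightarrow> nat \<Rightarrow> (nat \<Rightarrow> 'k) \<Rightarrow> (nat list \<Rightarrow> 'k) set"
  where "clifford_relators K n q =
    (let A = free_algebra K n; x = (\<lambda>i. basis_elt K [i]) in
      {x i \<otimes>\<^bsub>A\<^esub> x i \<ominus>\<^bsub>A\<^esub> q i \<odot>\<^bsub>A\<^esub> \<one>\<^bsub>A\<^esub> | i. i < n} \<union>
      {x i \<otimes>\<^bsub>A\<^esub> x j \<oplus>\<^bsub>A\<^esub> x j \<otimes>\<^bsub>A\<^esub> x i | i j. i < n \<and> j < n \<and> i \<noteq> j})"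

definition clifford_ideal ::
    "('k, 'm) ring_scheme \<Rightarrow> nat \<Rightarrow> (nat \<Rightarrow> 'k) \<Rightarrow> (nat list \<Rightarrow> 'k) set"
  where "clifford_ideal K n q = Idl\<^bsub>free_algebra K n\<^esub> (clifford_relators K n q)"

definition clifford_algebra ::
    "('k, 'm) ring_scheme \<Rightarrow> nat \<Rightarrow> (nat \<Rightarrow> 'k) \<Rightarrow> ('k, (nat list \<Rightarrow> 'k) set) module"
  where "clifford_algebra K n q = quotient_module (free_algebra K n) (clifford_ideal K n q)"

definition clifford_gen ::
    "('k, 'm) ring_scheme \<Rightarrow> nat \<Rightarrow> (nat \<Rightarrow> 'k) \<Rightarrow> nat \<Rightarrow> (nat list \<Rightarrow> 'k) set"
  where "clifford_gen K n q i = clifford_ideal K n q +>\<^bsub>free_algebra K n\<^esub> basis_elt K [i]"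

section \<open>Graded spaces and the generalised transposition\<close>

record ('k, 'v, 'g) graded_module = "('k, 'v) module" +
  grade :: "'g \<Rightarrow> 'v set"

definition with_grading ::
    "('k, 'v) module \<Rightarrow> ('g \<Rightarrow> 'v set) \<Rightarrow> ('k, 'v, 'g) graded_module"
  where "with_grading M gr = module.extend M (graded_module.fields gr)"

definition graded_space ::
    "('k, 'm) ring_scheme \<Rightarrow> ('g, 'c) monoid_scheme \<Rightarrow> ('k, 'v, 'g) graded_module \<Rightarrow> bool"
  where "graded_space K G V \<longleftrightarrow> module K V
    \<and> (\<forall>x\<in>carrier G. submodule (grade V x) K V)
    \<and> (\<forall>v\<in>carrier V. \<exists>!c. c \<in> (\<Pi>\<^sub>E x\<in>carrier G. grade V x)
          \<and> finite {x \<in> carrier G. c x \<noteq> \<zero>\<^bsub>V\<^esub>}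
          \<and> v = (\<Oplus>\<^bsub>V\<^esub>x\<in>{x \<in> carrier G. c x \<noteq> \<zero>\<^bsub>V\<^esub>}. c x))"

definition graded_maps ::
    "('k, 'm) ring_scheme \<Rightarrow> ('g, 'c) monoid_scheme \<Rightarrow> ('k, 'v, 'g) graded_module
      \<Rightarrow> ('k, 'w, 'g) graded_module \<Rightarrow> ('v \<Rightarrow> 'w) set"
  where "graded_maps K G V W =
    {h \<in> linear_maps K V W. \<forall>x\<in>carrier G. h ` grade V x \<subseteq> grade W x}"

definition unit_space ::
    "('k, 'm) ring_scheme \<Rightarrow> ('g, 'c) monoid_scheme \<Rightarrow> ('k, 'k, 'g) graded_module"
  where "unit_space K G =
    \<lparr>carrier = carrier K, monoid.mult = monoid.mult K, one = one K, zero = zero K, add = add K,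
     smult = monoid.mult K, grade = (\<lambda>x. if x = \<one>\<^bsub>G\<^esub> then carrier K else {\<zero>\<^bsub>K\<^esub>})\<rparr>"

definition bilinear_relators ::
    "('k, 'm) ring_scheme \<Rightarrow> ('k, 'v, 'a) module_scheme \<Rightarrow> ('k, 'w, 'b) module_scheme
      \<Rightarrow> ('v \<times> 'w \<Rightarrow> 'k) set"
  where "bilinear_relators K V W =
    (let M = free_module K (carrier V \<times> carrier W); d = (\<lambda>v w. basis_elt K (v, w)) in
      {d (u \<oplus>\<^bsub>V\<^esub> v) w \<ominus>\<^bsub>M\<^esub> (d u w \<oplus>\<^bsub>M\<^esub> d v w) | u v w.
         u \<in> carrier V \<and> v \<in> carrier V \<and> w \<in> carrier W} \<union>
      {d v (w \<oplus>\<^bsub>W\<^esub> z) \<ominus>\<^bsub>M\<^esub> (d v w \<oplus>\<^bsub>M\<^esub> d v z) | v w z.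
         v \<in> carrier V \<and> w \<in> carrier W \<and> z \<in> carrier W} \<union>
      {d (a \<odot>\<^bsub>V\<^esub> v) w \<ominus>\<^bsub>M\<^esub> a \<odot>\<^bsub>M\<^esub> d v w | a v w.
         a \<in> carrier K \<and> v \<in> carrier V \<and> w \<in> carrier W} \<union>
      {d v (a \<odot>\<^bsub>W\<^esub> w) \<ominus>\<^bsub>M\<^esub> a \<odot>\<^bsub>M\<^esub> d v w | a v w.
         a \<in> carrier K \<and> v \<in> carrier V \<and> w \<in> carrier W})"

definition tensor_relations ::
    "('k, 'm) ring_scheme \<Rightarrow> ('k, 'v, 'a) module_scheme \<Rightarrow> ('k, 'w, 'b) module_scheme
      \<Rightarrow> ('v \<times> 'w \<Rightarrow> 'k) set"
  where "tensor_relations K V W =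
    submodule_gen K (free_module K (carrier V \<times> carrier W)) (bilinear_relators K V W)"

definition tensor_space ::
    "('k, 'm) ring_scheme \<Rightarrow> ('k, 'v, 'a) module_scheme \<Rightarrow> ('k, 'w, 'b) module_scheme
      \<Rightarrow> ('k, ('v \<times> 'w \<Rightarrow> 'k) set) module"
  where "tensor_space K V W =
    quotient_module (free_module K (carrier V \<times> carrier W)) (tensor_relations K V W)"

definition pure_tensor ::
    "('k, 'm) ring_scheme \<Rightarrow> ('k, 'v, 'a) module_scheme \<Rightarrow> ('k, 'w, 'b) module_scheme
      \<Rightarrow> 'v \<Rightarrow> 'w \<Rightarrow> ('v \<times> 'w \<Rightarrow> 'k) set"
  where "pure_tensor K V W v w =
    tensor_relations K V W +>\<^bsub>free_module K (carrier V \<times> carrier W)\<^esub> basis_elt K (v, w)"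

definition graded_tensor ::
    "('k, 'm) ring_scheme \<Rightarrow> ('g, 'c) monoid_scheme \<Rightarrow> ('k, 'v, 'g) graded_module
      \<Rightarrow> ('k, 'w, 'g) graded_module \<Rightarrow> ('k, ('v \<times> 'w \<Rightarrow> 'k) set, 'g) graded_module"
  where "graded_tensor K G V W = with_grading (tensor_space K V W)
    (\<lambda>z. submodule_gen K (tensor_space K V W)
       {pure_tensor K V W v w | v w. \<exists>x\<in>carrier G. \<exists>y\<in>carrier G.
          x \<otimes>\<^bsub>G\<^esub> y = z \<and> v \<in> grade V x \<and> w \<in> grade W y})"

(* The linear map on the tensor product induced by the bilinear map b. *)
definition tensor_lift ::
    "('k, 'm) ring_scheme \<Rightarrow> ('k, 'v, 'a) module_scheme \<Rightarrow> ('k, 'w, 'b) module_scheme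
      \<Rightarrow> ('k, 'x, 'c) module_scheme \<Rightarrow> ('v \<Rightarrow> 'w \<Rightarrow> 'x) \<Rightarrow> ('v \<times> 'w \<Rightarrow> 'k) set \<Rightarrow> 'x"
  where "tensor_lift K V W X b =
    (THE h. h \<in> linear_maps K (tensor_space K V W) X
          \<and> h \<in> extensional (carrier (tensor_space K V W))
          \<and> (\<forall>v\<in>carrier V. \<forall>w\<in>carrier W. h (pure_tensor K V W v w) = b v w))"

definition tensor_map ::
    "('k, 'm) ring_scheme \<Rightarrow> ('k, 'v, 'a) module_scheme \<Rightarrow> ('k, 'w, 'b) module_scheme
      \<Rightarrow> ('k, 'x, 'c) module_scheme \<Rightarrow> ('k, 'y, 'd) module_scheme
      \<Rightarrow> ('v \<Rightarrow> 'x) \<Rightarrow> ('w \<Rightarrow> 'y) \<Rightarrow> ('v \<times> 'w \<Rightarrow> 'k) set \<Rightarrow> ('x \<times> 'y \<Rightarrow> 'k) set"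
  where "tensor_map K V W X Y f g =
    tensor_lift K V W (tensor_space K X Y) (\<lambda>v w. pure_tensor K X Y (f v) (g w))"

(* (u (x) v) (x) w |-> u (x) (v (x) w) *)
definition tensor_assoc ::
    "('k, 'm) ring_scheme \<Rightarrow> ('k, 'u, 'a) module_scheme \<Rightarrow> ('k, 'v, 'b) module_scheme
      \<Rightarrow> ('k, 'w, 'c) module_scheme
      \<Rightarrow> (('u \<times> 'v \<Rightarrow> 'k) set \<times> 'w \<Rightarrow> 'k) set \<Rightarrow> ('u \<times> ('v \<times> 'w \<Rightarrow> 'k) set \<Rightarrow> 'k) set"
  where "tensor_assoc K U V W =
    (let VW = tensor_space K V W; T = tensor_space K U VW in
      tensor_lift K (tensor_space K U V) W T
        (\<lambda>t w. tensor_lift K U V T (\<lambda>u v. pure_tensor K U VW u (pure_tensor K V W v w)) t))"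

definition transposition ::
    "('k, 'm) ring_scheme \<Rightarrow> ('g, 'c) monoid_scheme \<Rightarrow> ('g \<Rightarrow> 'g \<Rightarrow> 'k)
      \<Rightarrow> ('k, 'v, 'g) graded_module \<Rightarrow> ('k, 'w, 'g) graded_module
      \<Rightarrow> ('v \<times> 'w \<Rightarrow> 'k) set \<Rightarrow> ('w \<times> 'v \<Rightarrow> 'k) set"
  where "transposition K G R V W =
    (THE h. h \<in> linear_maps K (tensor_space K V W) (tensor_space K W V)
          \<and> h \<in> extensional (carrier (tensor_space K V W))
          \<and> (\<forall>x\<in>carrier G. \<forall>y\<in>carrier G. \<forall>v\<in>grade V x. \<forall>w\<in>grade W y.
               h (pure_tensor K V W v w) = R x y \<odot>\<^bsub>tensor_space K W V\<^esub> pure_tensor K W V w v))"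

(* R makes the G-graded spaces, with their usual monoidal structure, a symmetric monoidal
   category: the generalised transposition is a well defined, natural, involutive family of
   morphisms satisfying the hexagon identity (the other hexagon follows by involutivity).
   HOL has no quantification over types, so the spaces range over those with elements in an
   arbitrary type 'w, which is passed as an argument. *)
definition defines_symmetric_category ::
    "('k, 'm) ring_scheme \<Rightarrow> ('g, 'c) monoid_scheme \<Rightarrow> ('g \<Rightarrow> 'g \<Rightarrow> 'k) \<Rightarrow> 'w itself \<Rightarrow> bool"
  where "defines_symmetric_category K G R (_ :: 'w itself) \<longleftrightarrow>
    (\<forall>(V :: ('k, 'w, 'g) graded_module) (W :: ('k, 'w, 'g) graded_module).
       graded_space K G V \<longrightarrow> graded_space K G W \<longrightarrow>
       graded_space K G (graded_tensor K G V W)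
     \<and> transposition K G R V W \<in> graded_maps K G (graded_tensor K G V W) (graded_tensor K G W V)
     \<and> (\<forall>x\<in>carrier G. \<forall>y\<in>carrier G. \<forall>v\<in>grade V x. \<forall>w\<in>grade W y.
          transposition K G R V W (pure_tensor K V W v w)
            = R x y \<odot>\<^bsub>graded_tensor K G W V\<^esub> pure_tensor K W V w v)
     \<and> (\<forall>t\<in>carrier (graded_tensor K G V W).
          transposition K G R W V (transposition K G R V W t) = t))
  \<and> (\<forall>(V :: ('k, 'w, 'g) graded_module) (W :: ('k, 'w, 'g) graded_module)
      (V' :: ('k, 'w, 'g) graded_module) (W' :: ('k, 'w, 'g) graded_module).
       graded_space K G V \<longrightarrow> graded_space K G W \<longrightarrow>
       graded_space K G V' \<longrightarrow> graded_space K G W' \<longrightarrow>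
       (\<forall>f\<in>graded_maps K G V V'. \<forall>g\<in>graded_maps K G W W'. \<forall>t\<in>carrier (graded_tensor K G V W).
          transposition K G R V' W' (tensor_map K V W V' W' f g t)
            = tensor_map K W V W' V' g f (transposition K G R V W t)))
  \<and> (\<forall>(U :: ('k, 'w, 'g) graded_module) (V :: ('k, 'w, 'g) graded_module)
      (W :: ('k, 'w, 'g) graded_module).
       graded_space K G U \<longrightarrow> graded_space K G V \<longrightarrow> graded_space K G W \<longrightarrow>
       (\<forall>t\<in>carrier (graded_tensor K G (graded_tensor K G U V) W).
          tensor_assoc K V W U
            (transposition K G R U (graded_tensor K G V W) (tensor_assoc K U V W t))
          = tensor_map K V (graded_tensor K G U W) V (graded_tensor K G W U)
              id (transposition K G R U W)
              (tensor_assoc K V U W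
                (tensor_map K (graded_tensor K G U V) W (graded_tensor K G V U) W
                   (transposition K G R U V) id t))))"

(* An algebra whose product, as a map on the tensor square, and unit, as a map from the unit
   object, are degree-preserving. *)
definition graded_algebra ::
    "('k, 'm) ring_scheme \<Rightarrow> ('g, 'c) monoid_scheme \<Rightarrow> ('k, 'v, 'g) graded_module \<Rightarrow> bool"
  where "graded_algebra K G A \<longleftrightarrow> assoc_algebra K A \<and> graded_space K G A
    \<and> tensor_lift K A A A (monoid.mult A) \<in> graded_maps K G (graded_tensor K G A A) A
    \<and> (\<lambda>a. a \<odot>\<^bsub>A\<^esub> \<one>\<^bsub>A\<^esub>) \<in> graded_maps K G (unit_space K G) A"

definition algebra_in_symmetric_category ::
    "('k, 'm) ring_scheme \<Rightarrow> ('g, 'c) monoid_scheme \<Rightarrow> ('g \<Rightarrow> 'g \<Rightarrow> 'k) \<Rightarrow> 'w itself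
      \<Rightarrow> ('k, 'v, 'g) graded_module \<Rightarrow> bool"
  where "algebra_in_symmetric_category K G R T A \<longleftrightarrow>
    defines_symmetric_category K G R T \<and> graded_algebra K G A"

section \<open>The group \<open>Z\<^sub>2\<^sup>n\<close>, the cochain and the braiding\<close>

(* Elements are extensional functions on {..<n} with values in {0, 1}; indices start at 0. *)
definition Z2_pow :: "nat \<Rightarrow> (nat \<Rightarrow> int) monoid"
  where "Z2_pow n = product_group {..<n} (\<lambda>i. integer_mod_group 2)"

definition Z2_gen :: "nat \<Rightarrow> nat \<Rightarrow> nat \<Rightarrow> int"
  where "Z2_gen n i = (\<lambda>j\<in>{..<n}. if j = i then 1 else 0)"

definition rho :: "nat \<Rightarrow> (nat \<Rightarrow> int) \<Rightarrow> int"
  where "rho n x = (\<Sum>i<n. x i)"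

definition dot :: "nat \<Rightarrow> (nat \<Rightarrow> int) \<Rightarrow> (nat \<Rightarrow> int) \<Rightarrow> int"
  where "dot n x y = (\<Sum>i<n. x i * y i)"

definition clifford_cochain ::
    "('k, 'm) ring_scheme \<Rightarrow> nat \<Rightarrow> (nat \<Rightarrow> 'k) \<Rightarrow> (nat \<Rightarrow> int) \<Rightarrow> (nat \<Rightarrow> int) \<Rightarrow> 'k"
  where "clifford_cochain K n q x y =
    (\<ominus>\<^bsub>K\<^esub> \<one>\<^bsub>K\<^esub>) [^]\<^bsub>K\<^esub> nat (\<Sum>i<n. \<Sum>j<i. x i * y j)
      \<otimes>\<^bsub>K\<^esub> (\<Otimes>\<^bsub>K\<^esub>i\<in>{..<n}. q i [^]\<^bsub>K\<^esub> nat (x i * y i))"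

definition clifford_braiding ::
    "('k, 'm) ring_scheme \<Rightarrow> nat \<Rightarrow> (nat \<Rightarrow> int) \<Rightarrow> (nat \<Rightarrow> int) \<Rightarrow> 'k"
  where "clifford_braiding K n x y =
    (\<ominus>\<^bsub>K\<^esub> \<one>\<^bsub>K\<^esub>) [^]\<^bsub>K\<^esub> nat (rho n x * rho n y + dot n x y)"

(* The grading of C carried over from the basis grading of k_F G along phi : C -> k_F G. *)
definition transported_grading ::
    "('k, 'm) ring_scheme \<Rightarrow> ('k, 'v) module \<Rightarrow> ('k, 'g \<Rightarrow> 'k) module \<Rightarrow> ('v \<Rightarrow> 'g \<Rightarrow> 'k)
      \<Rightarrow> ('k, 'v, 'g) graded_module"
  where "transported_grading K C A \<phi> = with_grading C
    (\<lambda>x. {c \<in> carrier C. \<exists>a\<in>carrier K. \<phi> c = a \<odot>\<^bsub>A\<^esub> basis_elt K x})"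

end

theory Submission
  imports Defs
begin

text \<open>For the category: a linear map on a tensor product of graded spaces is determined by its
  values on tensors of homogeneous elements, and since the grading group is finite every rescaling
  of those values by degree is realised by a linear map. So the axioms for the generalised
  transposition reduce to the bicharacter identities
  \<open>R x (yz) = R x y R x z\<close> and \<open>R x y R y x = 1\<close>.

  For the algebra: \<open>F\<close> is a 2-cocycle because its sign part is bilinear modulo 2 and its \<open>q\<close> part
  is a carry cocycle. So \<open>k\<^sub>F Z\<^sub>2\<^sup>n\<close> is associative, and its elements labelled by the standard
  generators satisfy the Clifford relations, which gives a homomorphism \<open>\<phi>\<close> from \<open>C(V, q)\<close>.
  Multiplying an ordered monomial of \<open>C(V, q)\<close> by a generator produces exactly the values of \<open>F\<close>,
  so sending basis elements to ordered monomials inverts \<open>\<phi>\<close>.\<close>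

section \<open>Linear maps, submodules and quotients\<close>

text \<open>No dimension is counted in the comparison of the two algebras. The inverse is exhibited
  as a merely linear map: proving it multiplicative would require the whole multiplication table of
  ordered monomials, whereas commuting with left multiplication by the generators already determines
  it on all words, and words span the Clifford algebra. So only the values of \<open>F\<close> whose
  first argument is a generator have to be compared. Independence of the ordered monomials is a
  by-product, since their images are distinct basis elements.

  The braiding is the commutation sign of the twisted algebra:
  \<open>F(x,y) = R(x,y) F(y,x)\<close>. The parts of \<open>F\<close> that involve the q_i are
  symmetric, and the two signs differ by -1 to the number of pairs i, j of distinct indices with x_i
  = y_j = 1, which modulo 2 is rho(x) rho(y) + x.y.

  Tensor products are concrete quotients of huge free modules, and lifts and transpositions are
  definite descriptions. Nothing can be computed with them before existence and uniqueness are
  known, which is what most of the linear algebra below supplies.\<close>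

lemma linear_mapsI:
  assumes "\<And>v. v \<in> carrier V \<Longrightarrow> h v \<in> carrier W"
    and "\<And>u v. u \<in> carrier V \<Longrightarrow> v \<in> carrier V \<Longrightarrow> h (u \<oplus>\<^bsub>V\<^esub> v) = h u \<oplus>\<^bsub>W\<^esub> h v"
    and "\<And>a v. a \<in> carrier K \<Longrightarrow> v \<in> carrier V \<Longrightarrow> h (a \<odot>\<^bsub>V\<^esub> v) = a \<odot>\<^bsub>W\<^esub> h v"
  shows "h \<in> linear_maps K V W"
  using assms unfolding linear_maps_def by auto

lemma linear_maps_closed: "h \<in> linear_maps K V W \<Longrightarrow> v \<in> carrier V \<Longrightarrow> h v \<in> carrier W"
  and linear_maps_add: "h \<in> linear_maps K V W \<Longrightarrow> u \<in> carrier V \<Longrightarrow> v \<in> carrier V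
    \<Longrightarrow> h (u \<oplus>\<^bsub>V\<^esub> v) = h u \<oplus>\<^bsub>W\<^esub> h v"
  and linear_maps_smult: "h \<in> linear_maps K V W \<Longrightarrow> a \<in> carrier K \<Longrightarrow> v \<in> carrier V
    \<Longrightarrow> h (a \<odot>\<^bsub>V\<^esub> v) = a \<odot>\<^bsub>W\<^esub> h v"
  unfolding linear_maps_def by auto

lemma linear_maps_zero:
  assumes "module K V" "module K W" "h \<in> linear_maps K V W"
  shows "h \<zero>\<^bsub>V\<^esub> = \<zero>\<^bsub>W\<^esub>"
proof -
  interpret V: module K V by fact
  interpret W: module K W by fact
  have "h \<zero>\<^bsub>V\<^esub> = h (\<zero>\<^bsub>K\<^esub> \<odot>\<^bsub>V\<^esub> \<zero>\<^bsub>V\<^esub>)" by simp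
  also have "\<dots> = \<zero>\<^bsub>K\<^esub> \<odot>\<^bsub>W\<^esub> h \<zero>\<^bsub>V\<^esub>"
    by (intro linear_maps_smult[OF assms(3)]) auto
  also have "\<dots> = \<zero>\<^bsub>W\<^esub>" by (simp add: linear_maps_closed[OF assms(3)])
  finally show ?thesis .
qed

lemma linear_maps_id: "(\<lambda>v. v) \<in> linear_maps K V V"
  by (rule linear_mapsI) auto

lemma linear_maps_comp:
  assumes "f \<in> linear_maps K V W" "g \<in> linear_maps K W X"
  shows "(\<lambda>v. g (f v)) \<in> linear_maps K V X"
  using assms
  by (intro linear_mapsI) (auto simp: linear_maps_closed linear_maps_add linear_maps_smult)

lemma linear_maps_scale:
  assumes "module K W" "f \<in> linear_maps K V W" "a \<in> carrier K"
  shows "(\<lambda>v. a \<odot>\<^bsub>W\<^esub> f v) \<in> linear_maps K V W"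
proof -
  interpret W: module K W by fact
  show ?thesis using assms(2,3)
    by (intro linear_mapsI)
      (auto simp: linear_maps_closed linear_maps_add linear_maps_smult W.smult_r_distr
        W.smult_assoc1[symmetric] W.R.m_comm)
qed

lemma linear_maps_finsum:
  assumes "module K W" "finite I" "\<And>i. i \<in> I \<Longrightarrow> f i \<in> linear_maps K V W"
  shows "(\<lambda>v. \<Oplus>\<^bsub>W\<^esub>i\<in>I. f i v) \<in> linear_maps K V W"
proof -
  interpret W: module K W by fact
  show ?thesis
  proof (rule linear_mapsI)
    fix v assume v: "v \<in> carrier V"
    have c: "(\<lambda>i. f i v) \<in> I \<rightarrow> carrier W" if "v \<in> carrier V" for v
      using that linear_maps_closed[OF assms(3)] by blast
    show "(\<Oplus>\<^bsub>W\<^esub>i\<in>I. f i v) \<in> carrier W" using c v by simp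
    { fix u assume u: "u \<in> carrier V"
      have "(\<Oplus>\<^bsub>W\<^esub>i\<in>I. f i (u \<oplus>\<^bsub>V\<^esub> v)) = (\<Oplus>\<^bsub>W\<^esub>i\<in>I. f i u \<oplus>\<^bsub>W\<^esub> f i v)"
        using u v linear_maps_closed[OF assms(3)]
        by (intro W.finsum_cong') (auto simp: linear_maps_add[OF assms(3)])
      also have "\<dots> = (\<Oplus>\<^bsub>W\<^esub>i\<in>I. f i u) \<oplus>\<^bsub>W\<^esub> (\<Oplus>\<^bsub>W\<^esub>i\<in>I. f i v)"
        using c u v by (simp add: W.finsum_addf)
      finally show "(\<Oplus>\<^bsub>W\<^esub>i\<in>I. f i (u \<oplus>\<^bsub>V\<^esub> v)) = (\<Oplus>\<^bsub>W\<^esub>i\<in>I. f i u) \<oplus>\<^bsub>W\<^esub> (\<Oplus>\<^bsub>W\<^esub>i\<in>I. f i v)" . }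
    { fix a assume a: "a \<in> carrier K"
      have "(\<Oplus>\<^bsub>W\<^esub>i\<in>I. f i (a \<odot>\<^bsub>V\<^esub> v)) = (\<Oplus>\<^bsub>W\<^esub>i\<in>I. a \<odot>\<^bsub>W\<^esub> f i v)"
        using a v linear_maps_closed[OF assms(3)]
        by (intro W.finsum_cong') (auto simp: linear_maps_smult[OF assms(3)])
      also have "\<dots> = a \<odot>\<^bsub>W\<^esub> (\<Oplus>\<^bsub>W\<^esub>i\<in>I. f i v)"
        using c v a assms(2) by (simp add: W.finsum_smult_ldistr)
      finally show "(\<Oplus>\<^bsub>W\<^esub>i\<in>I. f i (a \<odot>\<^bsub>V\<^esub> v)) = a \<odot>\<^bsub>W\<^esub> (\<Oplus>\<^bsub>W\<^esub>i\<in>I. f i v)" . }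
  qed
qed

lemma linear_maps_commute_finsum:
  assumes "module K V" "module K W" "h \<in> linear_maps K V W" "f \<in> I \<rightarrow> carrier V"
  shows "h (\<Oplus>\<^bsub>V\<^esub>i\<in>I. f i) = (\<Oplus>\<^bsub>W\<^esub>i\<in>I. h (f i))"
proof -
  interpret V: module K V by fact
  interpret W: module K W by fact
  show ?thesis using assms(4)
  proof (induction I rule: infinite_finite_induct)
    case (insert i I)
    then show ?case
      using assms(3) by (simp add: Pi_def linear_maps_add linear_maps_closed)
  qed (simp_all add: linear_maps_zero[OF assms(1-3)])
qed

lemma linear_maps_plus:
  assumes "module K W" "f \<in> linear_maps K V W" "g \<in> linear_maps K V W"
  shows "(\<lambda>v. f v \<oplus>\<^bsub>W\<^esub> g v) \<in> linear_maps K V W"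
proof -
  interpret W: module K W by fact
  show ?thesis
    using linear_maps_closed[OF assms(2)] linear_maps_closed[OF assms(3)]
    by (intro linear_mapsI)
      (auto simp: linear_maps_add[OF assms(2)] linear_maps_add[OF assms(3)] W.smult_r_distr
        linear_maps_smult[OF assms(2)] linear_maps_smult[OF assms(3)] W.M.a_ac)
qed

lemma linear_maps_restrict:
  assumes "module K V" "f \<in> linear_maps K V W"
  shows "restrict f (carrier V) \<in> linear_maps K V W"
proof -
  interpret V: module K V by fact
  show ?thesis
    by (rule linear_mapsI)
      (auto simp: linear_maps_closed[OF assms(2)] linear_maps_add[OF assms(2)]
        linear_maps_smult[OF assms(2)])
qed

lemma linear_maps_inverse:
  assumes V: "module K V" and h: "h \<in> linear_maps K V W" and bij: "bij_betw h (carrier V) (carrier W)"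
  obtains g where "g \<in> linear_maps K W V" "\<And>v. v \<in> carrier V \<Longrightarrow> g (h v) = v"
    "\<And>w. w \<in> carrier W \<Longrightarrow> h (g w) = w"
proof
  interpret V: module K V by fact
  let ?g = "inv_into (carrier V) h"
  show gh: "?g (h v) = v" if "v \<in> carrier V" for v
    by (rule bij_betw_inv_into_left[OF bij that])
  show hg: "h (?g w) = w" if "w \<in> carrier W" for w
    by (rule bij_betw_inv_into_right[OF bij that])
  have g: "?g w \<in> carrier V" if "w \<in> carrier W" for w
    using bij_betwE[OF bij_betw_inv_into[OF bij]] that by blast
  show "?g \<in> linear_maps K W V"
  proof (rule linear_mapsI[OF g])
    show "?g (u \<oplus>\<^bsub>W\<^esub> w) = ?g u \<oplus>\<^bsub>V\<^esub> ?g w" if "u \<in> carrier W" "w \<in> carrier W" for u w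
      using gh[of "?g u \<oplus>\<^bsub>V\<^esub> ?g w"] linear_maps_add[OF h g[OF that(1)] g[OF that(2)]] that g hg
      by simp
    show "?g (a \<odot>\<^bsub>W\<^esub> w) = a \<odot>\<^bsub>V\<^esub> ?g w" if "a \<in> carrier K" "w \<in> carrier W" for a w
      using gh[of "a \<odot>\<^bsub>V\<^esub> ?g w"] linear_maps_smult[OF h that(1) g[OF that(2)]] that g hg by simp
  qed
qed

section \<open>Submodules: criteria, preimages, equalizers, generated submodules\<close>

lemma submoduleD:
  assumes "submodule N K M"
  shows "N \<subseteq> carrier M" "\<zero>\<^bsub>M\<^esub> \<in> N"
    and "\<And>x y. x \<in> N \<Longrightarrow> y \<in> N \<Longrightarrow> x \<oplus>\<^bsub>M\<^esub> y \<in> N"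
    and "\<And>a x. a \<in> carrier K \<Longrightarrow> x \<in> N \<Longrightarrow> a \<odot>\<^bsub>M\<^esub> x \<in> N"
  using subgroup.subset[OF submodule.axioms(1)[OF assms]]
    subgroup.one_closed[OF submodule.axioms(1)[OF assms]]
    subgroup.m_closed[OF submodule.axioms(1)[OF assms]]
    submodule.smult_closed[OF assms]
  by auto

text \<open>Closure under negatives is automatic, because the negative of x is the multiple of x by
  -1.\<close>

lemma (in module) submoduleI':
  assumes "N \<subseteq> carrier M" "\<zero>\<^bsub>M\<^esub> \<in> N"
    and "\<And>x y. x \<in> N \<Longrightarrow> y \<in> N \<Longrightarrow> x \<oplus>\<^bsub>M\<^esub> y \<in> N"
    and "\<And>a x. a \<in> carrier R \<Longrightarrow> x \<in> N \<Longrightarrow> a \<odot>\<^bsub>M\<^esub> x \<in> N"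
  shows "submodule N R M"
proof (rule submoduleI)
  fix x assume x: "x \<in> N"
  then have "x \<in> carrier M" using assms(1) by blast
  then have "\<ominus>\<^bsub>M\<^esub> x = (\<ominus> \<one>) \<odot>\<^bsub>M\<^esub> x" by (simp add: smult_l_minus)
  then show "\<ominus>\<^bsub>M\<^esub> x \<in> N" using assms(4) x by simp
qed (use assms in auto)

lemma submodule_finsum:
  assumes "module K M" "submodule N K M" "f \<in> I \<rightarrow> N"
  shows "(\<Oplus>\<^bsub>M\<^esub>i\<in>I. f i) \<in> N"
proof -
  interpret M: module K M by fact
  note N = submoduleD[OF assms(2)]
  show ?thesis using assms(3)
  proof (induction I rule: infinite_finite_induct)
    case (insert i I)
    then have "f \<in> I \<rightarrow> carrier M" "f i \<in> carrier M" using N(1) by auto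
    then show ?case using insert N by simp
  qed (use N in simp_all)
qed

lemma submodule_vimage:
  assumes "module K V" "module K W" "h \<in> linear_maps K V W" "submodule N K W"
  shows "submodule {v \<in> carrier V. h v \<in> N} K V"
proof -
  interpret V: module K V by fact
  show ?thesis
    using submoduleD[OF assms(4)] assms(3) linear_maps_zero[OF assms(1-3)]
    by (intro V.submoduleI') (auto simp: linear_maps_add linear_maps_smult)
qed

text \<open>This turns an identity between linear maps into membership in a submodule, so that every
  result about spanning sets below becomes a principle for proving identities on generators.\<close>

lemma submodule_equalizer:
  assumes "module K V" "module K W" "f \<in> linear_maps K V W" "g \<in> linear_maps K V W"
  shows "submodule {v \<in> carrier V. f v = g v} K V"
proof -
  interpret V: module K V by fact
  show ?thesis
    using assms(3,4) linear_maps_zero[OF assms(1-3)] linear_maps_zero[OF assms(1,2,4)]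
    by (intro V.submoduleI') (auto simp: linear_maps_add linear_maps_smult)
qed

lemma submodule_gen_least: "submodule N K M \<Longrightarrow> S \<subseteq> N \<Longrightarrow> submodule_gen K M S \<subseteq> N"
  unfolding submodule_gen_def by blast

lemma submodule_gen_incl: "S \<subseteq> submodule_gen K M S"
  unfolding submodule_gen_def by blast

lemma submodule_gen_submodule:
  assumes "module K M" "S \<subseteq> carrier M"
  shows "submodule (submodule_gen K M S) K M"
proof -
  interpret M: module K M by fact
  show ?thesis
  proof (rule M.submoduleI')
    show "submodule_gen K M S \<subseteq> carrier M"
      by (rule submodule_gen_least[OF M.carrier_is_submodule assms(2)])
  qed (auto simp: submodule_gen_def dest: submoduleD(2-4))
qed

section \<open>Quotient modules and their universal property\<close>

lemma quotient_module_simps: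
  "carrier (quotient_module M N) = (\<lambda>x. N +>\<^bsub>M\<^esub> x) ` carrier M"
  "monoid.mult (quotient_module M N) = rcoset_mult M N"
  "\<one>\<^bsub>quotient_module M N\<^esub> = N +>\<^bsub>M\<^esub> \<one>\<^bsub>M\<^esub>"
  "\<zero>\<^bsub>quotient_module M N\<^esub> = N"
  "add (quotient_module M N) = set_add M"
  "smult (quotient_module M N) = (\<lambda>a C. \<Union>x\<in>C. N +>\<^bsub>M\<^esub> (a \<odot>\<^bsub>M\<^esub> x))"
  unfolding quotient_module_def ring.extend_def module.fields_def FactRing_def
  by (auto simp: A_RCOSETS_defs a_r_coset_def)

lemma submodule_abelian_subgroup:
  assumes "module K M" "submodule N K M"
  shows "abelian_subgroup N M"
  using assms
  by (intro abelian_subgroupI3 additive_subgroupI) (auto simp: module_def submodule_def)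

lemma quotient_coset:
  assumes "module K M" "submodule N K M"
  shows quotient_coset_add: "\<And>x y. x \<in> carrier M \<Longrightarrow> y \<in> carrier M \<Longrightarrow>
      (N +>\<^bsub>M\<^esub> x) \<oplus>\<^bsub>quotient_module M N\<^esub> (N +>\<^bsub>M\<^esub> y) = N +>\<^bsub>M\<^esub> (x \<oplus>\<^bsub>M\<^esub> y)"
    and quotient_coset_smult: "\<And>a x. a \<in> carrier K \<Longrightarrow> x \<in> carrier M \<Longrightarrow>
      a \<odot>\<^bsub>quotient_module M N\<^esub> (N +>\<^bsub>M\<^esub> x) = N +>\<^bsub>M\<^esub> (a \<odot>\<^bsub>M\<^esub> x)"
    and quotient_coset_eq_iff: "\<And>x y. x \<in> carrier M \<Longrightarrow> y \<in> carrier M \<Longrightarrow>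
      N +>\<^bsub>M\<^esub> x = N +>\<^bsub>M\<^esub> y \<longleftrightarrow> x \<ominus>\<^bsub>M\<^esub> y \<in> N"
proof -
  interpret M: module K M by fact
  interpret N: abelian_subgroup N M using submodule_abelian_subgroup[OF assms] .
  note NN = submoduleD[OF assms(2)]
  show eq_iff: "N +>\<^bsub>M\<^esub> x = N +>\<^bsub>M\<^esub> y \<longleftrightarrow> x \<ominus>\<^bsub>M\<^esub> y \<in> N"
    if "x \<in> carrier M" "y \<in> carrier M" for x y
    using that N.a_rcos_module[OF that(2,1)] N.a_repr_independence'[of x y]
      N.a_repr_independenceD[of x y]
    unfolding M.minus_eq by blast
  show "(N +>\<^bsub>M\<^esub> x) \<oplus>\<^bsub>quotient_module M N\<^esub> (N +>\<^bsub>M\<^esub> y) = N +>\<^bsub>M\<^esub> (x \<oplus>\<^bsub>M\<^esub> y)"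
    if "x \<in> carrier M" "y \<in> carrier M" for x y
    using that by (simp add: quotient_module_simps N.a_rcos_sum)
  show "a \<odot>\<^bsub>quotient_module M N\<^esub> (N +>\<^bsub>M\<^esub> x) = N +>\<^bsub>M\<^esub> (a \<odot>\<^bsub>M\<^esub> x)"
    if a: "a \<in> carrier K" and x: "x \<in> carrier M" for a x
  proof -
    \<comment> \<open>Scalar multiplication of a coset is a union over all its representatives. All
      the cosets in that union coincide, so it collapses to a single one.\<close>
    have "N +>\<^bsub>M\<^esub> (a \<odot>\<^bsub>M\<^esub> y) = N +>\<^bsub>M\<^esub> (a \<odot>\<^bsub>M\<^esub> x)" if y_in: "y \<in> N +>\<^bsub>M\<^esub> x" for y
    proof -
      have y: "y \<in> carrier M" using N.a_elemrcos_carrier x y_in by blast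
      have "y \<ominus>\<^bsub>M\<^esub> x \<in> N" using eq_iff[OF y x] N.a_repr_independence'[OF y_in x] by argo
      then have "a \<odot>\<^bsub>M\<^esub> (y \<ominus>\<^bsub>M\<^esub> x) \<in> N" by (rule NN(4)[OF a])
      moreover have "a \<odot>\<^bsub>M\<^esub> (y \<ominus>\<^bsub>M\<^esub> x) = a \<odot>\<^bsub>M\<^esub> y \<ominus>\<^bsub>M\<^esub> a \<odot>\<^bsub>M\<^esub> x"
        unfolding a_minus_def using a x y by (simp add: M.smult_r_distr M.smult_r_minus)
      ultimately have "a \<odot>\<^bsub>M\<^esub> y \<ominus>\<^bsub>M\<^esub> a \<odot>\<^bsub>M\<^esub> x \<in> N" by argo
      then show ?thesis
        by (subst eq_iff) (use a x y in auto)
    qed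
    then have "(\<lambda>y. N +>\<^bsub>M\<^esub> (a \<odot>\<^bsub>M\<^esub> y)) ` (N +>\<^bsub>M\<^esub> x) = {N +>\<^bsub>M\<^esub> (a \<odot>\<^bsub>M\<^esub> x)}"
      using N.a_rcos_self[OF x] by blast
    then show ?thesis unfolding quotient_module_simps by simp
  qed
qed

lemma module_quotient:
  assumes "module K M" "submodule N K M"
  shows "module K (quotient_module M N)"
proof -
  interpret M: module K M by fact
  interpret N: abelian_subgroup N M using submodule_abelian_subgroup[OF assms] .
  note coset = quotient_coset_add[OF assms] quotient_coset_smult[OF assms]
  have zero: "\<zero>\<^bsub>quotient_module M N\<^esub> = N +>\<^bsub>M\<^esub> \<zero>\<^bsub>M\<^esub>"
    using N.a_subset by (simp add: quotient_module_simps)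
  have "abelian_group (quotient_module M N)"
  proof (rule abelian_groupI)
    fix C assume "C \<in> carrier (quotient_module M N)"
    then obtain x where x: "x \<in> carrier M" "C = N +>\<^bsub>M\<^esub> x" by (auto simp: quotient_module_simps)
    show "\<exists>D\<in>carrier (quotient_module M N). D \<oplus>\<^bsub>quotient_module M N\<^esub> C = \<zero>\<^bsub>quotient_module M N\<^esub>"
      using x by (intro bexI[of _ "N +>\<^bsub>M\<^esub> (\<ominus>\<^bsub>M\<^esub> x)"])
        (auto simp: coset zero M.l_neg quotient_module_simps(1))
  qed (auto simp: quotient_module_simps(1) coset zero M.a_ac)
  then show ?thesis
    by (intro moduleI M.R.cring_axioms)
      (auto simp: quotient_module_simps(1) coset M.smult_l_distr M.smult_r_distr M.smult_assoc1)
qed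

lemma quotient_proj_linear:
  assumes "module K M" "submodule N K M"
  shows "(\<lambda>x. N +>\<^bsub>M\<^esub> x) \<in> linear_maps K M (quotient_module M N)"
  using quotient_coset[OF assms] by (intro linear_mapsI) (auto simp: quotient_module_simps(1))

text \<open>The lift evaluates \<open>h\<close> at an arbitrarily chosen representative. Two
  representatives differ by an element of \<open>N\<close>, which \<open>h\<close> sends to zero, so
  the choice has no effect.\<close>

lemma quotient_lift:
  assumes "module K M" "submodule N K M" "module K X" "h \<in> linear_maps K M X"
    and "\<And>x. x \<in> N \<Longrightarrow> h x = \<zero>\<^bsub>X\<^esub>"
  obtains h' where "h' \<in> linear_maps K (quotient_module M N) X"
    and "\<And>x. x \<in> carrier M \<Longrightarrow> h' (N +>\<^bsub>M\<^esub> x) = h x"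
proof
  interpret M: module K M by fact
  interpret X: module K X by fact
  interpret N: abelian_subgroup N M using submodule_abelian_subgroup[OF assms(1,2)] .
  define h' where "h' C = h (SOME x. x \<in> C)" for C
  show h': "h' (N +>\<^bsub>M\<^esub> x) = h x" if x: "x \<in> carrier M" for x
  proof -
    define y where "y = (SOME y. y \<in> N +>\<^bsub>M\<^esub> x)"
    have "y \<in> N +>\<^bsub>M\<^esub> x" unfolding y_def by (rule someI) (rule N.a_rcos_self[OF x])
    then obtain z where z: "z \<in> N" "y = z \<oplus>\<^bsub>M\<^esub> x"
      by (auto simp: a_r_coset_def r_coset_def)
    then have "h y = h z \<oplus>\<^bsub>X\<^esub> h x" using x by (simp add: linear_maps_add[OF assms(4)])
    then show ?thesis
      using assms(5)[OF z(1)] x linear_maps_closed[OF assms(4)] by (simp add: h'_def y_def)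
  qed
  show "h' \<in> linear_maps K (quotient_module M N) X"
    using assms(4)
    by (intro linear_mapsI)
      (auto simp: quotient_module_simps(1) h' quotient_coset[OF assms(1,2)] linear_maps_closed
        linear_maps_add linear_maps_smult)
qed

section \<open>Free modules\<close>

lemma free_module_simps:
  "carrier (free_module K S) = {f. (\<forall>s\<in>S. f s \<in> carrier K) \<and> (\<forall>s. s \<notin> S \<longrightarrow> f s = \<zero>\<^bsub>K\<^esub>)
                  \<and> finite {s. f s \<noteq> \<zero>\<^bsub>K\<^esub>}}"
  "\<zero>\<^bsub>free_module K S\<^esub> = (\<lambda>s. \<zero>\<^bsub>K\<^esub>)"
  "add (free_module K S) = (\<lambda>f g s. f s \<oplus>\<^bsub>K\<^esub> g s)"
  "smult (free_module K S) = (\<lambda>a f s. a \<otimes>\<^bsub>K\<^esub> f s)"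
  unfolding free_module_def by auto

context cring
begin

lemma free_module_carrierD:
  assumes "f \<in> carrier (free_module R S)"
  shows "f s \<in> carrier R" "f s \<noteq> \<zero> \<Longrightarrow> s \<in> S" "finite {s. f s \<noteq> \<zero>}"
  using assms by (cases "s \<in> S"; auto simp: free_module_simps)+

lemma module_free_module: "module R (free_module R S)"
proof (rule moduleI)
  have fin: "finite {s. f s \<oplus> g s \<noteq> \<zero>}"
    if "f \<in> carrier (free_module R S)" "g \<in> carrier (free_module R S)" for f g
  proof (rule finite_subset)
    show "{s. f s \<oplus> g s \<noteq> \<zero>} \<subseteq> {s. f s \<noteq> \<zero>} \<union> {s. g s \<noteq> \<zero>}" by auto
    show "finite ({s. f s \<noteq> \<zero>} \<union> {s. g s \<noteq> \<zero>})"
      using that by (simp add: free_module_carrierD(3))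
  qed
  have fin': "finite {s. a \<otimes> f s \<noteq> \<zero>}"
    if "f \<in> carrier (free_module R S)" "a \<in> carrier R" for f a
    by (rule finite_subset[OF _ free_module_carrierD(3)[OF that(1)]]) (use that(2) in auto)
  show "abelian_group (free_module R S)"
  proof (rule abelian_groupI)
    fix f assume f: "f \<in> carrier (free_module R S)"
    show "\<exists>g \<in> carrier (free_module R S). g \<oplus>\<^bsub>free_module R S\<^esub> f = \<zero>\<^bsub>free_module R S\<^esub>"
    proof (rule bexI)
      show "(\<lambda>s. (\<ominus> \<one>) \<otimes> f s) \<in> carrier (free_module R S)"
        using f fin'[OF f, of "\<ominus> \<one>"] by (auto simp: free_module_simps)
      show "(\<lambda>s. (\<ominus> \<one>) \<otimes> f s) \<oplus>\<^bsub>free_module R S\<^esub> f = \<zero>\<^bsub>free_module R S\<^esub>"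
        using free_module_carrierD(1)[OF f] by (auto simp: free_module_simps l_minus l_neg)
    qed
  next
    show "f \<oplus>\<^bsub>free_module R S\<^esub> g \<in> carrier (free_module R S)"
      if "f \<in> carrier (free_module R S)" "g \<in> carrier (free_module R S)" for f g
      using that fin[OF that] by (auto simp: free_module_simps)
  next
    show "\<zero>\<^bsub>free_module R S\<^esub> \<in> carrier (free_module R S)" by (simp add: free_module_simps)
  qed (simp_all add: free_module_simps(2-) free_module_carrierD(1)[of _ S] a_ac)
  show "a \<odot>\<^bsub>free_module R S\<^esub> f \<in> carrier (free_module R S)"
    if "a \<in> carrier R" "f \<in> carrier (free_module R S)" for a f
    using that fin' by (auto simp: free_module_simps)
qed (simp_all add: free_module_simps(2-) free_module_carrierD(1)[of _ S] l_distr r_distr m_assoc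
    is_cring)

lemma basis_elt_closed: "s \<in> S \<Longrightarrow> basis_elt R s \<in> carrier (free_module R S)"
  by (auto simp: free_module_simps basis_elt_def)

text \<open>A function of finite support is reduced to zero by deleting one coordinate at a time;
  each deleted part is a multiple of a basis element.\<close>

lemma free_module_spanned:
  assumes N: "submodule N R (free_module R S)" and basis: "\<And>s. s \<in> S \<Longrightarrow> basis_elt R s \<in> N"
    and f: "f \<in> carrier (free_module R S)"
  shows "f \<in> N"
proof -
  \<comment> \<open>The induction is over a finite set that contains the support, not over the
    support itself, so a coordinate that happens to vanish needs no separate treatment;
    \<open>f\<close> has to be arbitrary because each step changes it.\<close>
  have "f \<in> N" if "finite T" "{s. f s \<noteq> \<zero>} \<subseteq> T" "f \<in> carrier (free_module R S)" for T f
    using that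
  proof (induction T arbitrary: f)
    case empty
    then have "f = (\<lambda>s. \<zero>)" by auto
    then show ?case using submoduleD(2)[OF N] by (simp add: free_module_simps)
  next
    case (insert s T)
    note D = free_module_carrierD[OF insert.prems(2)]
    define g where "g = f(s := \<zero>)"
    have g: "g \<in> N"
    proof (rule insert.IH)
      show "{t. g t \<noteq> \<zero>} \<subseteq> T" using insert.prems(1) by (auto simp: g_def)
      have "finite {t. g t \<noteq> \<zero>}"
        by (rule finite_subset[OF _ D(3)]) (auto simp: g_def)
      then show "g \<in> carrier (free_module R S)"
        using insert.prems(2) by (auto simp: free_module_simps g_def)
    qed
    show ?case
    proof (cases "s \<in> S")
      case True
      have "f = g \<oplus>\<^bsub>free_module R S\<^esub> f s \<odot>\<^bsub>free_module R S\<^esub> basis_elt R s"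
        using D(1) by (auto simp: g_def free_module_simps basis_elt_def)
      then show ?thesis
        using g basis[OF True] D(1)[of s] submoduleD(3,4)[OF N] by metis
    next
      case False
      then have "f s = \<zero>" using D(2)[of s] by blast
      then have "f = g" unfolding g_def by (metis fun_upd_triv)
      then show ?thesis using g by simp
    qed
  qed
  then show ?thesis using free_module_carrierD(3)[OF f] f by blast
qed

lemma free_module_lift:
  assumes "module R X" and h: "h \<in> S \<rightarrow> carrier X"
  obtains f where "f \<in> linear_maps R (free_module R S) X" "\<And>s. s \<in> S \<Longrightarrow> f (basis_elt R s) = h s"
proof
  interpret X: module R X by fact
  define f where "f u = (\<Oplus>\<^bsub>X\<^esub>s\<in>{s. u s \<noteq> \<zero>}. u s \<odot>\<^bsub>X\<^esub> h s)" for u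
  have hc: "(\<lambda>s. u s \<odot>\<^bsub>X\<^esub> h s) \<in> T \<rightarrow> carrier X"
    if "T \<subseteq> S" "u \<in> carrier (free_module R S)" for u T
    using that h free_module_carrierD(1)[OF that(2)] by auto
  \<comment> \<open>The support changes under sums and multiples. Letting the index set be any
    finite set between the support and \<open>S\<close> allows several functions to be summed over
    the same set; the added terms have coefficient zero.\<close>
  have f_eq: "f u = (\<Oplus>\<^bsub>X\<^esub>s\<in>T. u s \<odot>\<^bsub>X\<^esub> h s)"
    if "u \<in> carrier (free_module R S)" "finite T" "{s. u s \<noteq> \<zero>} \<subseteq> T" "T \<subseteq> S" for u T
    unfolding f_def using that hc[of T u] h
    by (intro X.add.finprod_mono_neutral_cong_left) (auto intro!: X.smult_l_null)
  interpret FM: module R "free_module R S" by (rule module_free_module)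
  show "f \<in> linear_maps R (free_module R S) X"
  proof (rule linear_mapsI)
    fix v assume v: "v \<in> carrier (free_module R S)"
    have supp: "{s. u s \<noteq> \<zero>} \<subseteq> S" if "u \<in> carrier (free_module R S)" for u
      using free_module_carrierD(2)[OF that] by blast
    show "f v \<in> carrier X" unfolding f_def using hc[OF supp[OF v] v] by simp
    { fix u assume u: "u \<in> carrier (free_module R S)"
      let ?T = "{s. u s \<noteq> \<zero>} \<union> {s. v s \<noteq> \<zero>}"
      have T: "?T \<subseteq> S" "finite ?T"
        using supp u v by (simp_all add: free_module_carrierD(3))
      have "f (u \<oplus>\<^bsub>free_module R S\<^esub> v)
        = (\<Oplus>\<^bsub>X\<^esub>s\<in>?T. (u \<oplus>\<^bsub>free_module R S\<^esub> v) s \<odot>\<^bsub>X\<^esub> h s)"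
        using T FM.M.add.m_closed[OF u v] by (intro f_eq) (auto simp: free_module_simps(3))
      also have "\<dots> = (\<Oplus>\<^bsub>X\<^esub>s\<in>?T. u s \<odot>\<^bsub>X\<^esub> h s \<oplus>\<^bsub>X\<^esub> v s \<odot>\<^bsub>X\<^esub> h s)"
      proof (rule X.finsum_cong'[OF refl])
        have "h s \<in> carrier X" if "s \<in> ?T" for s using that T(1) h by blast
        note * = this free_module_carrierD(1)[OF u] free_module_carrierD(1)[OF v]
        show "(\<lambda>s. u s \<odot>\<^bsub>X\<^esub> h s \<oplus>\<^bsub>X\<^esub> v s \<odot>\<^bsub>X\<^esub> h s) \<in> ?T \<rightarrow> carrier X"
          using * by (intro Pi_I) (simp only: X.M.add.m_closed X.smult_closed)
        show "(u \<oplus>\<^bsub>free_module R S\<^esub> v) s \<odot>\<^bsub>X\<^esub> h s = u s \<odot>\<^bsub>X\<^esub> h s \<oplus>\<^bsub>X\<^esub> v s \<odot>\<^bsub>X\<^esub> h s"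
          if "s \<in> ?T" for s
          using *(1)[OF that] *(2,3) by (simp add: free_module_simps(3) X.smult_l_distr)
      qed
      also have "\<dots> = f u \<oplus>\<^bsub>X\<^esub> f v"
        using T u v hc[OF T(1)] by (simp add: X.finsum_addf f_eq[of _ ?T])
      finally show "f (u \<oplus>\<^bsub>free_module R S\<^esub> v) = f u \<oplus>\<^bsub>X\<^esub> f v" . }
    { fix a assume a: "a \<in> carrier R"
      let ?T = "{s. v s \<noteq> \<zero>}"
      note T = supp[OF v] free_module_carrierD(3)[OF v]
      have "f (a \<odot>\<^bsub>free_module R S\<^esub> v) = (\<Oplus>\<^bsub>X\<^esub>s\<in>?T. (a \<odot>\<^bsub>free_module R S\<^esub> v) s \<odot>\<^bsub>X\<^esub> h s)"
        using a T FM.smult_closed[OF a v] by (intro f_eq) (auto simp: free_module_simps(4))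
      also have "\<dots> = (\<Oplus>\<^bsub>X\<^esub>s\<in>?T. a \<odot>\<^bsub>X\<^esub> (v s \<odot>\<^bsub>X\<^esub> h s))"
      proof (rule X.finsum_cong'[OF refl])
        have "h s \<in> carrier X" if "s \<in> ?T" for s using that T(1) h by blast
        note * = this free_module_carrierD(1)[OF v]
        show "(\<lambda>s. a \<odot>\<^bsub>X\<^esub> (v s \<odot>\<^bsub>X\<^esub> h s)) \<in> ?T \<rightarrow> carrier X"
          using * a by (intro Pi_I) (simp only: X.smult_closed)
        show "(a \<odot>\<^bsub>free_module R S\<^esub> v) s \<odot>\<^bsub>X\<^esub> h s = a \<odot>\<^bsub>X\<^esub> (v s \<odot>\<^bsub>X\<^esub> h s)"
          if "s \<in> ?T" for s
          using *(1)[OF that] *(2) a by (simp add: free_module_simps(4) X.smult_assoc1)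
      qed
      also have "\<dots> = a \<odot>\<^bsub>X\<^esub> f v"
        unfolding f_def using T hc[OF T(1) v] a by (intro X.finsum_smult_ldistr[symmetric])
      finally show "f (a \<odot>\<^bsub>free_module R S\<^esub> v) = a \<odot>\<^bsub>X\<^esub> f v" . }
  qed
  show "f (basis_elt R s) = h s" if s: "s \<in> S" for s
  proof -
    have "f (basis_elt R s) = (\<Oplus>\<^bsub>X\<^esub>t\<in>{s}. basis_elt R s t \<odot>\<^bsub>X\<^esub> h t)"
      using s by (intro f_eq basis_elt_closed) (auto simp: basis_elt_def)
    also have "\<dots> = h s" using h s by (simp add: basis_elt_def Pi_def)
    finally show ?thesis .
  qed
qed

end

section \<open>Tensor products\<close>

definition bilinear_maps ::
    "('k, 'm) ring_scheme \<Rightarrow> ('k, 'v, 'a) module_scheme \<Rightarrow> ('k, 'w, 'b) module_scheme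
      \<Rightarrow> ('k, 'x, 'c) module_scheme \<Rightarrow> ('v \<Rightarrow> 'w \<Rightarrow> 'x) set"
  where "bilinear_maps K V W X = {b. (\<forall>w\<in>carrier W. (\<lambda>v. b v w) \<in> linear_maps K V X)
    \<and> (\<forall>v\<in>carrier V. b v \<in> linear_maps K W X)}"

lemma bilinear_mapsI:
  assumes "\<And>w. w \<in> carrier W \<Longrightarrow> (\<lambda>v. b v w) \<in> linear_maps K V X"
    and "\<And>v. v \<in> carrier V \<Longrightarrow> b v \<in> linear_maps K W X"
  shows "b \<in> bilinear_maps K V W X"
  using assms unfolding bilinear_maps_def by blast

lemma bilinear_maps_left: "b \<in> bilinear_maps K V W X \<Longrightarrow> w \<in> carrier W
    \<Longrightarrow> (\<lambda>v. b v w) \<in> linear_maps K V X"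
  and bilinear_maps_right: "b \<in> bilinear_maps K V W X \<Longrightarrow> v \<in> carrier V
    \<Longrightarrow> b v \<in> linear_maps K W X"
  unfolding bilinear_maps_def by auto

lemma bilinear_maps_flip:
  "b \<in> bilinear_maps K V W X \<Longrightarrow> (\<lambda>w v. b v w) \<in> bilinear_maps K W V X"
  unfolding bilinear_maps_def by auto

lemma bilinear_maps_closed:
  "b \<in> bilinear_maps K V W X \<Longrightarrow> v \<in> carrier V \<Longrightarrow> w \<in> carrier W \<Longrightarrow> b v w \<in> carrier X"
  by (rule linear_maps_closed[OF bilinear_maps_right])

lemma bilinear_maps_comp:
  assumes "b \<in> bilinear_maps K V' W' X" "f \<in> linear_maps K V V'" "g \<in> linear_maps K W W'"
  shows "(\<lambda>v w. b (f v) (g w)) \<in> bilinear_maps K V W X"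
proof (rule bilinear_mapsI)
  show "(\<lambda>v. b (f v) (g w)) \<in> linear_maps K V X" if "w \<in> carrier W" for w
    by (rule linear_maps_comp[OF assms(2) bilinear_maps_left[OF assms(1)]])
      (rule linear_maps_closed[OF assms(3) that])
  show "(\<lambda>w. b (f v) (g w)) \<in> linear_maps K W X" if "v \<in> carrier V" for v
    by (rule linear_maps_comp[OF assms(3) bilinear_maps_right[OF assms(1)]])
      (rule linear_maps_closed[OF assms(2) that])
qed

section \<open>The tensor product as a quotient of a free module\<close>

lemma bilinear_relators_closed:
  assumes "module K V" "module K W"
  shows "bilinear_relators K V W \<subseteq> carrier (free_module K (carrier V \<times> carrier W))"
proof -
  interpret V: module K V by fact
  interpret W: module K W by fact
  interpret M: module K "free_module K (carrier V \<times> carrier W)"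
    by (rule V.R.module_free_module)
  show ?thesis
    unfolding bilinear_relators_def Let_def
    by (auto intro!: M.M.minus_closed M.M.add.m_closed M.smult_closed V.R.basis_elt_closed)
qed

lemma tensor_relations_submodule:
  assumes "module K V" "module K W"
  shows "submodule (tensor_relations K V W) K (free_module K (carrier V \<times> carrier W))"
proof -
  interpret V: module K V by fact
  show ?thesis
    unfolding tensor_relations_def
    by (rule submodule_gen_submodule[OF V.R.module_free_module bilinear_relators_closed[OF assms]])
qed

lemma module_tensor_space:
  assumes "module K V" "module K W"
  shows "module K (tensor_space K V W)"
proof -
  interpret V: module K V by fact
  show ?thesis
    unfolding tensor_space_def
    by (rule module_quotient[OF V.R.module_free_module tensor_relations_submodule[OF assms]])
qed

text \<open>Each clause of bilinearity is one family of relators, read as an equality of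
  cosets.\<close>

lemma pure_tensor_bilinear:
  assumes "module K V" "module K W"
  shows "pure_tensor K V W \<in> bilinear_maps K V W (tensor_space K V W)"
proof -
  interpret V: module K V by fact
  interpret W: module K W by fact
  let ?M = "free_module K (carrier V \<times> carrier W)"
  let ?N = "tensor_relations K V W"
  interpret M: module K ?M by (rule V.R.module_free_module)
  let ?d = "\<lambda>v w. basis_elt K (v, w)"
  note N = tensor_relations_submodule[OF assms]
  note coset = quotient_coset[OF M.module_axioms N]
  have rel: "r \<in> ?N" if "r \<in> bilinear_relators K V W" for r
    unfolding tensor_relations_def by (rule subsetD[OF submodule_gen_incl that])
  have d: "?d v w \<in> carrier ?M" if "v \<in> carrier V" "w \<in> carrier W" for v w
    using that by (intro V.R.basis_elt_closed) auto
  have closed: "pure_tensor K V W v w \<in> carrier (tensor_space K V W)"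
    if "v \<in> carrier V" "w \<in> carrier W" for v w
    unfolding pure_tensor_def tensor_space_def quotient_module_simps by (rule imageI[OF d[OF that]])
  show ?thesis
  proof (rule bilinear_mapsI)
    fix w assume w: "w \<in> carrier W"
    show "(\<lambda>v. pure_tensor K V W v w) \<in> linear_maps K V (tensor_space K V W)"
    proof (rule linear_mapsI)
      fix v assume v: "v \<in> carrier V"
      show "pure_tensor K V W v w \<in> carrier (tensor_space K V W)" using v w by (rule closed)
      { fix u assume u: "u \<in> carrier V"
        have "?d (u \<oplus>\<^bsub>V\<^esub> v) w \<ominus>\<^bsub>?M\<^esub> (?d u w \<oplus>\<^bsub>?M\<^esub> ?d v w) \<in> ?N"
          using u v w by (intro rel) (auto simp: bilinear_relators_def Let_def)
        then show "pure_tensor K V W (u \<oplus>\<^bsub>V\<^esub> v) w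
            = pure_tensor K V W u w \<oplus>\<^bsub>tensor_space K V W\<^esub> pure_tensor K V W v w"
          unfolding pure_tensor_def tensor_space_def
          by (subst coset(1)) (simp_all add: coset(3) d u v w) }
      { fix a assume a: "a \<in> carrier K"
        have "?d (a \<odot>\<^bsub>V\<^esub> v) w \<ominus>\<^bsub>?M\<^esub> a \<odot>\<^bsub>?M\<^esub> ?d v w \<in> ?N"
          using a v w by (intro rel) (auto simp: bilinear_relators_def Let_def)
        then show "pure_tensor K V W (a \<odot>\<^bsub>V\<^esub> v) w = a \<odot>\<^bsub>tensor_space K V W\<^esub> pure_tensor K V W v w"
          unfolding pure_tensor_def tensor_space_def
          by (subst coset(2)) (simp_all add: coset(3) d a v w) }
    qed
  next
    fix v assume v: "v \<in> carrier V"
    show "pure_tensor K V W v \<in> linear_maps K W (tensor_space K V W)"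
    proof (rule linear_mapsI)
      fix w assume w: "w \<in> carrier W"
      show "pure_tensor K V W v w \<in> carrier (tensor_space K V W)" using v w by (rule closed)
      { fix u assume u: "u \<in> carrier W"
        have "?d v (u \<oplus>\<^bsub>W\<^esub> w) \<ominus>\<^bsub>?M\<^esub> (?d v u \<oplus>\<^bsub>?M\<^esub> ?d v w) \<in> ?N"
          using u v w by (intro rel) (auto simp: bilinear_relators_def Let_def)
        then show "pure_tensor K V W v (u \<oplus>\<^bsub>W\<^esub> w)
            = pure_tensor K V W v u \<oplus>\<^bsub>tensor_space K V W\<^esub> pure_tensor K V W v w"
          unfolding pure_tensor_def tensor_space_def
          by (subst coset(1)) (simp_all add: coset(3) d u v w) }
      { fix a assume a: "a \<in> carrier K"
        have "?d v (a \<odot>\<^bsub>W\<^esub> w) \<ominus>\<^bsub>?M\<^esub> a \<odot>\<^bsub>?M\<^esub> ?d v w \<in> ?N"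
          using a v w by (intro rel) (auto simp: bilinear_relators_def Let_def)
        then show "pure_tensor K V W v (a \<odot>\<^bsub>W\<^esub> w) = a \<odot>\<^bsub>tensor_space K V W\<^esub> pure_tensor K V W v w"
          unfolding pure_tensor_def tensor_space_def
          by (subst coset(2)) (simp_all add: coset(3) d a v w) }
    qed
  qed
qed

lemmas pure_tensor_closed = bilinear_maps_closed[OF pure_tensor_bilinear]

text \<open>The preimage of \<open>N\<close> under the projection from the free module is a
  submodule that contains every basis element, hence is everything.\<close>

lemma tensor_space_spanned:
  assumes V: "module K V" and W: "module K W" and N: "submodule N K (tensor_space K V W)"
    and pure: "\<And>v w. v \<in> carrier V \<Longrightarrow> w \<in> carrier W \<Longrightarrow> pure_tensor K V W v w \<in> N"
    and t: "t \<in> carrier (tensor_space K V W)"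
  shows "t \<in> N"
proof -
  interpret V: module K V by fact
  let ?M = "free_module K (carrier V \<times> carrier W)"
  let ?p = "\<lambda>x. tensor_relations K V W +>\<^bsub>?M\<^esub> x"
  note R = tensor_relations_submodule[OF V W]
  have p: "?p \<in> linear_maps K ?M (tensor_space K V W)"
    unfolding tensor_space_def by (rule quotient_proj_linear[OF V.R.module_free_module R])
  obtain f where f: "f \<in> carrier ?M" "t = ?p f"
    using t unfolding tensor_space_def quotient_module_simps by blast
  have "f \<in> {x \<in> carrier ?M. ?p x \<in> N}"
  proof (rule V.R.free_module_spanned[OF _ _ f(1)])
    show "submodule {x \<in> carrier ?M. ?p x \<in> N} K ?M"
      by (rule submodule_vimage[OF V.R.module_free_module module_tensor_space[OF V W] p N])
    show "basis_elt K s \<in> {x \<in> carrier ?M. ?p x \<in> N}" if "s \<in> carrier V \<times> carrier W" for s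
      using that pure by (auto simp: pure_tensor_def V.R.basis_elt_closed)
  qed
  then show ?thesis using f(2) by simp
qed

lemma linear_maps_eq_on_tensor:
  assumes V: "module K V" and W: "module K W" and X: "module K X"
    and f: "f \<in> linear_maps K (tensor_space K V W) X"
    and g: "g \<in> linear_maps K (tensor_space K V W) X"
    and eq: "\<And>v w. v \<in> carrier V \<Longrightarrow> w \<in> carrier W \<Longrightarrow>
      f (pure_tensor K V W v w) = g (pure_tensor K V W v w)"
    and t: "t \<in> carrier (tensor_space K V W)"
  shows "f t = g t"
  using tensor_space_spanned[OF V W submodule_equalizer[OF module_tensor_space[OF V W] X f g] _ t]
    eq pure_tensor_closed[OF V W] by simp

text \<open>The existence half of the universal property. The linear extension of \<open>b\<close>
  to the free module kills every relator because \<open>b\<close> is bilinear; its kernel is a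
  submodule, so it contains the submodule generated by them and the map descends to the
  quotient.\<close>

lemma tensor_lift_exists:
  assumes V: "module K V" and W: "module K W" and X: "module K X"
    and b: "b \<in> bilinear_maps K V W X"
  obtains h where "h \<in> linear_maps K (tensor_space K V W) X"
    and "\<And>v w. v \<in> carrier V \<Longrightarrow> w \<in> carrier W \<Longrightarrow> h (pure_tensor K V W v w) = b v w"
proof -
  interpret V: module K V by fact
  interpret W: module K W by fact
  interpret X: module K X by fact
  let ?M = "free_module K (carrier V \<times> carrier W)"
  interpret M: module K ?M by (rule V.R.module_free_module)
  note bl = bilinear_maps_left[OF b] and br = bilinear_maps_right[OF b]
  have bc: "b v w \<in> carrier X" if "v \<in> carrier V" "w \<in> carrier W" for v w
    using bilinear_maps_closed[OF b that] .
  have "case_prod b \<in> carrier V \<times> carrier W \<rightarrow> carrier X" using bc by auto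
  then obtain f where f: "f \<in> linear_maps K ?M X"
    and fb: "\<And>s. s \<in> carrier V \<times> carrier W \<Longrightarrow> f (basis_elt K s) = case_prod b s"
    using V.R.free_module_lift[OF X] by blast
  have fd: "f (basis_elt K (v, w)) = b v w" if "v \<in> carrier V" "w \<in> carrier W" for v w
    using fb[of "(v, w)"] that by simp
  have minus: "f (x \<ominus>\<^bsub>?M\<^esub> y) = \<zero>\<^bsub>X\<^esub>"
    if "x \<in> carrier ?M" "y \<in> carrier ?M" "f x = f y" for x y
  proof -
    have "f (x \<ominus>\<^bsub>?M\<^esub> y) \<oplus>\<^bsub>X\<^esub> f y = f ((x \<ominus>\<^bsub>?M\<^esub> y) \<oplus>\<^bsub>?M\<^esub> y)"
      using that by (intro linear_maps_add[OF f, symmetric]) auto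
    also have "(x \<ominus>\<^bsub>?M\<^esub> y) \<oplus>\<^bsub>?M\<^esub> y = x"
      using that by (simp add: a_minus_def M.M.a_assoc M.M.l_neg)
    finally show ?thesis
      using that linear_maps_closed[OF f] X.M.add.r_cancel_one by (metis M.M.minus_closed)
  qed
  have d: "basis_elt K (v, w) \<in> carrier ?M" if "v \<in> carrier V" "w \<in> carrier W" for v w
    using that by (intro V.R.basis_elt_closed) auto
  have "bilinear_relators K V W \<subseteq> {x \<in> carrier ?M. f x = \<zero>\<^bsub>X\<^esub>}"
  proof
    fix r assume r: "r \<in> bilinear_relators K V W"
    then have "f r = \<zero>\<^bsub>X\<^esub>"
      unfolding bilinear_relators_def Let_def
      by (auto intro!: minus simp: d fd linear_maps_add[OF f] linear_maps_smult[OF f]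
          linear_maps_add[OF bl] linear_maps_smult[OF bl]
          linear_maps_add[OF br] linear_maps_smult[OF br])
    then show "r \<in> {x \<in> carrier ?M. f x = \<zero>\<^bsub>X\<^esub>}"
      using r bilinear_relators_closed[OF V W] by auto
  qed
  moreover have "submodule {x \<in> carrier ?M. f x \<in> {\<zero>\<^bsub>X\<^esub>}} K ?M"
    by (rule submodule_vimage[OF M.module_axioms X f X.submoduleI']) auto
  ultimately have "tensor_relations K V W \<subseteq> {x \<in> carrier ?M. f x = \<zero>\<^bsub>X\<^esub>}"
    unfolding tensor_relations_def by (intro submodule_gen_least) simp_all
  then have "f x = \<zero>\<^bsub>X\<^esub>" if "x \<in> tensor_relations K V W" for x using that by blast
  then obtain h where "h \<in> linear_maps K (tensor_space K V W) X"
    and "\<And>x. x \<in> carrier ?M \<Longrightarrow> h (tensor_relations K V W +>\<^bsub>?M\<^esub> x) = f x"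
    using quotient_lift[OF M.module_axioms tensor_relations_submodule[OF V W] X f]
    unfolding tensor_space_def by blast
  then show thesis using that d fd unfolding pure_tensor_def by simp
qed

text \<open>Justifies the definite description behind \<open>tensor_lift\<close>. Agreement on pure
  tensors forces agreement on the carrier, and extensionality fixes the values outside it, where
  linearity says nothing; together they make the lift a unique function.\<close>

lemma tensor_lift:
  assumes V: "module K V" and W: "module K W" and X: "module K X"
    and b: "b \<in> bilinear_maps K V W X"
  shows tensor_lift_linear: "tensor_lift K V W X b \<in> linear_maps K (tensor_space K V W) X"
    and tensor_lift_pure: "\<And>v w. v \<in> carrier V \<Longrightarrow> w \<in> carrier W \<Longrightarrow>
      tensor_lift K V W X b (pure_tensor K V W v w) = b v w"
proof -
  let ?T = "tensor_space K V W"
  let ?P = "\<lambda>h. h \<in> linear_maps K ?T X \<and> h \<in> extensional (carrier ?T)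
      \<and> (\<forall>v\<in>carrier V. \<forall>w\<in>carrier W. h (pure_tensor K V W v w) = b v w)"
  have "\<exists>!h. ?P h"
  proof -
    obtain h where h: "h \<in> linear_maps K ?T X"
      "\<And>v w. v \<in> carrier V \<Longrightarrow> w \<in> carrier W \<Longrightarrow> h (pure_tensor K V W v w) = b v w"
      using tensor_lift_exists[OF assms] by blast
    show ?thesis
    proof (rule ex1I)
      show "?P (restrict h (carrier ?T))"
        using h linear_maps_restrict[OF module_tensor_space[OF V W] h(1)]
          pure_tensor_closed[OF V W] by simp
      fix g assume g: "?P g"
      show "g = restrict h (carrier ?T)"
      proof (rule extensionalityI)
        show "g \<in> extensional (carrier ?T)" using g by blast
        show "g t = restrict h (carrier ?T) t" if "t \<in> carrier ?T" for t
          using that linear_maps_eq_on_tensor[OF V W X _ h(1) _ that, of g] g h(2) by simp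
      qed simp
    qed
  qed
  from theI'[OF this] show "tensor_lift K V W X b \<in> linear_maps K ?T X"
    and "\<And>v w. v \<in> carrier V \<Longrightarrow> w \<in> carrier W \<Longrightarrow>
      tensor_lift K V W X b (pure_tensor K V W v w) = b v w"
    unfolding tensor_lift_def by auto
qed

section \<open>Tensor products of maps and the associator\<close>

lemma tensor_map:
  assumes V: "module K V" and W: "module K W" and X: "module K X" and Y: "module K Y"
    and f: "f \<in> linear_maps K V X" and g: "g \<in> linear_maps K W Y"
  shows tensor_map_linear:
      "tensor_map K V W X Y f g \<in> linear_maps K (tensor_space K V W) (tensor_space K X Y)"
    and tensor_map_pure: "\<And>v w. v \<in> carrier V \<Longrightarrow> w \<in> carrier W \<Longrightarrow>
      tensor_map K V W X Y f g (pure_tensor K V W v w) = pure_tensor K X Y (f v) (g w)"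
proof -
  note b = bilinear_maps_comp[OF pure_tensor_bilinear[OF X Y] f g]
  show "tensor_map K V W X Y f g \<in> linear_maps K (tensor_space K V W) (tensor_space K X Y)"
    unfolding tensor_map_def by (rule tensor_lift_linear[OF V W module_tensor_space[OF X Y] b])
  show "tensor_map K V W X Y f g (pure_tensor K V W v w) = pure_tensor K X Y (f v) (g w)"
    if "v \<in> carrier V" "w \<in> carrier W" for v w
    unfolding tensor_map_def using that
    by (rule tensor_lift_pure[OF V W module_tensor_space[OF X Y] b])
qed

text \<open>The associator is a lift of lifts: for fixed w the inner lift handles u and v, and the
  result must then be shown linear in w. The inner lift is known explicitly only on pure tensors, so
  additivity and homogeneity in w are treated as identities between linear maps in the tensor t and
  checked on pure tensors.\<close>

lemma tensor_assoc:
  assumes U: "module K U" and V: "module K V" and W: "module K W"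
  shows tensor_assoc_linear: "tensor_assoc K U V W \<in>
      linear_maps K (tensor_space K (tensor_space K U V) W) (tensor_space K U (tensor_space K V W))"
    and tensor_assoc_pure: "\<And>u v w. u \<in> carrier U \<Longrightarrow> v \<in> carrier V \<Longrightarrow> w \<in> carrier W \<Longrightarrow>
      tensor_assoc K U V W (pure_tensor K (tensor_space K U V) W (pure_tensor K U V u v) w)
        = pure_tensor K U (tensor_space K V W) u (pure_tensor K V W v w)"
proof -
  let ?UV = "tensor_space K U V" and ?VW = "tensor_space K V W"
  let ?T = "tensor_space K U ?VW"
  note UV = module_tensor_space[OF U V] and VW = module_tensor_space[OF V W]
  note T = module_tensor_space[OF U VW]
  define b where "b w u v = pure_tensor K U ?VW u (pure_tensor K V W v w)" for w u v
  have bil: "b w \<in> bilinear_maps K U V ?T" if "w \<in> carrier W" for w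
    unfolding b_def
    by (rule bilinear_maps_comp[OF pure_tensor_bilinear[OF U VW] linear_maps_id])
      (rule bilinear_maps_left[OF pure_tensor_bilinear[OF V W] that])
  define c where "c t w = tensor_lift K U V ?T (b w) t" for t w
  have c_lin: "(\<lambda>t. c t w) \<in> linear_maps K ?UV ?T" if "w \<in> carrier W" for w
    unfolding c_def using tensor_lift_linear[OF U V T bil[OF that]] .
  have c_pure: "c (pure_tensor K U V u v) w = b w u v"
    if "u \<in> carrier U" "v \<in> carrier V" "w \<in> carrier W" for u v w
    unfolding c_def using tensor_lift_pure[OF U V T bil[OF that(3)] that(1,2)] .
  have b_lin: "(\<lambda>w. b w u v) \<in> linear_maps K W ?T" if "u \<in> carrier U" "v \<in> carrier V" for u v
    unfolding b_def
    by (rule linear_maps_comp[OF bilinear_maps_right[OF pure_tensor_bilinear[OF V W] that(2)]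
          bilinear_maps_right[OF pure_tensor_bilinear[OF U VW] that(1)]])
  interpret W: module K W by fact
  have cbil: "c \<in> bilinear_maps K ?UV W ?T"
  proof (rule bilinear_mapsI[OF c_lin])
    fix t assume t: "t \<in> carrier ?UV"
    show "c t \<in> linear_maps K W ?T"
    proof (rule linear_mapsI)
      fix w assume w: "w \<in> carrier W"
      show "c t w \<in> carrier ?T" using linear_maps_closed[OF c_lin[OF w] t] .
      { fix z assume z: "z \<in> carrier W"
        show "c t (z \<oplus>\<^bsub>W\<^esub> w) = c t z \<oplus>\<^bsub>?T\<^esub> c t w"
        proof (rule linear_maps_eq_on_tensor[OF U V T c_lin linear_maps_plus[OF T c_lin c_lin] _ t])
          show "c (pure_tensor K U V u v) (z \<oplus>\<^bsub>W\<^esub> w)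
              = c (pure_tensor K U V u v) z \<oplus>\<^bsub>?T\<^esub> c (pure_tensor K U V u v) w"
            if "u \<in> carrier U" "v \<in> carrier V" for u v
            using that z w linear_maps_add[OF b_lin[OF that]] by (simp add: c_pure)
        qed (use z w in auto) }
      { fix a assume a: "a \<in> carrier K"
        show "c t (a \<odot>\<^bsub>W\<^esub> w) = a \<odot>\<^bsub>?T\<^esub> c t w"
        proof (rule linear_maps_eq_on_tensor[OF U V T c_lin linear_maps_scale[OF T c_lin] _ t])
          show "c (pure_tensor K U V u v) (a \<odot>\<^bsub>W\<^esub> w) = a \<odot>\<^bsub>?T\<^esub> c (pure_tensor K U V u v) w"
            if "u \<in> carrier U" "v \<in> carrier V" for u v
            using that a w linear_maps_smult[OF b_lin[OF that]] by (simp add: c_pure)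
        qed (use a w in auto) }
    qed
  qed
  have assoc: "tensor_assoc K U V W = tensor_lift K ?UV W ?T c"
    unfolding tensor_assoc_def Let_def c_def b_def ..
  show "tensor_assoc K U V W \<in> linear_maps K (tensor_space K ?UV W) ?T"
    unfolding assoc by (rule tensor_lift_linear[OF UV W T cbil])
  show "tensor_assoc K U V W (pure_tensor K ?UV W (pure_tensor K U V u v) w)
        = pure_tensor K U ?VW u (pure_tensor K V W v w)"
    if "u \<in> carrier U" "v \<in> carrier V" "w \<in> carrier W" for u v w
    unfolding assoc using that
    by (simp add: tensor_lift_pure[OF UV W T cbil] pure_tensor_closed[OF U V] c_pure b_def)
qed

section \<open>Graded spaces\<close>

lemma with_grading_simps [simp]:
  "carrier (with_grading M gr) = carrier M"
  "monoid.mult (with_grading M gr) = monoid.mult M"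
  "one (with_grading M gr) = one M"
  "zero (with_grading M gr) = zero M"
  "add (with_grading M gr) = add M"
  "smult (with_grading M gr) = smult M"
  "grade (with_grading M gr) = gr"
  unfolding with_grading_def module.extend_def graded_module.fields_def by auto

text \<open>Carries the module property across record types: from a module to its graded extension,
  and from a free module to the twisted algebra built on it.\<close>

lemma module_congI:
  assumes "module K M" "carrier M' = carrier M" "zero M' = zero M" "add M' = add M"
    "smult M' = smult M"
  shows "module K M'"
proof -
  interpret M: module K M by fact
  have "abelian_group M'"
    by (rule abelian_groupI)
      (use abelian_groupE[OF M.abelian_group_axioms] in \<open>simp_all add: assms(2-)\<close>)
  then show ?thesis
    by (rule moduleI[OF M.R.is_cring])
      (simp_all add: assms(2-) M.smult_l_distr M.smult_r_distr M.smult_assoc1)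
qed

lemma module_with_grading: "module K M \<Longrightarrow> module K (with_grading M gr)"
  by (rule module_congI) auto

lemma linear_maps_with_grading [simp]:
  "linear_maps K (with_grading M gr) W = linear_maps K M W"
  "linear_maps K V (with_grading M gr) = linear_maps K V M"
  unfolding linear_maps_def by auto

text \<open>The relators see only the carrier, addition and scalars, which a grading leaves alone.
  Results about plain tensor products therefore apply to iterated graded ones by
  simplification.\<close>

lemma tensor_relations_with_grading [simp]:
  "tensor_relations K (with_grading M gr) W = tensor_relations K M W"
  "tensor_relations K V (with_grading M gr) = tensor_relations K V M"
  unfolding tensor_relations_def bilinear_relators_def by simp_all

lemma tensor_space_with_grading [simp]:
  "tensor_space K (with_grading M gr) W = tensor_space K M W"
  "tensor_space K V (with_grading M gr) = tensor_space K V M"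
  unfolding tensor_space_def by simp_all

lemma pure_tensor_with_grading [simp]:
  "pure_tensor K (with_grading M gr) W = pure_tensor K M W"
  "pure_tensor K V (with_grading M gr) = pure_tensor K V M"
  unfolding pure_tensor_def fun_eq_iff by simp_all

lemma submodule_with_grading_iff:
  assumes "module K M"
  shows "submodule N K (with_grading M gr) \<longleftrightarrow> submodule N K M"
proof
  show "submodule N K M" if "submodule N K (with_grading M gr)"
    using submoduleD[OF that] by (intro module.submoduleI'[OF assms]) simp_all
  show "submodule N K (with_grading M gr)" if "submodule N K M"
    using submoduleD[OF that] by (intro module.submoduleI'[OF module_with_grading[OF assms]]) simp_all
qed

section \<open>Homogeneous decompositions and projections\<close>

lemma graded_space_module: "graded_space K G V \<Longrightarrow> module K V"
  and grade_submodule: "graded_space K G V \<Longrightarrow> x \<in> carrier G \<Longrightarrow> submodule (grade V x) K V"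
  unfolding graded_space_def by auto

lemma grade_closed: "graded_space K G V \<Longrightarrow> x \<in> carrier G \<Longrightarrow> v \<in> grade V x \<Longrightarrow> v \<in> carrier V"
  by (rule subsetD[OF submoduleD(1)[OF grade_submodule]])

text \<open>Gradings are defined by sums over the nonzero components, which makes sense for infinite
  groups. Over a finite group this turns them into sums over the whole group, whose index set no
  longer depends on the vector.\<close>

lemma finsum_support:
  assumes "module K V" "finite I" "c \<in> I \<rightarrow> carrier V"
  shows "(\<Oplus>\<^bsub>V\<^esub>x\<in>{x \<in> I. c x \<noteq> \<zero>\<^bsub>V\<^esub>}. c x) = (\<Oplus>\<^bsub>V\<^esub>x\<in>I. c x)"
proof -
  interpret V: module K V by fact
  show ?thesis
    using assms(2,3) by (intro V.add.finprod_mono_neutral_cong_left) auto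
qed

text \<open>A grading by a finite set amounts to linear projections that sum to the identity and act
  on homogeneous elements as a Kronecker delta. The projections of v give a decomposition; applying
  \<open>P y\<close> to any other decomposition isolates its component of degree y, which proves
  uniqueness.\<close>

lemma graded_spaceI:
  assumes V: "module K V" and fin: "finite (carrier G)"
    and sub: "\<And>x. x \<in> carrier G \<Longrightarrow> submodule (grade V x) K V"
    and P: "\<And>x. x \<in> carrier G \<Longrightarrow> P x \<in> linear_maps K V V"
    and P_grade: "\<And>x v. x \<in> carrier G \<Longrightarrow> v \<in> carrier V \<Longrightarrow> P x v \<in> grade V x"
    and P_sum: "\<And>v. v \<in> carrier V \<Longrightarrow> (\<Oplus>\<^bsub>V\<^esub>x\<in>carrier G. P x v) = v"
    and P_homogeneous: "\<And>x y v. x \<in> carrier G \<Longrightarrow> y \<in> carrier G \<Longrightarrow> v \<in> grade V y \<Longrightarrow>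
      P x v = (if y = x then v else \<zero>\<^bsub>V\<^esub>)"
  shows "graded_space K G V"
  unfolding graded_space_def
proof (intro conjI ballI V sub)
  interpret V: module K V by fact
  fix v assume v: "v \<in> carrier V"
  have grade_carrier: "u \<in> carrier V" if "x \<in> carrier G" "u \<in> grade V x" for x u
    using submoduleD(1)[OF sub[OF that(1)]] that(2) by blast
  let ?Q = "\<lambda>c. c \<in> (\<Pi>\<^sub>E x\<in>carrier G. grade V x) \<and> finite {x \<in> carrier G. c x \<noteq> \<zero>\<^bsub>V\<^esub>}
          \<and> v = (\<Oplus>\<^bsub>V\<^esub>x\<in>{x \<in> carrier G. c x \<noteq> \<zero>\<^bsub>V\<^esub>}. c x)"
  show "\<exists>!c. ?Q c"
  proof (rule ex1I)
    let ?c = "\<lambda>x\<in>carrier G. P x v"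
    have c: "?c \<in> carrier G \<rightarrow> carrier V" using linear_maps_closed[OF P v] by auto
    have "(\<Oplus>\<^bsub>V\<^esub>x\<in>{x \<in> carrier G. ?c x \<noteq> \<zero>\<^bsub>V\<^esub>}. ?c x) = (\<Oplus>\<^bsub>V\<^esub>x\<in>carrier G. ?c x)"
      by (rule finsum_support[OF V fin c])
    also have "\<dots> = (\<Oplus>\<^bsub>V\<^esub>x\<in>carrier G. P x v)"
      using linear_maps_closed[OF P v] by (intro V.finsum_cong') auto
    finally show "?Q ?c" using fin v P_grade P_sum by auto
  next
    fix c assume c: "?Q c"
    have c_grade: "c x \<in> grade V x" if "x \<in> carrier G" for x using c that by auto
    have cc: "c \<in> carrier G \<rightarrow> carrier V" using c_grade grade_carrier by blast
    have v_eq: "v = (\<Oplus>\<^bsub>V\<^esub>x\<in>carrier G. c x)" using c finsum_support[OF V fin cc] by metis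
    have "c y = P y v" if y: "y \<in> carrier G" for y
    proof -
      have "P y v = (\<Oplus>\<^bsub>V\<^esub>x\<in>carrier G. P y (c x))"
        unfolding v_eq by (rule linear_maps_commute_finsum[OF V V P[OF y] cc])
      also have "\<dots> = (\<Oplus>\<^bsub>V\<^esub>x\<in>carrier G. if y = x then c x else \<zero>\<^bsub>V\<^esub>)"
        using P_homogeneous[OF y] c_grade cc by (intro V.finsum_cong') auto
      also have "\<dots> = c y" by (rule V.finsum_singleton[OF y fin cc])
      finally show ?thesis by simp
    qed
    then show "c = (\<lambda>x\<in>carrier G. P x v)"
      using c by (intro extensionalityI[of _ "carrier G"]) (auto simp: PiE_def)
  qed
qed

text \<open>The converse of \<open>graded_spaceI\<close>: \<open>P x v\<close> is the component of
  degree x in the unique decomposition of v.\<close>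

lemma homogeneous_projections:
  assumes gr: "graded_space K G V" and fin: "finite (carrier G)"
  obtains P where "\<And>x. x \<in> carrier G \<Longrightarrow> P x \<in> linear_maps K V V"
    and "\<And>x v. x \<in> carrier G \<Longrightarrow> v \<in> carrier V \<Longrightarrow> P x v \<in> grade V x"
    and "\<And>v. v \<in> carrier V \<Longrightarrow> (\<Oplus>\<^bsub>V\<^esub>x\<in>carrier G. P x v) = v"
    and "\<And>x y v. x \<in> carrier G \<Longrightarrow> y \<in> carrier G \<Longrightarrow> v \<in> grade V y \<Longrightarrow>
      P x v = (if y = x then v else \<zero>\<^bsub>V\<^esub>)"
proof -
  note V = graded_space_module[OF gr]
  interpret V: module K V by fact
  note sub = submoduleD[OF grade_submodule[OF gr]]
  let ?D = "\<lambda>v c. c \<in> (\<Pi>\<^sub>E x\<in>carrier G. grade V x) \<and> v = (\<Oplus>\<^bsub>V\<^esub>x\<in>carrier G. c x)"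
  have ex1: "\<exists>!c. ?D v c" if v: "v \<in> carrier V" for v
  proof -
    have D_iff: "?D v c \<longleftrightarrow> c \<in> (\<Pi>\<^sub>E x\<in>carrier G. grade V x) \<and> finite {x \<in> carrier G. c x \<noteq> \<zero>\<^bsub>V\<^esub>}
          \<and> v = (\<Oplus>\<^bsub>V\<^esub>x\<in>{x \<in> carrier G. c x \<noteq> \<zero>\<^bsub>V\<^esub>}. c x)" for c
    proof (cases "c \<in> (\<Pi>\<^sub>E x\<in>carrier G. grade V x)")
      case True
      then have "c \<in> carrier G \<rightarrow> carrier V" using sub(1) by (auto simp: PiE_iff Pi_iff)
      from finsum_support[OF V fin this] show ?thesis using fin by simp
    qed simp
    show ?thesis unfolding D_iff using gr v unfolding graded_space_def by simp
  qed
  define c where "c v = (THE c. ?D v c)" for v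
  have c: "?D v (c v)" if "v \<in> carrier V" for v
    unfolding c_def by (rule theI'[OF ex1[OF that]])
  have c_grade: "c v x \<in> grade V x" if "v \<in> carrier V" "x \<in> carrier G" for v x
    using c[OF that(1)] that(2) by auto
  have cc: "c v x \<in> carrier V" if "v \<in> carrier V" "x \<in> carrier G" for v x
    using c_grade[OF that] sub(1)[OF that(2)] by blast
  \<comment> \<open>Linearity and the action on homogeneous elements all follow from this: the
    componentwise sum, the componentwise multiple and the family concentrated in one degree are
    decompositions, hence the decomposition.\<close>
  have unique: "c v x = d x"
    if v: "v \<in> carrier V" and d: "\<And>x. x \<in> carrier G \<Longrightarrow> d x \<in> grade V x"
      and sum: "v = (\<Oplus>\<^bsub>V\<^esub>x\<in>carrier G. d x)" and x: "x \<in> carrier G" for v d x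
  proof -
    have "d \<in> carrier G \<rightarrow> carrier V" using d sub(1) by blast
    then have "(\<Oplus>\<^bsub>V\<^esub>x\<in>carrier G. restrict d (carrier G) x) = (\<Oplus>\<^bsub>V\<^esub>x\<in>carrier G. d x)"
      by (intro V.finsum_cong') auto
    then have "?D v (restrict d (carrier G))" using d sum by auto
    then have "c v = restrict d (carrier G)" using c[OF v] ex1[OF v] by blast
    then show ?thesis using x by simp
  qed
  show thesis
  proof (rule that[of "\<lambda>x v. c v x"])
    fix x assume x: "x \<in> carrier G"
    show "(\<lambda>v. c v x) \<in> linear_maps K V V"
    proof (rule linear_mapsI)
      fix v assume v: "v \<in> carrier V"
      show "c v x \<in> carrier V" using cc[OF v x] .
      { fix u assume u: "u \<in> carrier V"
        have "u \<oplus>\<^bsub>V\<^esub> v = (\<Oplus>\<^bsub>V\<^esub>x\<in>carrier G. c u x) \<oplus>\<^bsub>V\<^esub> (\<Oplus>\<^bsub>V\<^esub>x\<in>carrier G. c v x)"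
          using c[OF u] c[OF v] by argo
        also have "\<dots> = (\<Oplus>\<^bsub>V\<^esub>x\<in>carrier G. c u x \<oplus>\<^bsub>V\<^esub> c v x)"
          using cc u v by (intro V.finsum_addf[symmetric]) auto
        finally show "c (u \<oplus>\<^bsub>V\<^esub> v) x = c u x \<oplus>\<^bsub>V\<^esub> c v x"
          using sub(3)[OF _ c_grade[OF u] c_grade[OF v]] V.M.add.m_closed[OF u v] x
          by (intro unique[where d = "\<lambda>x. c u x \<oplus>\<^bsub>V\<^esub> c v x"]) }
      { fix a assume a: "a \<in> carrier K"
        have "a \<odot>\<^bsub>V\<^esub> v = a \<odot>\<^bsub>V\<^esub> (\<Oplus>\<^bsub>V\<^esub>x\<in>carrier G. c v x)" using c[OF v] by argo
        also have "\<dots> = (\<Oplus>\<^bsub>V\<^esub>x\<in>carrier G. a \<odot>\<^bsub>V\<^esub> c v x)"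
          using cc a v fin by (intro V.finsum_smult_ldistr) auto
        finally show "c (a \<odot>\<^bsub>V\<^esub> v) x = a \<odot>\<^bsub>V\<^esub> c v x"
          using sub(4)[OF _ a c_grade[OF v]] V.smult_closed[OF a v] x
          by (intro unique[where d = "\<lambda>x. a \<odot>\<^bsub>V\<^esub> c v x"]) }
    qed
    fix y v assume y: "y \<in> carrier G" and v: "v \<in> grade V y"
    have vc: "v \<in> carrier V" using v sub(1)[OF y] by blast
    have "(\<Oplus>\<^bsub>V\<^esub>x\<in>carrier G. if y = x then v else \<zero>\<^bsub>V\<^esub>) = v"
      using vc by (intro V.finsum_singleton[OF y fin]) auto
    then show "c v x = (if y = x then v else \<zero>\<^bsub>V\<^esub>)"
      using vc v sub(2) x by (intro unique[where d = "\<lambda>x. if y = x then v else \<zero>\<^bsub>V\<^esub>"]) auto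
  qed (use c c_grade in auto)
qed

lemma graded_space_spanned:
  assumes gr: "graded_space K G V" and fin: "finite (carrier G)" and N: "submodule N K V"
    and hom: "\<And>x v. x \<in> carrier G \<Longrightarrow> v \<in> grade V x \<Longrightarrow> v \<in> N" and v: "v \<in> carrier V"
  shows "v \<in> N"
proof -
  obtain P where P: "\<And>x v. x \<in> carrier G \<Longrightarrow> v \<in> carrier V \<Longrightarrow> P x v \<in> grade V x"
    "\<And>v. v \<in> carrier V \<Longrightarrow> (\<Oplus>\<^bsub>V\<^esub>x\<in>carrier G. P x v) = v"
    using homogeneous_projections[OF gr fin] by metis
  have "(\<Oplus>\<^bsub>V\<^esub>x\<in>carrier G. P x v) \<in> N"
    using P(1) v hom by (intro submodule_finsum[OF graded_space_module[OF gr] N]) auto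
  then show ?thesis using P(2)[OF v] by simp
qed

text \<open>The two factors are released one at a time: for homogeneous w the vectors v with v (x) w
  in \<open>N\<close> form a submodule that contains all homogeneous ones, and for arbitrary v the
  same argument applies to w.\<close>

lemma homogeneous_tensors_span:
  assumes V: "graded_space K G V" and W: "graded_space K G W" and fin: "finite (carrier G)"
    and N: "submodule N K (tensor_space K V W)"
    and hom: "\<And>x y v w. x \<in> carrier G \<Longrightarrow> y \<in> carrier G \<Longrightarrow> v \<in> grade V x \<Longrightarrow> w \<in> grade W y \<Longrightarrow>
      pure_tensor K V W v w \<in> N"
    and t: "t \<in> carrier (tensor_space K V W)"
  shows "t \<in> N"
proof (rule tensor_space_spanned[OF _ _ N _ t])
  show mV: "module K V" and mW: "module K W" using V W by (simp_all add: graded_space_module)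
  note T = module_tensor_space[OF mV mW] and bil = pure_tensor_bilinear[OF mV mW]
  have 1: "pure_tensor K V W v w \<in> N"
    if v: "v \<in> carrier V" and y: "y \<in> carrier G" and w: "w \<in> grade W y" for v w y
  proof -
    have "v \<in> {v \<in> carrier V. pure_tensor K V W v w \<in> N}"
    proof (rule graded_space_spanned[OF V fin _ _ v])
      show "submodule {v \<in> carrier V. pure_tensor K V W v w \<in> N} K V"
        by (rule submodule_vimage[OF mV T bilinear_maps_left[OF bil grade_closed[OF W y w]] N])
    qed (use hom y w grade_closed[OF V] in auto)
    then show ?thesis by simp
  qed
  show "pure_tensor K V W v w \<in> N" if v: "v \<in> carrier V" and w: "w \<in> carrier W" for v w
  proof -
    have "w \<in> {w \<in> carrier W. pure_tensor K V W v w \<in> N}"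
    proof (rule graded_space_spanned[OF W fin _ _ w])
      show "submodule {w \<in> carrier W. pure_tensor K V W v w \<in> N} K W"
        by (rule submodule_vimage[OF mW T bilinear_maps_right[OF bil v] N])
    qed (use 1 v grade_closed[OF W] in auto)
    then show ?thesis by simp
  qed
qed

lemma linear_maps_eq_on_homogeneous_tensors:
  assumes V: "graded_space K G V" and W: "graded_space K G W" and fin: "finite (carrier G)"
    and X: "module K X"
    and f: "f \<in> linear_maps K (tensor_space K V W) X"
    and g: "g \<in> linear_maps K (tensor_space K V W) X"
    and eq: "\<And>x y v w. x \<in> carrier G \<Longrightarrow> y \<in> carrier G \<Longrightarrow> v \<in> grade V x \<Longrightarrow> w \<in> grade W y \<Longrightarrow>
      f (pure_tensor K V W v w) = g (pure_tensor K V W v w)"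
    and t: "t \<in> carrier (tensor_space K V W)"
  shows "f t = g t"
proof -
  note mV = graded_space_module[OF V] and mW = graded_space_module[OF W]
  have "t \<in> {t \<in> carrier (tensor_space K V W). f t = g t}"
    by (rule homogeneous_tensors_span[OF V W fin
          submodule_equalizer[OF module_tensor_space[OF mV mW] X f g] _ t])
      (use eq pure_tensor_closed[OF mV mW] grade_closed[OF V] grade_closed[OF W] in auto)
  then show ?thesis by simp
qed

text \<open>Both the homogeneous projections of a tensor product and the generalised transposition
  arise from a bilinear map whose values on homogeneous elements are rescaled by degree.\<close>

lemma homogeneous_lift:
  assumes V: "graded_space K G V" and W: "graded_space K G W" and fin: "finite (carrier G)"
    and X: "module K X" and b: "b \<in> bilinear_maps K V W X"
    and c: "\<And>x y. x \<in> carrier G \<Longrightarrow> y \<in> carrier G \<Longrightarrow> c x y \<in> carrier K"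
  obtains h where "h \<in> linear_maps K (tensor_space K V W) X"
    and "\<And>x y v w. x \<in> carrier G \<Longrightarrow> y \<in> carrier G \<Longrightarrow> v \<in> grade V x \<Longrightarrow> w \<in> grade W y \<Longrightarrow>
      h (pure_tensor K V W v w) = c x y \<odot>\<^bsub>X\<^esub> b v w"
proof -
  note mV = graded_space_module[OF V] and mW = graded_space_module[OF W]
  interpret V: module K V by fact
  interpret W: module K W by fact
  interpret X: module K X by fact
  obtain P where P: "\<And>x. x \<in> carrier G \<Longrightarrow> P x \<in> linear_maps K V V"
    and P_hom: "\<And>x y v. x \<in> carrier G \<Longrightarrow> y \<in> carrier G \<Longrightarrow> v \<in> grade V y \<Longrightarrow>
      P x v = (if y = x then v else \<zero>\<^bsub>V\<^esub>)"
    using homogeneous_projections[OF V fin] by metis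
  obtain Q where Q: "\<And>x. x \<in> carrier G \<Longrightarrow> Q x \<in> linear_maps K W W"
    and Q_hom: "\<And>x y v. x \<in> carrier G \<Longrightarrow> y \<in> carrier G \<Longrightarrow> v \<in> grade W y \<Longrightarrow>
      Q x v = (if y = x then v else \<zero>\<^bsub>W\<^esub>)"
    using homogeneous_projections[OF W fin] by metis
  let ?I = "carrier G \<times> carrier G"
  \<comment> \<open>The degrees are read off by the projections: sum c(x, y) b(P_x v, Q_y w) over
    all pairs of degrees. This is bilinear and the sum is finite, and for homogeneous v and w a
    single summand survives.\<close>
  define \<beta> where "\<beta> v w = (\<Oplus>\<^bsub>X\<^esub>p\<in>?I. c (fst p) (snd p) \<odot>\<^bsub>X\<^esub> b (P (fst p) v) (Q (snd p) w))" for v w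
  have bPQ: "(\<lambda>v w. b (P (fst p) v) (Q (snd p) w)) \<in> bilinear_maps K V W X" if "p \<in> ?I" for p
    using that P Q by (intro bilinear_maps_comp[OF b]) auto
  have cp: "c (fst p) (snd p) \<in> carrier K" if "p \<in> ?I" for p using that c by auto
  have "\<beta> \<in> bilinear_maps K V W X"
  proof (rule bilinear_mapsI)
    show "(\<lambda>v. \<beta> v w) \<in> linear_maps K V X" if w: "w \<in> carrier W" for w
      unfolding \<beta>_def using fin
      by (intro linear_maps_finsum[OF X] linear_maps_scale[OF X] bilinear_maps_left[OF bPQ _]) (auto simp: w cp)
    show "\<beta> v \<in> linear_maps K W X" if v: "v \<in> carrier V" for v
      unfolding \<beta>_def using fin
      by (intro linear_maps_finsum[OF X] linear_maps_scale[OF X] bilinear_maps_right[OF bPQ]) (auto simp: v cp)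
  qed
  then obtain h where h: "h \<in> linear_maps K (tensor_space K V W) X"
    "\<And>v w. v \<in> carrier V \<Longrightarrow> w \<in> carrier W \<Longrightarrow> h (pure_tensor K V W v w) = \<beta> v w"
    using tensor_lift_exists[OF mV mW X] by blast
  show thesis
  proof (rule that[OF h(1)])
    fix x y v w assume x: "x \<in> carrier G" and y: "y \<in> carrier G"
      and v: "v \<in> grade V x" and w: "w \<in> grade W y"
    have vc: "v \<in> carrier V" and wc: "w \<in> carrier W"
      using grade_closed[OF V x v] grade_closed[OF W y w] by auto
    have bvw: "b v w \<in> carrier X" using bilinear_maps_closed[OF b vc wc] .
    have b0: "b \<zero>\<^bsub>V\<^esub> u = \<zero>\<^bsub>X\<^esub>" if "u \<in> carrier W" for u
      by (rule linear_maps_zero[OF mV X bilinear_maps_left[OF b that]])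
    have b0': "b u \<zero>\<^bsub>W\<^esub> = \<zero>\<^bsub>X\<^esub>" if "u \<in> carrier V" for u
      by (rule linear_maps_zero[OF mW X bilinear_maps_right[OF b that]])
    have "h (pure_tensor K V W v w) = \<beta> v w" using h(2)[OF vc wc] .
    also have "\<dots> = (\<Oplus>\<^bsub>X\<^esub>p\<in>?I. if (x, y) = p then c (fst p) (snd p) \<odot>\<^bsub>X\<^esub> b v w else \<zero>\<^bsub>X\<^esub>)"
      unfolding \<beta>_def
    proof (rule X.finsum_cong'[OF refl])
      show "(\<lambda>p. if (x, y) = p then c (fst p) (snd p) \<odot>\<^bsub>X\<^esub> b v w else \<zero>\<^bsub>X\<^esub>) \<in> ?I \<rightarrow> carrier X"
        using cp bvw by auto
      fix p assume p: "p \<in> ?I"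
      obtain x' y' where p_eq: "p = (x', y')" "x' \<in> carrier G" "y' \<in> carrier G"
        using p by auto
      show "c (fst p) (snd p) \<odot>\<^bsub>X\<^esub> b (P (fst p) v) (Q (snd p) w)
          = (if (x, y) = p then c (fst p) (snd p) \<odot>\<^bsub>X\<^esub> b v w else \<zero>\<^bsub>X\<^esub>)"
        using P_hom[OF p_eq(2) x v] Q_hom[OF p_eq(3) y w] c[OF p_eq(2,3)] b0 b0' vc wc
        by (auto simp: p_eq)
    qed
    also have "\<dots> = c x y \<odot>\<^bsub>X\<^esub> b v w"
      using X.finsum_singleton[of "(x, y)" ?I "\<lambda>p. c (fst p) (snd p) \<odot>\<^bsub>X\<^esub> b v w"] x y fin cp bvw
      by auto
    finally show "h (pure_tensor K V W v w) = c x y \<odot>\<^bsub>X\<^esub> b v w" .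
  qed
qed

section \<open>The grading on a tensor product\<close>

lemma graded_tensor_simps [simp]:
  "carrier (graded_tensor K G V W) = carrier (tensor_space K V W)"
  "zero (graded_tensor K G V W) = zero (tensor_space K V W)"
  "add (graded_tensor K G V W) = add (tensor_space K V W)"
  "smult (graded_tensor K G V W) = smult (tensor_space K V W)"
  "linear_maps K (graded_tensor K G V W) Y = linear_maps K (tensor_space K V W) Y"
  "linear_maps K Z (graded_tensor K G V W) = linear_maps K Z (tensor_space K V W)"
  "tensor_space K (graded_tensor K G V W) X = tensor_space K (tensor_space K V W) X"
  "tensor_space K X (graded_tensor K G V W) = tensor_space K X (tensor_space K V W)"
  "pure_tensor K (graded_tensor K G V W) X = pure_tensor K (tensor_space K V W) X"
  "pure_tensor K X (graded_tensor K G V W) = pure_tensor K X (tensor_space K V W)"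
  unfolding graded_tensor_def by simp_all

lemma module_graded_tensor:
  "module K V \<Longrightarrow> module K W \<Longrightarrow> module K (graded_tensor K G V W)"
  unfolding graded_tensor_def by (rule module_with_grading[OF module_tensor_space])

lemma pure_tensor_homogeneous:
  assumes "x \<in> carrier G" "y \<in> carrier G" "v \<in> grade V x" "w \<in> grade W y"
  shows "pure_tensor K V W v w \<in> grade (graded_tensor K G V W) (x \<otimes>\<^bsub>G\<^esub> y)"
  unfolding graded_tensor_def with_grading_simps
  by (rule subsetD[OF submodule_gen_incl]) (use assms in blast)

lemma grade_graded_tensor_least:
  assumes "submodule N K (tensor_space K V W)"
    and "\<And>x y v w. x \<in> carrier G \<Longrightarrow> y \<in> carrier G \<Longrightarrow> x \<otimes>\<^bsub>G\<^esub> y = z \<Longrightarrow> v \<in> grade V x \<Longrightarrow>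
      w \<in> grade W y \<Longrightarrow> pure_tensor K V W v w \<in> N"
  shows "grade (graded_tensor K G V W) z \<subseteq> N"
  unfolding graded_tensor_def with_grading_simps
  by (rule submodule_gen_least[OF assms(1)]) (use assms(2) in blast)

lemma graded_tensor_grade_submodule:
  assumes "graded_space K G V" "graded_space K G W"
  shows "submodule (grade (graded_tensor K G V W) z) K (tensor_space K V W)"
proof -
  note mod = assms[THEN graded_space_module]
  have "pure_tensor K V W v w \<in> carrier (tensor_space K V W)"
    if "x \<in> carrier G" "y \<in> carrier G" "v \<in> grade V x" "w \<in> grade W y" for x y v w
    using that assms[THEN grade_closed] by (intro pure_tensor_closed[OF mod]) auto
  then show ?thesis
    unfolding graded_tensor_def with_grading_simps
    by (intro submodule_gen_submodule[OF module_tensor_space[OF mod]]) blast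
qed

text \<open>The projection onto degree z comes from \<open>homogeneous_lift\<close> applied to the
  pure tensor itself, rescaled by the indicator of x y = z: it keeps the tensors of total degree z
  and kills the others. The conditions of \<open>graded_spaceI\<close> are then checked on tensors
  of homogeneous elements.\<close>

lemma graded_space_graded_tensor:
  assumes G: "monoid G" and fin: "finite (carrier G)"
    and V: "graded_space K G V" and W: "graded_space K G W"
  shows "graded_space K G (graded_tensor K G V W)"
proof -
  interpret G: monoid G by fact
  note mV = graded_space_module[OF V] and mW = graded_space_module[OF W]
  let ?T = "tensor_space K V W" and ?GT = "graded_tensor K G V W"
  let ?p = "pure_tensor K V W"
  interpret V: module K V by fact
  interpret T: module K ?T by (rule module_tensor_space[OF mV mW])
  interpret GT: module K ?GT by (rule module_graded_tensor[OF mV mW])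
  note T = T.module_axioms and GT = GT.module_axioms
  note sub = graded_tensor_grade_submodule[OF V W]
  have sub': "submodule (grade ?GT z) K ?GT" for z
    using sub[of z] submodule_with_grading_iff[OF T] unfolding graded_tensor_def by blast
  have pc: "?p v w \<in> carrier ?T"
    if "x \<in> carrier G" "y \<in> carrier G" "v \<in> grade V x" "w \<in> grade W y" for x y v w
    using that grade_closed[OF V] grade_closed[OF W] by (intro pure_tensor_closed[OF mV mW]) auto
  have "\<exists>h. h \<in> linear_maps K ?T ?T \<and> (\<forall>x\<in>carrier G. \<forall>y\<in>carrier G. \<forall>v\<in>grade V x. \<forall>w\<in>grade W y.
      h (?p v w) = (if x \<otimes>\<^bsub>G\<^esub> y = z then \<one>\<^bsub>K\<^esub> else \<zero>\<^bsub>K\<^esub>) \<odot>\<^bsub>?T\<^esub> ?p v w)" for z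
    by (rule homogeneous_lift[OF V W fin T pure_tensor_bilinear[OF mV mW],
          of "\<lambda>x y. if x \<otimes>\<^bsub>G\<^esub> y = z then \<one>\<^bsub>K\<^esub> else \<zero>\<^bsub>K\<^esub>"]) auto
  then obtain P where P: "\<And>z. P z \<in> linear_maps K ?T ?T"
    and P_pure': "\<And>z x y v w. x \<in> carrier G \<Longrightarrow> y \<in> carrier G \<Longrightarrow> v \<in> grade V x \<Longrightarrow> w \<in> grade W y \<Longrightarrow>
      P z (?p v w) = (if x \<otimes>\<^bsub>G\<^esub> y = z then \<one>\<^bsub>K\<^esub> else \<zero>\<^bsub>K\<^esub>) \<odot>\<^bsub>?T\<^esub> ?p v w"
    by metis
  have P_pure: "P z (?p v w) = (if x \<otimes>\<^bsub>G\<^esub> y = z then ?p v w else \<zero>\<^bsub>?T\<^esub>)"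
    if "x \<in> carrier G" "y \<in> carrier G" "v \<in> grade V x" "w \<in> grade W y" for z x y v w
    using P_pure'[OF that, of z] pc[OF that] by simp
  have P_closed: "P z t \<in> carrier ?T" if "t \<in> carrier ?T" for z t
    using linear_maps_closed[OF P that] .
  show ?thesis
  proof (rule graded_spaceI[OF GT fin sub', of P])
    show "P z \<in> linear_maps K ?GT ?GT" for z using P by simp
    show "P z t \<in> grade ?GT z" if t: "t \<in> carrier ?GT" for z t
    proof -
      have "t \<in> {t \<in> carrier ?T. P z t \<in> grade ?GT z}"
      proof (rule homogeneous_tensors_span[OF V W fin submodule_vimage[OF T T P sub]])
        fix x y v w assume xy: "x \<in> carrier G" "y \<in> carrier G" "v \<in> grade V x" "w \<in> grade W y"
        show "?p v w \<in> {t \<in> carrier ?T. P z t \<in> grade ?GT z}"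
          using pc[OF xy] P_pure[OF xy, of z] submoduleD(2)[OF sub, of z]
            pure_tensor_homogeneous[OF xy, of K] by auto
      qed (use t in simp)
      then show ?thesis by simp
    qed
    show "(\<Oplus>\<^bsub>?GT\<^esub>z\<in>carrier G. P z t) = t" if t: "t \<in> carrier ?GT" for t
    proof (rule linear_maps_eq_on_homogeneous_tensors[OF V W fin GT])
      show "(\<lambda>t. \<Oplus>\<^bsub>?GT\<^esub>z\<in>carrier G. P z t) \<in> linear_maps K ?T ?GT"
        by (rule linear_maps_finsum[OF GT fin]) (simp add: P)
      show "(\<lambda>t. t) \<in> linear_maps K ?T ?GT" by (simp add: linear_maps_id)
      fix x y v w assume xy: "x \<in> carrier G" "y \<in> carrier G" "v \<in> grade V x" "w \<in> grade W y"
      have "(\<Oplus>\<^bsub>?GT\<^esub>z\<in>carrier G. P z (?p v w))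
          = (\<Oplus>\<^bsub>?GT\<^esub>z\<in>carrier G. if x \<otimes>\<^bsub>G\<^esub> y = z then ?p v w else \<zero>\<^bsub>?GT\<^esub>)"
        using pc[OF xy] P_pure[OF xy] T.M.zero_closed by (intro GT.finsum_cong') auto
      also have "\<dots> = ?p v w"
        using pc[OF xy] xy(1,2) by (intro GT.finsum_singleton fin) auto
      finally show "(\<Oplus>\<^bsub>?GT\<^esub>z\<in>carrier G. P z (?p v w)) = ?p v w" .
    qed (use t in simp)
    show "P z t = (if z' = z then t else \<zero>\<^bsub>?GT\<^esub>)" if t: "t \<in> grade ?GT z'" for z z' t
    proof -
      \<comment> \<open>Writing the case distinction as multiplication by 1 or 0 makes the
        right-hand side linear in t, so that equality with \<open>P z\<close> holds on a submodule
        and only the generators of the degree z' part need checking.\<close>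
      have lin: "(\<lambda>t. (if z' = z then \<one>\<^bsub>K\<^esub> else \<zero>\<^bsub>K\<^esub>) \<odot>\<^bsub>?T\<^esub> t) \<in> linear_maps K ?T ?T"
        by (rule linear_maps_scale[OF T linear_maps_id]) simp
      have "grade ?GT z' \<subseteq> {t \<in> carrier ?T. P z t = (if z' = z then \<one>\<^bsub>K\<^esub> else \<zero>\<^bsub>K\<^esub>) \<odot>\<^bsub>?T\<^esub> t}"
        by (rule grade_graded_tensor_least[OF submodule_equalizer[OF T T P lin]])
          (use P_pure pc in auto)
      then show ?thesis using t by auto
    qed
  qed
qed

section \<open>The generalised transposition of a bicharacter\<close>

lemma pure_tensor_smult:
  assumes "module K V" "module K W" "a \<in> carrier K" "v \<in> carrier V" "w \<in> carrier W"
  shows pure_tensor_smult_left: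
      "pure_tensor K V W (a \<odot>\<^bsub>V\<^esub> v) w = a \<odot>\<^bsub>tensor_space K V W\<^esub> pure_tensor K V W v w"
    and pure_tensor_smult_right:
      "pure_tensor K V W v (a \<odot>\<^bsub>W\<^esub> w) = a \<odot>\<^bsub>tensor_space K V W\<^esub> pure_tensor K V W v w"
proof -
  note bil = pure_tensor_bilinear[OF assms(1,2)]
  show "pure_tensor K V W (a \<odot>\<^bsub>V\<^esub> v) w = a \<odot>\<^bsub>tensor_space K V W\<^esub> pure_tensor K V W v w"
    by (rule linear_maps_smult[OF bilinear_maps_left[OF bil assms(5)] assms(3,4)])
  show "pure_tensor K V W v (a \<odot>\<^bsub>W\<^esub> w) = a \<odot>\<^bsub>tensor_space K V W\<^esub> pure_tensor K V W v w"
    by (rule linear_maps_smult[OF bilinear_maps_right[OF bil assms(4)] assms(3,5)])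
qed

text \<open>Treating \<open>U\<close> (x) \<open>V\<close> as one graded factor would require a
  check on all its homogeneous elements, which are sums of pure tensors. Decomposing that factor
  again leaves only products of three homogeneous vectors, on which the hexagon is an explicit
  computation.\<close>

lemma linear_maps_eq_on_homogeneous_triple_tensors:
  assumes U: "graded_space K G U" and V: "graded_space K G V" and W: "graded_space K G W"
    and fin: "finite (carrier G)" and X: "module K X"
    and f: "f \<in> linear_maps K (tensor_space K (tensor_space K U V) W) X"
    and g: "g \<in> linear_maps K (tensor_space K (tensor_space K U V) W) X"
    and eq: "\<And>x y z u v w. x \<in> carrier G \<Longrightarrow> y \<in> carrier G \<Longrightarrow> z \<in> carrier G \<Longrightarrow>
      u \<in> grade U x \<Longrightarrow> v \<in> grade V y \<Longrightarrow> w \<in> grade W z \<Longrightarrow>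
      f (pure_tensor K (tensor_space K U V) W (pure_tensor K U V u v) w)
        = g (pure_tensor K (tensor_space K U V) W (pure_tensor K U V u v) w)"
    and t: "t \<in> carrier (tensor_space K (tensor_space K U V) W)"
  shows "f t = g t"
proof -
  let ?UV = "tensor_space K U V"
  let ?p = "pure_tensor K ?UV W"
  note mU = graded_space_module[OF U] and mV = graded_space_module[OF V]
    and mW = graded_space_module[OF W]
  note mUV = module_tensor_space[OF mU mV]
  note bil = pure_tensor_bilinear[OF mUV mW]
  have 1: "f (?p s w) = g (?p s w)"
    if s: "s \<in> carrier ?UV" and z: "z \<in> carrier G" and w: "w \<in> grade W z" for s w z
    by (rule linear_maps_eq_on_homogeneous_tensors[OF U V fin X
          linear_maps_comp[OF bilinear_maps_left[OF bil grade_closed[OF W z w]] f]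
          linear_maps_comp[OF bilinear_maps_left[OF bil grade_closed[OF W z w]] g] _ s])
      (use eq z w in blast)
  show ?thesis
  proof (rule linear_maps_eq_on_tensor[OF mUV mW X f g _ t])
    fix s w assume s: "s \<in> carrier ?UV" and w: "w \<in> carrier W"
    have "w \<in> {w \<in> carrier W. f (?p s w) = g (?p s w)}"
      by (rule graded_space_spanned[OF W fin submodule_equalizer[OF mW X
              linear_maps_comp[OF bilinear_maps_right[OF bil s] f]
              linear_maps_comp[OF bilinear_maps_right[OF bil s] g]] _ w])
        (use 1 s grade_closed[OF W] in blast)
    then show "f (?p s w) = g (?p s w)" by simp
  qed
qed

text \<open>Justifies the definite description behind \<open>transposition\<close>. Existence comes
  from rescaling the bilinear map that sends (v, w) to w (x) v by \<open>R\<close>; uniqueness holds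
  because tensors of homogeneous elements span and extensionality fixes the rest.\<close>

lemma transposition:
  assumes V: "graded_space K G V" and W: "graded_space K G W" and fin: "finite (carrier G)"
    and R: "R \<in> carrier G \<rightarrow> carrier G \<rightarrow> carrier K"
  shows transposition_linear:
      "transposition K G R V W \<in> linear_maps K (tensor_space K V W) (tensor_space K W V)"
    and transposition_pure: "\<And>x y v w. x \<in> carrier G \<Longrightarrow> y \<in> carrier G \<Longrightarrow> v \<in> grade V x \<Longrightarrow>
      w \<in> grade W y \<Longrightarrow> transposition K G R V W (pure_tensor K V W v w)
        = R x y \<odot>\<^bsub>tensor_space K W V\<^esub> pure_tensor K W V w v"
proof -
  let ?T = "tensor_space K V W" and ?T' = "tensor_space K W V"
  note mV = graded_space_module[OF V] and mW = graded_space_module[OF W]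
  note T = module_tensor_space[OF mV mW] and T' = module_tensor_space[OF mW mV]
  let ?P = "\<lambda>h. h \<in> linear_maps K ?T ?T' \<and> h \<in> extensional (carrier ?T)
      \<and> (\<forall>x\<in>carrier G. \<forall>y\<in>carrier G. \<forall>v\<in>grade V x. \<forall>w\<in>grade W y.
               h (pure_tensor K V W v w) = R x y \<odot>\<^bsub>?T'\<^esub> pure_tensor K W V w v)"
  obtain h where h: "h \<in> linear_maps K ?T ?T'"
    and h_pure: "\<And>x y v w. x \<in> carrier G \<Longrightarrow> y \<in> carrier G \<Longrightarrow> v \<in> grade V x \<Longrightarrow> w \<in> grade W y \<Longrightarrow>
      h (pure_tensor K V W v w) = R x y \<odot>\<^bsub>?T'\<^esub> pure_tensor K W V w v"
    by (rule homogeneous_lift[OF V W fin T' bilinear_maps_flip[OF pure_tensor_bilinear[OF mW mV]],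
          where c = R]) (use R in auto)
  have "\<exists>!h. ?P h"
  proof (rule ex1I)
    have "restrict h (carrier ?T) (pure_tensor K V W v w) = R x y \<odot>\<^bsub>?T'\<^esub> pure_tensor K W V w v"
      if "x \<in> carrier G" "y \<in> carrier G" "v \<in> grade V x" "w \<in> grade W y" for x y v w
      using h_pure[OF that]
        pure_tensor_closed[OF mV mW grade_closed[OF V that(1,3)] grade_closed[OF W that(2,4)]]
      by simp
    then show "?P (restrict h (carrier ?T))"
      using linear_maps_restrict[OF T h] by blast
    fix g assume g: "?P g"
    show "g = restrict h (carrier ?T)"
    proof (rule extensionalityI)
      show "g \<in> extensional (carrier ?T)" using g by blast
      show "g t = restrict h (carrier ?T) t" if "t \<in> carrier ?T" for t
        using linear_maps_eq_on_homogeneous_tensors[OF V W fin T' _ h _ that, of g] g h_pure that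
        by simp
    qed simp
  qed
  from theI'[OF this] show "transposition K G R V W \<in> linear_maps K ?T ?T'"
    and "\<And>x y v w. x \<in> carrier G \<Longrightarrow> y \<in> carrier G \<Longrightarrow> v \<in> grade V x \<Longrightarrow> w \<in> grade W y \<Longrightarrow>
      transposition K G R V W (pure_tensor K V W v w) = R x y \<odot>\<^bsub>?T'\<^esub> pure_tensor K W V w v"
    unfolding transposition_def by auto
qed

text \<open>Multiplicativity in the first argument follows from these axioms, since
  \<open>R y x\<close> is the inverse of \<open>R x y\<close>; likewise one hexagon gives the
  other.\<close>

locale symmetric_bicharacter = K: cring K + G: comm_monoid G
  for K :: "('k, 'm) ring_scheme" and G :: "('g, 'c) monoid_scheme" +
  fixes R :: "'g \<Rightarrow> 'g \<Rightarrow> 'k"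
  assumes finite_grades: "finite (carrier G)"
    and R_funcset: "R \<in> carrier G \<rightarrow> carrier G \<rightarrow> carrier K"
    and R_mult: "x \<in> carrier G \<Longrightarrow> y \<in> carrier G \<Longrightarrow> z \<in> carrier G \<Longrightarrow>
      R x (y \<otimes>\<^bsub>G\<^esub> z) = R x y \<otimes>\<^bsub>K\<^esub> R x z"
    and R_inverse: "x \<in> carrier G \<Longrightarrow> y \<in> carrier G \<Longrightarrow> R x y \<otimes>\<^bsub>K\<^esub> R y x = \<one>\<^bsub>K\<^esub>"
begin

lemma R_closed: "x \<in> carrier G \<Longrightarrow> y \<in> carrier G \<Longrightarrow> R x y \<in> carrier K"
  using R_funcset by blast

text \<open>Here commutativity of the grading group enters: v (x) w has degree x y, while w (x) v
  has degree y x.\<close>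

lemma transposition_graded:
  assumes V: "graded_space K G V" and W: "graded_space K G W"
  shows "transposition K G R V W \<in> graded_maps K G (graded_tensor K G V W) (graded_tensor K G W V)"
  unfolding graded_maps_def
proof (intro CollectI conjI ballI)
  note mV = graded_space_module[OF V] and mW = graded_space_module[OF W]
  note T = module_tensor_space[OF mV mW] and T' = module_tensor_space[OF mW mV]
  note lin = transposition_linear[OF V W finite_grades R_funcset]
  show "transposition K G R V W \<in> linear_maps K (graded_tensor K G V W) (graded_tensor K G W V)"
    using lin by simp
  fix z assume z: "z \<in> carrier G"
  note sub = graded_tensor_grade_submodule[OF W V, of z]
  have "grade (graded_tensor K G V W) z
      \<subseteq> {t \<in> carrier (tensor_space K V W). transposition K G R V W t \<in> grade (graded_tensor K G W V) z}"
  proof (rule grade_graded_tensor_least[OF submodule_vimage[OF T T' lin sub]])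
    fix x y v w
    assume xy: "x \<in> carrier G" "y \<in> carrier G" "v \<in> grade V x" "w \<in> grade W y"
      and z: "x \<otimes>\<^bsub>G\<^esub> y = z"
    have "pure_tensor K W V w v \<in> grade (graded_tensor K G W V) z"
      using pure_tensor_homogeneous[OF xy(2,1,4,3)] G.m_comm[OF xy(1,2)] z by metis
    then show "pure_tensor K V W v w \<in> {t \<in> carrier (tensor_space K V W).
        transposition K G R V W t \<in> grade (graded_tensor K G W V) z}"
      using xy pure_tensor_closed[OF mV mW grade_closed[OF V xy(1,3)] grade_closed[OF W xy(2,4)]]
      by (simp add: transposition_pure[OF V W finite_grades R_funcset xy] submoduleD(4)[OF sub] R_closed)
  qed
  then show "transposition K G R V W ` grade (graded_tensor K G V W) z
      \<subseteq> grade (graded_tensor K G W V) z" by blast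
qed

text \<open>Swapping twice restores the pure tensor and leaves the scalar \<open>R x y\<close> times
  \<open>R y x\<close>, which is 1 by \<open>R_inverse\<close>.\<close>

lemma transposition_involutive:
  assumes V: "graded_space K G V" and W: "graded_space K G W"
    and t: "t \<in> carrier (tensor_space K V W)"
  shows "transposition K G R W V (transposition K G R V W t) = t"
proof -
  note mV = graded_space_module[OF V] and mW = graded_space_module[OF W]
  note T = module_tensor_space[OF mV mW] and T' = module_tensor_space[OF mW mV]
  interpret T: module K "tensor_space K V W" by (rule T)
  note VW = transposition[OF V W finite_grades R_funcset]
  note WV = transposition[OF W V finite_grades R_funcset]
  show ?thesis
  proof (rule linear_maps_eq_on_homogeneous_tensors[OF V W finite_grades T
        linear_maps_comp[OF VW(1) WV(1)] linear_maps_id _ t])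
    fix x y v w
    assume xy: "x \<in> carrier G" "y \<in> carrier G" "v \<in> grade V x" "w \<in> grade W y"
    note c = grade_closed[OF V xy(1,3)] grade_closed[OF W xy(2,4)]
    note Rc = R_closed[OF xy(1,2)] R_closed[OF xy(2,1)]
    have "transposition K G R W V (transposition K G R V W (pure_tensor K V W v w))
      = R x y \<odot>\<^bsub>tensor_space K V W\<^esub> (R y x \<odot>\<^bsub>tensor_space K V W\<^esub> pure_tensor K V W v w)"
      unfolding VW(2)[OF xy] WV(2)[OF xy(2,1,4,3), symmetric]
      by (rule linear_maps_smult[OF WV(1) Rc(1) pure_tensor_closed[OF mW mV c(2,1)]])
    also have "\<dots> = pure_tensor K V W v w"
      using R_inverse[OF xy(1,2)] pure_tensor_closed[OF mV mW c] Rc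
      by (simp add: T.smult_assoc1[symmetric])
    finally show "transposition K G R W V (transposition K G R V W (pure_tensor K V W v w))
      = pure_tensor K V W v w" .
  qed
qed

text \<open>Degree-preserving maps do not change the degrees x and y, so both routes pick up the
  same scalar \<open>R x y\<close>.\<close>

lemma transposition_natural:
  assumes V: "graded_space K G V" and W: "graded_space K G W"
    and V': "graded_space K G V'" and W': "graded_space K G W'"
    and f: "f \<in> graded_maps K G V V'" and g: "g \<in> graded_maps K G W W'"
    and t: "t \<in> carrier (tensor_space K V W)"
  shows "transposition K G R V' W' (tensor_map K V W V' W' f g t)
    = tensor_map K W V W' V' g f (transposition K G R V W t)"
proof -
  note m = V[THEN graded_space_module] W[THEN graded_space_module]
    V'[THEN graded_space_module] W'[THEN graded_space_module]
  have lin: "f \<in> linear_maps K V V'" "g \<in> linear_maps K W W'"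
    and deg: "\<And>x v. x \<in> carrier G \<Longrightarrow> v \<in> grade V x \<Longrightarrow> f v \<in> grade V' x"
      "\<And>x v. x \<in> carrier G \<Longrightarrow> v \<in> grade W x \<Longrightarrow> g v \<in> grade W' x"
    using f g unfolding graded_maps_def by blast+
  note fg = tensor_map[OF m lin] and gf = tensor_map[OF m(2,1,4,3) lin(2,1)]
  note VW = transposition[OF V W finite_grades R_funcset]
  note V'W' = transposition[OF V' W' finite_grades R_funcset]
  show ?thesis
  proof (rule linear_maps_eq_on_homogeneous_tensors[OF V W finite_grades
        module_tensor_space[OF m(4,3)]
        linear_maps_comp[OF fg(1) V'W'(1)] linear_maps_comp[OF VW(1) gf(1)] _ t])
    fix x y v w
    assume xy: "x \<in> carrier G" "y \<in> carrier G" "v \<in> grade V x" "w \<in> grade W y"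
    note c = grade_closed[OF V xy(1,3)] grade_closed[OF W xy(2,4)]
    have "tensor_map K W V W' V' g f (transposition K G R V W (pure_tensor K V W v w))
        = R x y \<odot>\<^bsub>tensor_space K W' V'\<^esub> pure_tensor K W' V' (g w) (f v)"
      unfolding VW(2)[OF xy] gf(2)[OF c(2,1), symmetric]
      by (rule linear_maps_smult[OF gf(1) R_closed[OF xy(1,2)] pure_tensor_closed[OF m(2,1) c(2,1)]])
    moreover have "transposition K G R V' W' (tensor_map K V W V' W' f g (pure_tensor K V W v w))
        = R x y \<odot>\<^bsub>tensor_space K W' V'\<^esub> pure_tensor K W' V' (g w) (f v)"
      unfolding fg(2)[OF c] by (rule V'W'(2)[OF xy(1,2) deg(1)[OF xy(1,3)] deg(2)[OF xy(2,4)]])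
    ultimately show "transposition K G R V' W' (tensor_map K V W V' W' f g (pure_tensor K V W v w))
      = tensor_map K W V W' V' g f (transposition K G R V W (pure_tensor K V W v w))" by simp
  qed
qed

text \<open>Both sides send (u (x) v) (x) w to a multiple of v (x) (w (x) u). Moving u past v (x) w
  at once costs R(x, y z), as that tensor has degree y z; moving it past v and w separately costs
  R(x, y) R(x, z). So the hexagon is \<open>R_mult\<close>.\<close>

lemma transposition_hexagon:
  assumes U: "graded_space K G U" and V: "graded_space K G V" and W: "graded_space K G W"
    and t: "t \<in> carrier (tensor_space K (tensor_space K U V) W)"
  shows "tensor_assoc K V W U
            (transposition K G R U (graded_tensor K G V W) (tensor_assoc K U V W t))
          = tensor_map K V (graded_tensor K G U W) V (graded_tensor K G W U)
              id (transposition K G R U W)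
              (tensor_assoc K V U W
                (tensor_map K (graded_tensor K G U V) W (graded_tensor K G V U) W
                   (transposition K G R U V) id t))"
proof -
  note m = U[THEN graded_space_module] V[THEN graded_space_module] W[THEN graded_space_module]
  let ?t = "tensor_space K" and ?g = "graded_tensor K G" and ?p = "pure_tensor K"
  note mVW = module_tensor_space[OF m(2,3)] and mWU = module_tensor_space[OF m(3,1)]
    and mUW = module_tensor_space[OF m(1,3)] and mVU = module_tensor_space[OF m(2,1)]
    and mUV = module_tensor_space[OF m(1,2)]
  note T = module_tensor_space[OF m(2) mWU]
  interpret WU: module K "?t W U" by (rule mWU)
  interpret T: module K "?t V (?t W U)" by (rule T)
  note VW = graded_space_graded_tensor[OF G.monoid_axioms finite_grades V W]
  note \<tau>UV = transposition[OF U V finite_grades R_funcset]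
  note \<tau>UW = transposition[OF U W finite_grades R_funcset]
  note \<tau>U_VW = transposition[OF U VW finite_grades R_funcset]
  have idV: "id \<in> linear_maps K V V" and idW: "id \<in> linear_maps K W W"
    using linear_maps_id unfolding id_def by auto
  have lins: "transposition K G R U V \<in> linear_maps K (?g U V) (?g V U)"
    "transposition K G R U W \<in> linear_maps K (?g U W) (?g W U)"
    using \<tau>UV(1) \<tau>UW(1) by simp_all
  note map1 = tensor_map[OF module_graded_tensor[OF m(1,2)] m(3) module_graded_tensor[OF m(2,1)] m(3)
      lins(1) idW, simplified]
  note map2 = tensor_map[OF m(2) module_graded_tensor[OF m(1,3)] m(2) module_graded_tensor[OF m(3,1)]
      idV lins(2), simplified]
  note a1 = tensor_assoc[OF m] and a2 = tensor_assoc[OF m(2,3,1)] and a3 = tensor_assoc[OF m(2,1,3)]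
  let ?L = "\<lambda>t. tensor_assoc K V W U (transposition K G R U (?g V W) (tensor_assoc K U V W t))"
  let ?m1 = "tensor_map K (?g U V) W (?g V U) W (transposition K G R U V) id"
  let ?m2 = "tensor_map K V (?g U W) V (?g W U) id (transposition K G R U W)"
  show ?thesis
  proof (rule linear_maps_eq_on_homogeneous_triple_tensors[OF U V W finite_grades T _ _ _ t])
    show "?L \<in> linear_maps K (?t (?t U V) W) (?t V (?t W U))"
      using \<tau>U_VW(1) by (intro linear_maps_comp[OF linear_maps_comp[OF a1(1)] a2(1)]) simp
    show "(\<lambda>t. ?m2 (tensor_assoc K V U W (?m1 t))) \<in> linear_maps K (?t (?t U V) W) (?t V (?t W U))"
      by (rule linear_maps_comp[OF linear_maps_comp[OF map1(1) a3(1)] map2(1)])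
    fix x y z u v w
    assume xyz: "x \<in> carrier G" "y \<in> carrier G" "z \<in> carrier G"
      and u: "u \<in> grade U x" and v: "v \<in> grade V y" and w: "w \<in> grade W z"
    note c = grade_closed[OF U xyz(1) u] grade_closed[OF V xyz(2) v] grade_closed[OF W xyz(3) w]
    note Rc = R_closed[OF xyz(1,2)] R_closed[OF xyz(1,3)] R_closed[OF xyz(1) G.m_closed[OF xyz(2,3)]]
    let ?e = "?p V (?t W U) v (?p W U w u)"
    have e: "?e \<in> carrier (?t V (?t W U))"
      using c by (intro pure_tensor_closed m mWU)
    have "transposition K G R U (?g V W) (?p U (?t V W) u (?p V W v w))
        = R x (y \<otimes>\<^bsub>G\<^esub> z) \<odot>\<^bsub>?t (?t V W) U\<^esub> ?p (?t V W) U (?p V W v w) u"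
      using \<tau>U_VW(2)[OF xyz(1) G.m_closed[OF xyz(2,3)] u pure_tensor_homogeneous[OF xyz(2,3) v w]]
      by simp
    then have "?L (?p (?t U V) W (?p U V u v) w) = R x (y \<otimes>\<^bsub>G\<^esub> z) \<odot>\<^bsub>?t V (?t W U)\<^esub> ?e"
      using linear_maps_smult[OF a2(1) Rc(3)] c
      by (simp add: a1(2) a2(2) pure_tensor_closed[OF m(2,3)] pure_tensor_closed[OF mVW m(1)])
    moreover have "?m1 (?p (?t U V) W (?p U V u v) w) = R x y \<odot>\<^bsub>?t (?t V U) W\<^esub> ?p (?t V U) W (?p V U v u) w"
      using map1(2)[OF pure_tensor_closed[OF m(1,2) c(1,2)] c(3)] \<tau>UV(2)[OF xyz(1,2) u v]
        pure_tensor_smult_left[OF mVU m(3) Rc(1) pure_tensor_closed[OF m(2,1) c(2,1)] c(3)] by simp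
    moreover have "tensor_assoc K V U W (R x y \<odot>\<^bsub>?t (?t V U) W\<^esub> ?p (?t V U) W (?p V U v u) w)
        = R x y \<odot>\<^bsub>?t V (?t U W)\<^esub> ?p V (?t U W) v (?p U W u w)"
      using linear_maps_smult[OF a3(1) Rc(1)] a3(2) c
      by (simp add: pure_tensor_closed[OF m(2,1)] pure_tensor_closed[OF mVU m(3)])
    moreover have "?m2 (R x y \<odot>\<^bsub>?t V (?t U W)\<^esub> ?p V (?t U W) v (?p U W u w))
        = R x y \<odot>\<^bsub>?t V (?t W U)\<^esub> (R x z \<odot>\<^bsub>?t V (?t W U)\<^esub> ?e)"
      using linear_maps_smult[OF map2(1) Rc(1)
          pure_tensor_closed[OF m(2) mUW c(2) pure_tensor_closed[OF m(1,3) c(1,3)]]]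
        map2(2)[OF c(2) pure_tensor_closed[OF m(1,3) c(1,3)]] \<tau>UW(2)[OF xyz(1,3) u w]
        pure_tensor_smult_right[OF m(2) mWU Rc(2) c(2) pure_tensor_closed[OF m(3,1) c(3,1)]]
      by simp
    ultimately show "?L (?p (?t U V) W (?p U V u v) w)
        = ?m2 (tensor_assoc K V U W (?m1 (?p (?t U V) W (?p U V u v) w)))"
      using R_mult[OF xyz] e Rc by (simp add: T.smult_assoc1)
  qed
qed

lemma defines_symmetric_category: "defines_symmetric_category K G R TYPE('w)"
  unfolding defines_symmetric_category_def
proof (intro conjI allI impI ballI)
  fix V W :: "('k, 'w, 'g) graded_module"
  assume V: "graded_space K G V" and W: "graded_space K G W"
  show "graded_space K G (graded_tensor K G V W)"
    by (rule graded_space_graded_tensor[OF G.monoid_axioms finite_grades V W])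
  show "transposition K G R V W \<in> graded_maps K G (graded_tensor K G V W) (graded_tensor K G W V)"
    by (rule transposition_graded[OF V W])
  show "transposition K G R V W (pure_tensor K V W v w)
      = R x y \<odot>\<^bsub>graded_tensor K G W V\<^esub> pure_tensor K W V w v"
    if "x \<in> carrier G" "y \<in> carrier G" "v \<in> grade V x" "w \<in> grade W y" for x y v w
    using transposition_pure[OF V W finite_grades R_funcset that] by simp
  show "transposition K G R W V (transposition K G R V W t) = t"
    if "t \<in> carrier (graded_tensor K G V W)" for t
    using that transposition_involutive[OF V W] by simp
qed (simp_all add: transposition_natural transposition_hexagon)

end

section \<open>Twisted monoid algebras\<close>

lemma ring_congI:
  fixes R :: "('r, 'a) ring_scheme" and R' :: "('r, 'b) ring_scheme"
  assumes "ring R" "carrier R' = carrier R" "monoid.mult R' = monoid.mult R" "one R' = one R"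
    "zero R' = zero R" "add R' = add R"
  shows "ring R'"
proof -
  interpret R: ring R by fact
  have "abelian_group R'"
    by (rule abelian_groupI)
      (use abelian_groupE[OF R.abelian_group_axioms] in \<open>simp_all add: assms(2-)\<close>)
  moreover have "monoid R'"
    by (rule monoidI) (simp_all add: assms(2-) R.m_assoc)
  ultimately show ?thesis
    by (rule ringI) (simp_all add: assms(2-) R.l_distr R.r_distr)
qed

text \<open>Bilinearity of the product packages both distributive laws and both compatibilities with
  scalars, which suits the extension of identities from basis elements.\<close>

lemma assoc_algebraI:
  assumes "module K M" "monoid M" "monoid.mult M \<in> bilinear_maps K M M M"
  shows "assoc_algebra K M"
proof -
  interpret M: module K M by fact
  interpret M: monoid M by fact
  note l = bilinear_maps_left[OF assms(3)] and r = bilinear_maps_right[OF assms(3)]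
  have "ring M"
    by (rule ringI[OF M.abelian_group_axioms M.monoid_axioms])
      (simp_all add: linear_maps_add[OF l] linear_maps_add[OF r])
  then show ?thesis
    by (intro assoc_algebra.intro assoc_algebra_axioms.intro M.module_axioms)
      (simp_all add: linear_maps_smult[OF l] linear_maps_smult[OF r])
qed

lemma (in assoc_algebra) mult_bilinear: "monoid.mult M \<in> bilinear_maps R M M M"
  by (intro bilinear_mapsI linear_mapsI)
    (simp_all add: l_distr r_distr smult_mult_left smult_mult_right)

lemma assoc_algebra_with_grading:
  assumes "assoc_algebra K M"
  shows "assoc_algebra K (with_grading M gr)"
proof -
  interpret M: assoc_algebra K M by fact
  show ?thesis
    by (intro assoc_algebra.intro assoc_algebra_axioms.intro module_with_grading M.module_axioms
        ring_congI[OF M.ring_axioms]) (simp_all add: M.smult_mult_left M.smult_mult_right)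
qed

lemma twisted_algebra_simps:
  "carrier (twisted_algebra K G F) = carrier (free_module K (carrier G))"
  "one (twisted_algebra K G F) = basis_elt K (one G)"
  "zero (twisted_algebra K G F) = zero (free_module K (carrier G))"
  "add (twisted_algebra K G F) = add (free_module K (carrier G))"
  "smult (twisted_algebra K G F) = smult (free_module K (carrier G))"
  "monoid.mult (twisted_algebra K G F) = (\<lambda>f g z.
        finsum K (\<lambda>(x, y). F x y \<otimes>\<^bsub>K\<^esub> (f x \<otimes>\<^bsub>K\<^esub> g y))
          {(x, y). x \<in> carrier G \<and> y \<in> carrier G \<and> f x \<noteq> \<zero>\<^bsub>K\<^esub> \<and> g y \<noteq> \<zero>\<^bsub>K\<^esub>
                   \<and> x \<otimes>\<^bsub>G\<^esub> y = z})"
  unfolding twisted_algebra_def by simp_all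

text \<open>\<open>F_cocycle\<close> is associativity on basis elements. Taking \<open>G\<close> to
  be a monoid lets one development serve twice: for words with the constant cochain 1, which gives
  the free algebra, and for Z_2^n with the Clifford cochain.\<close>

locale twisting = K: cring K + G: monoid G
  for K :: "('k, 'm) ring_scheme" and G :: "('g, 'c) monoid_scheme" +
  fixes F :: "'g \<Rightarrow> 'g \<Rightarrow> 'k"
  assumes F_funcset: "F \<in> carrier G \<rightarrow> carrier G \<rightarrow> carrier K"
    and F_cocycle: "x \<in> carrier G \<Longrightarrow> y \<in> carrier G \<Longrightarrow> z \<in> carrier G \<Longrightarrow>
      F x y \<otimes>\<^bsub>K\<^esub> F (x \<otimes>\<^bsub>G\<^esub> y) z = F y z \<otimes>\<^bsub>K\<^esub> F x (y \<otimes>\<^bsub>G\<^esub> z)"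
    and F_one_left: "x \<in> carrier G \<Longrightarrow> F \<one>\<^bsub>G\<^esub> x = \<one>\<^bsub>K\<^esub>"
    and F_one_right: "x \<in> carrier G \<Longrightarrow> F x \<one>\<^bsub>G\<^esub> = \<one>\<^bsub>K\<^esub>"
begin

abbreviation A where "A \<equiv> twisted_algebra K G F"

lemma F_closed: "x \<in> carrier G \<Longrightarrow> y \<in> carrier G \<Longrightarrow> F x y \<in> carrier K"
  using F_funcset by blast

sublocale A: module K A
  by (rule module_congI[OF K.module_free_module]) (simp_all add: twisted_algebra_simps)

lemma linear_maps_twisted_algebra:
  "linear_maps K A X = linear_maps K (free_module K (carrier G)) X"
  unfolding linear_maps_def by (simp add: twisted_algebra_simps)

lemma basis_closed: "x \<in> carrier G \<Longrightarrow> basis_elt K x \<in> carrier A"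
  by (simp add: twisted_algebra_simps K.basis_elt_closed)

lemma carrierD:
  assumes "f \<in> carrier A"
  shows "f s \<in> carrier K" "f s \<noteq> \<zero>\<^bsub>K\<^esub> \<Longrightarrow> s \<in> carrier G" "finite {s. f s \<noteq> \<zero>\<^bsub>K\<^esub>}"
  using K.free_module_carrierD[of f "carrier G"] assms by (simp_all add: twisted_algebra_simps)

lemma spanned_by_basis:
  assumes "submodule N K A" "\<And>x. x \<in> carrier G \<Longrightarrow> basis_elt K x \<in> N" "f \<in> carrier A"
  shows "f \<in> N"
proof (rule K.free_module_spanned)
  show "submodule N K (free_module K (carrier G))"
    using submoduleD[OF assms(1)]
    by (intro module.submoduleI'[OF K.module_free_module]) (simp_all add: twisted_algebra_simps)
qed (use assms in \<open>simp_all add: twisted_algebra_simps\<close>)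

lemma linear_maps_eq_on_basis:
  assumes "module K X" "f \<in> linear_maps K A X" "g \<in> linear_maps K A X"
    and "\<And>x. x \<in> carrier G \<Longrightarrow> f (basis_elt K x) = g (basis_elt K x)" "u \<in> carrier A"
  shows "f u = g u"
  using spanned_by_basis[OF submodule_equalizer[OF A.module_axioms assms(1-3)] _ assms(5)]
    assms(4) basis_closed by simp

lemma lift_basis:
  assumes "module K X" "h \<in> carrier G \<rightarrow> carrier X"
  obtains f where "f \<in> linear_maps K A X" "\<And>x. x \<in> carrier G \<Longrightarrow> f (basis_elt K x) = h x"
  using K.free_module_lift[OF assms] unfolding linear_maps_twisted_algebra by blast

text \<open>The defining sum runs over a set that depends on both supports and on the coordinate z.
  Summing over any finite rectangle that contains the supports, with the condition on z moved into
  the summand, gives an index set that can be shared between several products.\<close>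

lemma mult_eq_finsum:
  assumes f: "f \<in> carrier A" and g: "g \<in> carrier A"
    and S: "finite S" "{x. f x \<noteq> \<zero>\<^bsub>K\<^esub>} \<subseteq> S" "S \<subseteq> carrier G"
    and T: "finite T" "{x. g x \<noteq> \<zero>\<^bsub>K\<^esub>} \<subseteq> T" "T \<subseteq> carrier G"
  shows "(f \<otimes>\<^bsub>A\<^esub> g) z = (\<Oplus>\<^bsub>K\<^esub>p\<in>S \<times> T. if fst p \<otimes>\<^bsub>G\<^esub> snd p = z
      then F (fst p) (snd p) \<otimes>\<^bsub>K\<^esub> (f (fst p) \<otimes>\<^bsub>K\<^esub> g (snd p)) else \<zero>\<^bsub>K\<^esub>)"
proof -
  note c = carrierD(1)[OF f] carrierD(1)[OF g]
  have F: "F x y \<in> carrier K" if "x \<in> S" "y \<in> T" for x y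
    using that S(3) T(3) F_closed by blast
  show ?thesis
    unfolding twisted_algebra_simps
  proof (rule K.add.finprod_mono_neutral_cong_left)
    show "finite (S \<times> T)" using S T by simp
    show "{(x, y). x \<in> carrier G \<and> y \<in> carrier G \<and> f x \<noteq> \<zero>\<^bsub>K\<^esub> \<and> g y \<noteq> \<zero>\<^bsub>K\<^esub> \<and> x \<otimes>\<^bsub>G\<^esub> y = z} \<subseteq> S \<times> T"
      using S T by blast
    show "(if fst p \<otimes>\<^bsub>G\<^esub> snd p = z then F (fst p) (snd p) \<otimes>\<^bsub>K\<^esub> (f (fst p) \<otimes>\<^bsub>K\<^esub> g (snd p)) else \<zero>\<^bsub>K\<^esub>) = \<zero>\<^bsub>K\<^esub>"
      if p: "p \<in> S \<times> T - {(x, y). x \<in> carrier G \<and> y \<in> carrier G \<and> f x \<noteq> \<zero>\<^bsub>K\<^esub> \<and> g y \<noteq> \<zero>\<^bsub>K\<^esub>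
        \<and> x \<otimes>\<^bsub>G\<^esub> y = z}" for p
    proof -
      obtain x y where xy: "p = (x, y)" "x \<in> S" "y \<in> T" using p by auto
      show ?thesis
        using p xy S(3) T(3) F[OF xy(2,3)] c by (cases "f x = \<zero>\<^bsub>K\<^esub>"; cases "g y = \<zero>\<^bsub>K\<^esub>") auto
    qed
    show "(\<lambda>p. if fst p \<otimes>\<^bsub>G\<^esub> snd p = z then F (fst p) (snd p) \<otimes>\<^bsub>K\<^esub> (f (fst p) \<otimes>\<^bsub>K\<^esub> g (snd p)) else \<zero>\<^bsub>K\<^esub>)
        \<in> S \<times> T \<rightarrow> carrier K"
      using F c by auto
  qed auto
qed

lemma mult_closed:
  assumes f: "f \<in> carrier A" and g: "g \<in> carrier A"
  shows "f \<otimes>\<^bsub>A\<^esub> g \<in> carrier A"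
proof -
  let ?S = "{x. f x \<noteq> \<zero>\<^bsub>K\<^esub>}" and ?T = "{x. g x \<noteq> \<zero>\<^bsub>K\<^esub>}"
  have sub: "?S \<subseteq> carrier G" "?T \<subseteq> carrier G" using carrierD(2)[OF f] carrierD(2)[OF g] by auto
  note fin = carrierD(3)[OF f] carrierD(3)[OF g]
  note eq = mult_eq_finsum[OF f g fin(1) subset_refl sub(1) fin(2) subset_refl sub(2)]
  \<comment> \<open>The support of a product lies in the set of products of the two supports, which
    is finite and contained in \<open>G\<close>.\<close>
  have zero: "(f \<otimes>\<^bsub>A\<^esub> g) z = \<zero>\<^bsub>K\<^esub>" if "z \<notin> (\<lambda>p. fst p \<otimes>\<^bsub>G\<^esub> snd p) ` (?S \<times> ?T)" for z
    unfolding eq using that by (intro K.add.finprod_one_eqI) auto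
  have "(f \<otimes>\<^bsub>A\<^esub> g) z \<in> carrier K" for z
    unfolding eq using sub F_closed carrierD(1)[OF f] carrierD(1)[OF g]
    by (intro K.finsum_closed) (auto simp: subset_iff)
  moreover have "finite {z. (f \<otimes>\<^bsub>A\<^esub> g) z \<noteq> \<zero>\<^bsub>K\<^esub>}"
    by (rule finite_subset[of _ "(\<lambda>p. fst p \<otimes>\<^bsub>G\<^esub> snd p) ` (?S \<times> ?T)"]) (use zero fin in auto)
  moreover have "(f \<otimes>\<^bsub>A\<^esub> g) z = \<zero>\<^bsub>K\<^esub>" if "z \<notin> carrier G" for z
    by (rule zero) (use that carrierD(2)[OF f] carrierD(2)[OF g] G.m_closed in auto)
  ultimately show ?thesis unfolding twisted_algebra_simps(1) free_module_simps by blast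
qed

lemma mult_bilinear: "monoid.mult A \<in> bilinear_maps K A A A"
proof -
  define s where "s f = {x. f x \<noteq> \<zero>\<^bsub>K\<^esub>}" for f :: "'g \<Rightarrow> 'k"
  have s: "finite (s f)" "s f \<subseteq> carrier G" if "f \<in> carrier A" for f
    using carrierD(2,3)[OF that] by (auto simp: s_def)
  let ?t = "\<lambda>z f g p. if fst p \<otimes>\<^bsub>G\<^esub> snd p = z
      then F (fst p) (snd p) \<otimes>\<^bsub>K\<^esub> (f (fst p) \<otimes>\<^bsub>K\<^esub> g (snd p)) else \<zero>\<^bsub>K\<^esub>"
  have t: "?t z f g \<in> S \<times> T \<rightarrow> carrier K"
    if "f \<in> carrier A" "g \<in> carrier A" "S \<subseteq> carrier G" "T \<subseteq> carrier G" for f g S T z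
    using carrierD(1)[OF that(1)] carrierD(1)[OF that(2)] F_closed that(3,4) by (auto simp: subset_iff)
  have F: "F (fst p) (snd p) \<in> carrier K" if "p \<in> S \<times> T" "S \<subseteq> carrier G" "T \<subseteq> carrier G" for p S T
    using that F_closed by (auto simp: subset_iff)
  have add_eq: "(f \<oplus>\<^bsub>A\<^esub> g) x = f x \<oplus>\<^bsub>K\<^esub> g x" and smult_eq: "(a \<odot>\<^bsub>A\<^esub> g) x = a \<otimes>\<^bsub>K\<^esub> g x" for f g a x
    by (simp_all add: twisted_algebra_simps free_module_simps)
  show ?thesis
  proof (intro bilinear_mapsI linear_mapsI mult_closed ext; (assumption)?)
    fix f g h z assume f: "f \<in> carrier A" and g: "g \<in> carrier A" and h: "h \<in> carrier A"
    note c = carrierD(1)[OF f] carrierD(1)[OF g] carrierD(1)[OF h]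
    \<comment> \<open>The supports of g, h and g + h all lie in this union, so all three products
      become sums over the same rectangle and can be compared term by term.\<close>
    let ?S = "s g \<union> s h"
    have S: "finite ?S" "?S \<subseteq> carrier G" using s[OF g] s[OF h] by auto
    have sub: "{x. g x \<noteq> \<zero>\<^bsub>K\<^esub>} \<subseteq> ?S" "{x. h x \<noteq> \<zero>\<^bsub>K\<^esub>} \<subseteq> ?S" "{x. (g \<oplus>\<^bsub>A\<^esub> h) x \<noteq> \<zero>\<^bsub>K\<^esub>} \<subseteq> ?S"
      "{x. f x \<noteq> \<zero>\<^bsub>K\<^esub>} \<subseteq> s f"
      by (auto simp: s_def add_eq)
    note L = mult_eq_finsum[OF _ f S(1) _ S(2) s(1)[OF f] sub(4) s(2)[OF f]]
    have "((g \<oplus>\<^bsub>A\<^esub> h) \<otimes>\<^bsub>A\<^esub> f) z = (\<Oplus>\<^bsub>K\<^esub>p\<in>?S \<times> s f. ?t z g f p \<oplus>\<^bsub>K\<^esub> ?t z h f p)"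
      unfolding L[OF A.M.add.m_closed[OF g h] sub(3)]
    proof (rule K.finsum_cong'[OF refl])
      show "(\<lambda>p. ?t z g f p \<oplus>\<^bsub>K\<^esub> ?t z h f p) \<in> ?S \<times> s f \<rightarrow> carrier K"
        using t[OF g f S(2) s(2)[OF f], of z] t[OF h f S(2) s(2)[OF f], of z] by (intro Pi_I K.add.m_closed) blast+
      show "?t z (g \<oplus>\<^bsub>A\<^esub> h) f p = ?t z g f p \<oplus>\<^bsub>K\<^esub> ?t z h f p" if "p \<in> ?S \<times> s f" for p
        using F[OF that S(2) s(2)[OF f]] c by (simp add: add_eq K.l_distr K.r_distr)
    qed
    also have "\<dots> = (g \<otimes>\<^bsub>A\<^esub> f) z \<oplus>\<^bsub>K\<^esub> (h \<otimes>\<^bsub>A\<^esub> f) z"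
      unfolding L[OF g sub(1)] L[OF h sub(2)]
      by (rule K.finsum_addf[OF t[OF g f S(2) s(2)[OF f]] t[OF h f S(2) s(2)[OF f]]])
    finally show "((g \<oplus>\<^bsub>A\<^esub> h) \<otimes>\<^bsub>A\<^esub> f) z = ((g \<otimes>\<^bsub>A\<^esub> f) \<oplus>\<^bsub>A\<^esub> (h \<otimes>\<^bsub>A\<^esub> f)) z" by (simp add: add_eq)
    note L = mult_eq_finsum[OF f _ s(1)[OF f] sub(4) s(2)[OF f] S(1) _ S(2)]
    have "(f \<otimes>\<^bsub>A\<^esub> (g \<oplus>\<^bsub>A\<^esub> h)) z = (\<Oplus>\<^bsub>K\<^esub>p\<in>s f \<times> ?S. ?t z f g p \<oplus>\<^bsub>K\<^esub> ?t z f h p)"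
      unfolding L[OF A.M.add.m_closed[OF g h] sub(3)]
    proof (rule K.finsum_cong'[OF refl])
      show "(\<lambda>p. ?t z f g p \<oplus>\<^bsub>K\<^esub> ?t z f h p) \<in> s f \<times> ?S \<rightarrow> carrier K"
        using t[OF f g s(2)[OF f] S(2), of z] t[OF f h s(2)[OF f] S(2), of z] by (intro Pi_I K.add.m_closed) blast+
      show "?t z f (g \<oplus>\<^bsub>A\<^esub> h) p = ?t z f g p \<oplus>\<^bsub>K\<^esub> ?t z f h p" if "p \<in> s f \<times> ?S" for p
        using F[OF that s(2)[OF f] S(2)] c by (simp add: add_eq K.r_distr)
    qed
    also have "\<dots> = (f \<otimes>\<^bsub>A\<^esub> g) z \<oplus>\<^bsub>K\<^esub> (f \<otimes>\<^bsub>A\<^esub> h) z"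
      unfolding L[OF g sub(1)] L[OF h sub(2)]
      by (rule K.finsum_addf[OF t[OF f g s(2)[OF f] S(2)] t[OF f h s(2)[OF f] S(2)]])
    finally show "(f \<otimes>\<^bsub>A\<^esub> (g \<oplus>\<^bsub>A\<^esub> h)) z = ((f \<otimes>\<^bsub>A\<^esub> g) \<oplus>\<^bsub>A\<^esub> (f \<otimes>\<^bsub>A\<^esub> h)) z" by (simp add: add_eq)
  next
    fix f g a z assume f: "f \<in> carrier A" and g: "g \<in> carrier A" and a: "a \<in> carrier K"
    note c = carrierD(1)[OF f] carrierD(1)[OF g]
    have sub: "{x. f x \<noteq> \<zero>\<^bsub>K\<^esub>} \<subseteq> s f" "{x. g x \<noteq> \<zero>\<^bsub>K\<^esub>} \<subseteq> s g" "{x. (a \<odot>\<^bsub>A\<^esub> g) x \<noteq> \<zero>\<^bsub>K\<^esub>} \<subseteq> s g"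
      using a by (auto simp: s_def smult_eq)
    note L = mult_eq_finsum[OF _ f s(1)[OF g] _ s(2)[OF g] s(1)[OF f] sub(1) s(2)[OF f]]
    have "((a \<odot>\<^bsub>A\<^esub> g) \<otimes>\<^bsub>A\<^esub> f) z = (\<Oplus>\<^bsub>K\<^esub>p\<in>s g \<times> s f. a \<otimes>\<^bsub>K\<^esub> ?t z g f p)"
      unfolding L[OF A.smult_closed[OF a g] sub(3)]
    proof (rule K.finsum_cong'[OF refl])
      show "(\<lambda>p. a \<otimes>\<^bsub>K\<^esub> ?t z g f p) \<in> s g \<times> s f \<rightarrow> carrier K"
        using t[OF g f s(2)[OF g] s(2)[OF f], of z] a by (intro Pi_I K.m_closed) blast+
      show "?t z (a \<odot>\<^bsub>A\<^esub> g) f p = a \<otimes>\<^bsub>K\<^esub> ?t z g f p" if "p \<in> s g \<times> s f" for p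
        using F[OF that s(2)[OF g] s(2)[OF f]] c a by (simp add: smult_eq K.m_ac)
    qed
    also have "\<dots> = a \<otimes>\<^bsub>K\<^esub> (g \<otimes>\<^bsub>A\<^esub> f) z"
      unfolding L[OF g sub(2)] using s[OF f] s[OF g] a
      by (intro K.finsum_rdistr[symmetric] t f g) auto
    finally show "((a \<odot>\<^bsub>A\<^esub> g) \<otimes>\<^bsub>A\<^esub> f) z = (a \<odot>\<^bsub>A\<^esub> (g \<otimes>\<^bsub>A\<^esub> f)) z" by (simp add: smult_eq)
    note L = mult_eq_finsum[OF f _ s(1)[OF f] sub(1) s(2)[OF f] s(1)[OF g] _ s(2)[OF g]]
    have "(f \<otimes>\<^bsub>A\<^esub> (a \<odot>\<^bsub>A\<^esub> g)) z = (\<Oplus>\<^bsub>K\<^esub>p\<in>s f \<times> s g. a \<otimes>\<^bsub>K\<^esub> ?t z f g p)"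
      unfolding L[OF A.smult_closed[OF a g] sub(3)]
    proof (rule K.finsum_cong'[OF refl])
      show "(\<lambda>p. a \<otimes>\<^bsub>K\<^esub> ?t z f g p) \<in> s f \<times> s g \<rightarrow> carrier K"
        using t[OF f g s(2)[OF f] s(2)[OF g], of z] a by (intro Pi_I K.m_closed) blast+
      show "?t z f (a \<odot>\<^bsub>A\<^esub> g) p = a \<otimes>\<^bsub>K\<^esub> ?t z f g p" if "p \<in> s f \<times> s g" for p
        using F[OF that s(2)[OF f] s(2)[OF g]] c a by (simp add: smult_eq K.m_ac)
    qed
    also have "\<dots> = a \<otimes>\<^bsub>K\<^esub> (f \<otimes>\<^bsub>A\<^esub> g) z"
      unfolding L[OF g sub(2)] using s[OF f] s[OF g] a
      by (intro K.finsum_rdistr[symmetric] t f g) auto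
    finally show "(f \<otimes>\<^bsub>A\<^esub> (a \<odot>\<^bsub>A\<^esub> g)) z = (a \<odot>\<^bsub>A\<^esub> (f \<otimes>\<^bsub>A\<^esub> g)) z" by (simp add: smult_eq)
  qed
qed

lemma basis_mult:
  assumes x: "x \<in> carrier G" and y: "y \<in> carrier G"
  shows "basis_elt K x \<otimes>\<^bsub>A\<^esub> basis_elt K y = F x y \<odot>\<^bsub>A\<^esub> basis_elt K (x \<otimes>\<^bsub>G\<^esub> y)"
proof
  fix z
  have "(basis_elt K x \<otimes>\<^bsub>A\<^esub> basis_elt K y) z = (\<Oplus>\<^bsub>K\<^esub>p\<in>{x} \<times> {y}. if fst p \<otimes>\<^bsub>G\<^esub> snd p = z
      then F (fst p) (snd p) \<otimes>\<^bsub>K\<^esub> (basis_elt K x (fst p) \<otimes>\<^bsub>K\<^esub> basis_elt K y (snd p)) else \<zero>\<^bsub>K\<^esub>)"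
    using x y by (intro mult_eq_finsum basis_closed) (auto simp: basis_elt_def)
  then show "(basis_elt K x \<otimes>\<^bsub>A\<^esub> basis_elt K y) z = (F x y \<odot>\<^bsub>A\<^esub> basis_elt K (x \<otimes>\<^bsub>G\<^esub> y)) z"
    using F_closed[OF x y] by (simp add: basis_elt_def twisted_algebra_simps(5) free_module_simps)
qed

text \<open>For basis elements associativity is the cocycle identity together with associativity in
  \<open>G\<close>. It is then extended to arbitrary elements one argument at a time, from the last
  to the first, both sides being linear in each argument.\<close>

lemma assoc_algebra_twisted: "assoc_algebra K A"
proof (rule assoc_algebraI[OF A.module_axioms _ mult_bilinear])
  note l = bilinear_maps_left[OF mult_bilinear] and r = bilinear_maps_right[OF mult_bilinear]
  note A = A.module_axioms
  let ?b = "basis_elt K"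
  have assoc_basis: "(?b x \<otimes>\<^bsub>A\<^esub> ?b y) \<otimes>\<^bsub>A\<^esub> ?b z = ?b x \<otimes>\<^bsub>A\<^esub> (?b y \<otimes>\<^bsub>A\<^esub> ?b z)"
    if xyz: "x \<in> carrier G" "y \<in> carrier G" "z \<in> carrier G" for x y z
  proof -
    note c = F_closed[OF xyz(1,2)] F_closed[OF xyz(2,3)] F_closed[OF G.m_closed[OF xyz(1,2)] xyz(3)]
      F_closed[OF xyz(1) G.m_closed[OF xyz(2,3)]]
    have "(?b x \<otimes>\<^bsub>A\<^esub> ?b y) \<otimes>\<^bsub>A\<^esub> ?b z
        = (F x y \<otimes>\<^bsub>K\<^esub> F (x \<otimes>\<^bsub>G\<^esub> y) z) \<odot>\<^bsub>A\<^esub> ?b (x \<otimes>\<^bsub>G\<^esub> y \<otimes>\<^bsub>G\<^esub> z)"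
      using xyz c
      by (simp add: basis_mult linear_maps_smult[OF l] basis_closed A.smult_assoc1)
    moreover have "?b x \<otimes>\<^bsub>A\<^esub> (?b y \<otimes>\<^bsub>A\<^esub> ?b z)
        = (F y z \<otimes>\<^bsub>K\<^esub> F x (y \<otimes>\<^bsub>G\<^esub> z)) \<odot>\<^bsub>A\<^esub> ?b (x \<otimes>\<^bsub>G\<^esub> (y \<otimes>\<^bsub>G\<^esub> z))"
      using xyz c
      by (simp add: basis_mult linear_maps_smult[OF r] basis_closed A.smult_assoc1)
    ultimately show ?thesis using F_cocycle[OF xyz] G.m_assoc[OF xyz] by simp
  qed
  have 1: "(?b x \<otimes>\<^bsub>A\<^esub> ?b y) \<otimes>\<^bsub>A\<^esub> h = ?b x \<otimes>\<^bsub>A\<^esub> (?b y \<otimes>\<^bsub>A\<^esub> h)"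
    if "x \<in> carrier G" "y \<in> carrier G" "h \<in> carrier A" for x y h
    by (rule linear_maps_eq_on_basis[OF A r linear_maps_comp[OF r r] assoc_basis])
      (use that in \<open>auto intro: basis_closed mult_closed\<close>)
  have 2: "(?b x \<otimes>\<^bsub>A\<^esub> g) \<otimes>\<^bsub>A\<^esub> h = ?b x \<otimes>\<^bsub>A\<^esub> (g \<otimes>\<^bsub>A\<^esub> h)"
    if "x \<in> carrier G" "g \<in> carrier A" "h \<in> carrier A" for x g h
    by (rule linear_maps_eq_on_basis[OF A linear_maps_comp[OF r l] linear_maps_comp[OF l r] 1])
      (use that in \<open>auto intro: basis_closed\<close>)
  have 3: "(f \<otimes>\<^bsub>A\<^esub> g) \<otimes>\<^bsub>A\<^esub> h = f \<otimes>\<^bsub>A\<^esub> (g \<otimes>\<^bsub>A\<^esub> h)"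
    if "f \<in> carrier A" "g \<in> carrier A" "h \<in> carrier A" for f g h
    by (rule linear_maps_eq_on_basis[OF A linear_maps_comp[OF l l] l 2])
      (use that in \<open>auto intro: mult_closed\<close>)
  have one: "\<one>\<^bsub>A\<^esub> = ?b \<one>\<^bsub>G\<^esub>" by (simp add: twisted_algebra_simps)
  show "monoid A"
  proof (rule monoidI[OF mult_closed _ 3])
    show "\<one>\<^bsub>A\<^esub> \<in> carrier A" unfolding one by (simp add: basis_closed)
    show "\<one>\<^bsub>A\<^esub> \<otimes>\<^bsub>A\<^esub> f = f" if "f \<in> carrier A" for f
      unfolding one
      by (rule linear_maps_eq_on_basis[OF A r linear_maps_id])
        (use that in \<open>auto simp: basis_closed basis_mult F_one_left\<close>)
    show "f \<otimes>\<^bsub>A\<^esub> \<one>\<^bsub>A\<^esub> = f" if "f \<in> carrier A" for f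
      unfolding one
      by (rule linear_maps_eq_on_basis[OF A l linear_maps_id])
        (use that in \<open>auto simp: basis_closed basis_mult F_one_right\<close>)
  qed
qed

end

text \<open>Multiplicativity compares two bilinear expressions in u and v, so it can be tested on
  pairs of basis elements; the extension again releases one argument at a time.\<close>

lemma (in twisting) ring_hom_on_basis:
  assumes B: "assoc_algebra K B" and f: "f \<in> linear_maps K A B"
    and one: "f (basis_elt K \<one>\<^bsub>G\<^esub>) = \<one>\<^bsub>B\<^esub>"
    and mult: "\<And>x y. x \<in> carrier G \<Longrightarrow> y \<in> carrier G \<Longrightarrow>
      f (basis_elt K x) \<otimes>\<^bsub>B\<^esub> f (basis_elt K y) = F x y \<odot>\<^bsub>B\<^esub> f (basis_elt K (x \<otimes>\<^bsub>G\<^esub> y))"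
  shows "f \<in> ring_hom A B"
proof (rule ring_hom_memI)
  interpret B: assoc_algebra K B by (rule B)
  note mod = B.module_axioms
  note lA = bilinear_maps_left[OF mult_bilinear] and rA = bilinear_maps_right[OF mult_bilinear]
  note lB = bilinear_maps_left[OF B.mult_bilinear] and rB = bilinear_maps_right[OF B.mult_bilinear]
  have 1: "f (basis_elt K x \<otimes>\<^bsub>A\<^esub> basis_elt K y) = f (basis_elt K x) \<otimes>\<^bsub>B\<^esub> f (basis_elt K y)"
    if "x \<in> carrier G" "y \<in> carrier G" for x y
    using that by (simp add: basis_mult mult linear_maps_smult[OF f] F_closed basis_closed)
  have 2: "f (basis_elt K x \<otimes>\<^bsub>A\<^esub> v) = f (basis_elt K x) \<otimes>\<^bsub>B\<^esub> f v"
    if "x \<in> carrier G" "v \<in> carrier A" for x v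
    by (rule linear_maps_eq_on_basis[OF mod linear_maps_comp[OF rA f] linear_maps_comp[OF f rB] 1])
      (use that in \<open>auto intro: basis_closed linear_maps_closed[OF f]\<close>)
  show "f (u \<otimes>\<^bsub>A\<^esub> v) = f u \<otimes>\<^bsub>B\<^esub> f v" if "u \<in> carrier A" "v \<in> carrier A" for u v
    by (rule linear_maps_eq_on_basis[OF mod linear_maps_comp[OF lA f] linear_maps_comp[OF f lB] 2])
      (use that in \<open>auto intro: linear_maps_closed[OF f]\<close>)
qed (use linear_maps_closed[OF f] linear_maps_add[OF f] one in \<open>simp_all add: twisted_algebra_simps\<close>)

text \<open>Scaling by \<open>a\<close> is multiplication by the algebra element \<open>a\<close>
  times 1, so ideals absorb scalars. This makes the module quotient by an ideal available.\<close>

lemma ideal_submodule: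
  assumes "assoc_algebra K A" "ideal I A"
  shows "submodule I K A"
proof -
  interpret A: assoc_algebra K A by fact
  interpret I: ideal I A by fact
  show ?thesis
  proof (rule A.submoduleI')
    fix a x assume a: "a \<in> carrier K" and x: "x \<in> I"
    have "a \<odot>\<^bsub>A\<^esub> x = (a \<odot>\<^bsub>A\<^esub> \<one>\<^bsub>A\<^esub>) \<otimes>\<^bsub>A\<^esub> x"
      using a x I.a_Hcarr by (simp add: A.smult_mult_left)
    then show "a \<odot>\<^bsub>A\<^esub> x \<in> I" using a I.I_l_closed[OF x] by simp
  qed (use I.a_subset in auto)
qed

lemma quotient_algebra:
  assumes A: "assoc_algebra K A" and I: "ideal I A"
  shows assoc_algebra_quotient: "assoc_algebra K (quotient_module A I)"
    and quotient_coset_mult: "\<And>x y. x \<in> carrier A \<Longrightarrow> y \<in> carrier A \<Longrightarrow>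
      (I +>\<^bsub>A\<^esub> x) \<otimes>\<^bsub>quotient_module A I\<^esub> (I +>\<^bsub>A\<^esub> y) = I +>\<^bsub>A\<^esub> (x \<otimes>\<^bsub>A\<^esub> y)"
proof -
  interpret A: assoc_algebra K A by fact
  interpret I: ideal I A by fact
  let ?Q = "quotient_module A I"
  note sub = ideal_submodule[OF A I]
  have mult: "(I +>\<^bsub>A\<^esub> x) \<otimes>\<^bsub>?Q\<^esub> (I +>\<^bsub>A\<^esub> y) = I +>\<^bsub>A\<^esub> (x \<otimes>\<^bsub>A\<^esub> y)"
    if "x \<in> carrier A" "y \<in> carrier A" for x y
    using I.rcoset_mult_add[OF that] by (simp add: quotient_module_simps)
  show "assoc_algebra K ?Q"
  proof (rule assoc_algebraI[OF module_quotient[OF A.module_axioms sub]])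
    show "monoid ?Q"
      by (rule monoidI) (auto simp: mult A.m_assoc quotient_module_simps(1,3))
    show "monoid.mult ?Q \<in> bilinear_maps K ?Q ?Q ?Q"
      by (intro bilinear_mapsI linear_mapsI)
        (auto simp: mult quotient_module_simps(1) quotient_coset[OF A.module_axioms sub] A.l_distr
          A.r_distr A.smult_mult_left A.smult_mult_right)
  qed
  show "(I +>\<^bsub>A\<^esub> x) \<otimes>\<^bsub>?Q\<^esub> (I +>\<^bsub>A\<^esub> y) = I +>\<^bsub>A\<^esub> (x \<otimes>\<^bsub>A\<^esub> y)"
    if "x \<in> carrier A" "y \<in> carrier A" for x y
    by (rule mult[OF that])
qed

section \<open>The basis grading and its transport along an isomorphism\<close>

context twisting
begin

text \<open>This map is the projection onto degree x for the grading in which the basis element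
  labelled by x has degree x.\<close>

lemma coordinate_linear:
  assumes "x \<in> carrier G"
  shows "(\<lambda>f. f x \<odot>\<^bsub>A\<^esub> basis_elt K x) \<in> linear_maps K A A"
proof (rule linear_mapsI)
  show "f x \<odot>\<^bsub>A\<^esub> basis_elt K x \<in> carrier A" if "f \<in> carrier A" for f
    using carrierD(1)[OF that] basis_closed[OF assms] by simp
  fix f g assume f: "f \<in> carrier A" and g: "g \<in> carrier A"
  have "(f \<oplus>\<^bsub>A\<^esub> g) x = f x \<oplus>\<^bsub>K\<^esub> g x" by (simp add: twisted_algebra_simps free_module_simps)
  then show "(f \<oplus>\<^bsub>A\<^esub> g) x \<odot>\<^bsub>A\<^esub> basis_elt K x = f x \<odot>\<^bsub>A\<^esub> basis_elt K x \<oplus>\<^bsub>A\<^esub> g x \<odot>\<^bsub>A\<^esub> basis_elt K x"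
    using carrierD(1)[OF f] carrierD(1)[OF g] basis_closed[OF assms] by (simp add: A.smult_l_distr)
next
  fix a f assume a: "a \<in> carrier K" and f: "f \<in> carrier A"
  have "(a \<odot>\<^bsub>A\<^esub> f) x = a \<otimes>\<^bsub>K\<^esub> f x" by (simp add: twisted_algebra_simps free_module_simps)
  then show "(a \<odot>\<^bsub>A\<^esub> f) x \<odot>\<^bsub>A\<^esub> basis_elt K x = a \<odot>\<^bsub>A\<^esub> (f x \<odot>\<^bsub>A\<^esub> basis_elt K x)"
    using a carrierD(1)[OF f] basis_closed[OF assms] by (simp add: A.smult_assoc1)
qed

lemma sum_of_coordinates:
  assumes fin: "finite (carrier G)" and f: "f \<in> carrier A"
  shows "(\<Oplus>\<^bsub>A\<^esub>x\<in>carrier G. f x \<odot>\<^bsub>A\<^esub> basis_elt K x) = f"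
proof (rule linear_maps_eq_on_basis[OF A.module_axioms _ linear_maps_id _ f])
  show "(\<lambda>f. \<Oplus>\<^bsub>A\<^esub>x\<in>carrier G. f x \<odot>\<^bsub>A\<^esub> basis_elt K x) \<in> linear_maps K A A"
    by (rule linear_maps_finsum[OF A.module_axioms fin coordinate_linear])
  fix y assume y: "y \<in> carrier G"
  have "(\<Oplus>\<^bsub>A\<^esub>x\<in>carrier G. basis_elt K y x \<odot>\<^bsub>A\<^esub> basis_elt K x)
      = (\<Oplus>\<^bsub>A\<^esub>x\<in>carrier G. if y = x then basis_elt K x else \<zero>\<^bsub>A\<^esub>)"
    using basis_closed by (intro A.finsum_cong') (auto simp: basis_elt_def[of K y])
  also have "\<dots> = basis_elt K y"
    using basis_closed by (intro A.finsum_singleton[OF y fin]) auto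
  finally show "(\<Oplus>\<^bsub>A\<^esub>x\<in>carrier G. basis_elt K y x \<odot>\<^bsub>A\<^esub> basis_elt K x) = basis_elt K y" .
qed

text \<open>Everything is pulled back along the isomorphism. The product respects degrees because in
  the twisted algebra a multiple of the basis element x times a multiple of the basis element y is a
  multiple of the basis element x y.\<close>

lemma graded_algebra_transported:
  assumes fin: "finite (carrier G)" and C: "assoc_algebra K C" and \<phi>: "\<phi> \<in> algebra_iso K C A"
  shows "graded_algebra K G (transported_grading K C A \<phi>)"
proof -
  define gr where "gr x = {c \<in> carrier C. \<exists>a\<in>carrier K. \<phi> c = a \<odot>\<^bsub>A\<^esub> basis_elt K x}" for x
  let ?C = "with_grading C gr"
  interpret C: assoc_algebra K C by (rule C)
  have lin: "\<phi> \<in> linear_maps K C A" and hom: "\<phi> \<in> ring_hom C A"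
    and bij: "bij_betw \<phi> (carrier C) (carrier A)"
    using \<phi> unfolding algebra_iso_def ring_iso_def by auto
  note mC = C.module_axioms and mA = A.module_axioms
  obtain \<sigma> where \<sigma>: "\<sigma> \<in> linear_maps K A C" and \<sigma>\<phi>: "\<And>c. c \<in> carrier C \<Longrightarrow> \<sigma> (\<phi> c) = c"
    and \<phi>\<sigma>: "\<And>f. f \<in> carrier A \<Longrightarrow> \<phi> (\<sigma> f) = f"
    using linear_maps_inverse[OF mC lin bij] by blast
  have smult_basis: "(a \<odot>\<^bsub>A\<^esub> basis_elt K y) x = (if x = y then a else \<zero>\<^bsub>K\<^esub>)"
    if "a \<in> carrier K" for a x y
    using that by (simp add: twisted_algebra_simps free_module_simps basis_elt_def)
  have gr_closed: "c \<in> carrier C" if "c \<in> gr x" for c x using that by (simp add: gr_def)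
  have sub: "submodule (gr x) K C" if x: "x \<in> carrier G" for x
  proof (rule C.submoduleI')
    have "\<zero>\<^bsub>A\<^esub> = \<zero>\<^bsub>K\<^esub> \<odot>\<^bsub>A\<^esub> basis_elt K x" using basis_closed[OF x] by simp
    then show "\<zero>\<^bsub>C\<^esub> \<in> gr x"
      using linear_maps_zero[OF mC mA lin] by (auto simp: gr_def)
    fix c d assume c: "c \<in> gr x" and d: "d \<in> gr x"
    then obtain a b where ab: "a \<in> carrier K" "b \<in> carrier K"
      "\<phi> c = a \<odot>\<^bsub>A\<^esub> basis_elt K x" "\<phi> d = b \<odot>\<^bsub>A\<^esub> basis_elt K x" by (auto simp: gr_def)
    then have "\<phi> (c \<oplus>\<^bsub>C\<^esub> d) = (a \<oplus>\<^bsub>K\<^esub> b) \<odot>\<^bsub>A\<^esub> basis_elt K x"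
      using linear_maps_add[OF lin] c d gr_closed basis_closed[OF x] by (simp add: A.smult_l_distr)
    then show "c \<oplus>\<^bsub>C\<^esub> d \<in> gr x" using c d ab by (auto simp: gr_def)
  next
    fix b c assume b: "b \<in> carrier K" and c: "c \<in> gr x"
    then obtain a where a: "a \<in> carrier K" "\<phi> c = a \<odot>\<^bsub>A\<^esub> basis_elt K x" by (auto simp: gr_def)
    then have "\<phi> (b \<odot>\<^bsub>C\<^esub> c) = (b \<otimes>\<^bsub>K\<^esub> a) \<odot>\<^bsub>A\<^esub> basis_elt K x"
      using linear_maps_smult[OF lin b gr_closed[OF c]] b basis_closed[OF x]
      by (simp add: A.smult_assoc1)
    then show "b \<odot>\<^bsub>C\<^esub> c \<in> gr x" using b c a by (auto simp: gr_def)
  qed (auto simp: gr_def)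
  have mC': "module K ?C" by (rule module_with_grading[OF mC])
  interpret C': module K ?C by (rule mC')
  \<comment> \<open>The coordinate projection of the twisted algebra, conjugated by
    \<open>\<phi>\<close> and its inverse \<open>\<sigma>\<close>.\<close>
  let ?P = "\<lambda>x c. \<sigma> (\<phi> c x \<odot>\<^bsub>A\<^esub> basis_elt K x)"
  have graded: "graded_space K G ?C"
  proof (rule graded_spaceI[OF mC' fin])
    show "submodule (grade ?C x) K ?C" if "x \<in> carrier G" for x
      by (simp add: submodule_with_grading_iff[OF mC] sub[OF that])
    show "?P x \<in> linear_maps K ?C ?C" if "x \<in> carrier G" for x
      using linear_maps_comp[OF lin linear_maps_comp[OF coordinate_linear[OF that] \<sigma>]] by simp
    fix c assume c: "c \<in> carrier ?C"
    then have \<phi>c: "\<phi> c \<in> carrier A" using linear_maps_closed[OF lin] by simp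
    have coord: "\<phi> c x \<odot>\<^bsub>A\<^esub> basis_elt K x \<in> carrier A" if "x \<in> carrier G" for x
      using linear_maps_closed[OF coordinate_linear[OF that] \<phi>c] .
    show "?P x c \<in> grade ?C x" if "x \<in> carrier G" for x
      using coord[OF that] \<phi>\<sigma> linear_maps_closed[OF \<sigma>] carrierD(1)[OF \<phi>c] by (auto simp: gr_def)
    have "(\<Oplus>\<^bsub>?C\<^esub>x\<in>carrier G. ?P x c) = \<sigma> (\<Oplus>\<^bsub>A\<^esub>x\<in>carrier G. \<phi> c x \<odot>\<^bsub>A\<^esub> basis_elt K x)"
      using coord by (intro linear_maps_commute_finsum[symmetric, OF mA mC']) (auto simp: \<sigma>)
    then show "(\<Oplus>\<^bsub>?C\<^esub>x\<in>carrier G. ?P x c) = c"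
      using \<sigma>\<phi> c by (simp add: sum_of_coordinates[OF fin \<phi>c])
  next
    fix x y c assume x: "x \<in> carrier G" and y: "y \<in> carrier G" and "c \<in> grade ?C y"
    then obtain a where a: "a \<in> carrier K" "c \<in> carrier C" "\<phi> c = a \<odot>\<^bsub>A\<^esub> basis_elt K y"
      by (auto simp: gr_def)
    show "?P x c = (if y = x then c else \<zero>\<^bsub>?C\<^esub>)"
    proof (cases "y = x")
      case True
      then have "\<phi> c x \<odot>\<^bsub>A\<^esub> basis_elt K x = \<phi> c" using a by (simp add: smult_basis)
      then show ?thesis using True \<sigma>\<phi>[OF a(2)] by simp
    next
      case False
      then show ?thesis
        using a basis_closed[OF x] linear_maps_zero[OF mA mC \<sigma>] by (simp add: smult_basis)
    qed
  qed
  have mult_gr: "u \<otimes>\<^bsub>C\<^esub> v \<in> gr (x \<otimes>\<^bsub>G\<^esub> y)"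
    if "x \<in> carrier G" "y \<in> carrier G" and u: "u \<in> gr x" and v: "v \<in> gr y" for x y u v
  proof -
    obtain a b where ab: "a \<in> carrier K" "b \<in> carrier K"
      "\<phi> u = a \<odot>\<^bsub>A\<^esub> basis_elt K x" "\<phi> v = b \<odot>\<^bsub>A\<^esub> basis_elt K y" using u v by (auto simp: gr_def)
    have "\<phi> (u \<otimes>\<^bsub>C\<^esub> v) = \<phi> u \<otimes>\<^bsub>A\<^esub> \<phi> v"
      using ring_hom_mult[OF hom] gr_closed u v by blast
    also have "\<dots> = (b \<otimes>\<^bsub>K\<^esub> (a \<otimes>\<^bsub>K\<^esub> F x y)) \<odot>\<^bsub>A\<^esub> basis_elt K (x \<otimes>\<^bsub>G\<^esub> y)"
      using ab that(1,2) F_closed[OF that(1,2)]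
      by (simp add: linear_maps_smult[OF bilinear_maps_left[OF mult_bilinear]]
          linear_maps_smult[OF bilinear_maps_right[OF mult_bilinear]] basis_mult basis_closed
          A.smult_assoc1)
    finally show ?thesis
      using ab gr_closed[OF u] gr_closed[OF v] F_closed[OF that(1,2)] by (auto simp: gr_def)
  qed
  note lift = tensor_lift[OF mC mC mC C.mult_bilinear]
  have lift_eq: "tensor_lift K ?C ?C ?C (monoid.mult ?C) = tensor_lift K C C C (monoid.mult C)"
    unfolding tensor_lift_def by simp
  have "tensor_lift K C C C (monoid.mult C) \<in> graded_maps K G (graded_tensor K G ?C ?C) ?C"
    unfolding graded_maps_def
  proof (intro CollectI conjI ballI)
    show "tensor_lift K C C C (monoid.mult C) \<in> linear_maps K (graded_tensor K G ?C ?C) ?C"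
      using lift(1) by simp
    fix z assume z: "z \<in> carrier G"
    have T: "module K (tensor_space K C C)" by (rule module_tensor_space[OF mC mC])
    have "grade (graded_tensor K G ?C ?C) z
        \<subseteq> {t \<in> carrier (tensor_space K C C). tensor_lift K C C C (monoid.mult C) t \<in> gr z}"
    proof (rule grade_graded_tensor_least)
      show "submodule {t \<in> carrier (tensor_space K C C). tensor_lift K C C C (monoid.mult C) t \<in> gr z}
          K (tensor_space K ?C ?C)"
        using submodule_vimage[OF T mC lift(1) sub[OF z]] by simp
      show "pure_tensor K ?C ?C v w
          \<in> {t \<in> carrier (tensor_space K C C). tensor_lift K C C C (monoid.mult C) t \<in> gr z}"
        if "x \<in> carrier G" "y \<in> carrier G" "x \<otimes>\<^bsub>G\<^esub> y = z" "v \<in> grade ?C x" "w \<in> grade ?C y"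
        for x y v w
        using that mult_gr[of x y v w] gr_closed
        by (auto simp: lift(2) pure_tensor_closed[OF mC mC])
    qed
    then show "tensor_lift K C C C (monoid.mult C) ` grade (graded_tensor K G ?C ?C) z \<subseteq> grade ?C z"
      by auto
  qed
  moreover have "(\<lambda>a. a \<odot>\<^bsub>C\<^esub> \<one>\<^bsub>C\<^esub>) \<in> graded_maps K G (unit_space K G) ?C"
    unfolding graded_maps_def
  proof (intro CollectI conjI ballI)
    show "(\<lambda>a. a \<odot>\<^bsub>C\<^esub> \<one>\<^bsub>C\<^esub>) \<in> linear_maps K (unit_space K G) ?C"
      by (rule linear_mapsI) (simp_all add: unit_space_def C.smult_l_distr C.smult_assoc1)
    \<comment> \<open>The unit object is concentrated in the neutral degree, and
      \<open>\<phi>\<close> sends 1 to the basis element of the neutral element. In every other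
      degree only zero has to be mapped.\<close>
    fix x assume x: "x \<in> carrier G"
    have "a \<odot>\<^bsub>C\<^esub> \<one>\<^bsub>C\<^esub> \<in> gr \<one>\<^bsub>G\<^esub>" if "a \<in> carrier K" for a
      using that linear_maps_smult[OF lin that C.one_closed] ring_hom_one[OF hom]
      by (auto simp: gr_def twisted_algebra_simps(2))
    then show "(\<lambda>a. a \<odot>\<^bsub>C\<^esub> \<one>\<^bsub>C\<^esub>) ` grade (unit_space K G) x \<subseteq> grade ?C x"
      using submoduleD(2)[OF sub[OF x]] by (auto simp: unit_space_def)
  qed
  ultimately have "graded_algebra K G ?C"
    unfolding graded_algebra_def lift_eq
    using assoc_algebra_with_grading[OF C] graded by simp
  then show ?thesis
    unfolding transported_grading_def gr_def .
qed

end

section \<open>The cochain and the braiding on \<open>Z\<^sub>2\<^sup>n\<close>\<close>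

lemma Z2_pow_carrier_iff:
  "x \<in> carrier (Z2_pow n) \<longleftrightarrow> x \<in> extensional {..<n} \<and> (\<forall>i<n. x i = 0 \<or> x i = 1)"
proof -
  have "a \<in> {0..<2} \<longleftrightarrow> a = 0 \<or> a = 1" for a :: int by auto
  then show ?thesis
    unfolding Z2_pow_def by (auto simp: PiE_iff carrier_integer_mod_group)
qed

lemma Z2_pow_mult: "x \<otimes>\<^bsub>Z2_pow n\<^esub> y = (\<lambda>i\<in>{..<n}. (x i + y i) mod 2)"
  unfolding Z2_pow_def by simp

lemma Z2_pow_one: "\<one>\<^bsub>Z2_pow n\<^esub> = (\<lambda>i\<in>{..<n}. 0)"
  unfolding Z2_pow_def by simp

lemma comm_group_Z2_pow: "comm_group (Z2_pow n)"
proof (rule group.group_comm_groupI)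
  show "group (Z2_pow n)" unfolding Z2_pow_def by simp
qed (simp add: Z2_pow_mult add.commute)

lemma finite_Z2_pow: "finite (carrier (Z2_pow n))"
  unfolding Z2_pow_def by (auto intro!: finite_PiE simp: carrier_integer_mod_group)

lemma Z2_gen_closed: "Z2_gen n i \<in> carrier (Z2_pow n)"
  by (auto simp: Z2_pow_carrier_iff Z2_gen_def)

text \<open>Adding a generator flips one bit. The form \<open>1 - x i\<close> avoids a remainder
  modulo 2 and is shared with the rule for ordered monomials.\<close>

lemma Z2_gen_mult:
  assumes "i < n" "x \<in> carrier (Z2_pow n)"
  shows "Z2_gen n i \<otimes>\<^bsub>Z2_pow n\<^esub> x = x(i := 1 - x i)"
proof
  show "(Z2_gen n i \<otimes>\<^bsub>Z2_pow n\<^esub> x) j = (x(i := 1 - x i)) j" for j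
    using assms by (auto simp: Z2_pow_carrier_iff Z2_pow_mult Z2_gen_def extensional_def)
qed

lemma Z2_pow_nonneg: "x \<in> carrier (Z2_pow n) \<Longrightarrow> i < n \<Longrightarrow> 0 \<le> x i"
  by (force simp: Z2_pow_carrier_iff)

text \<open>Reduces every comparison of signs to the parity of an exponent, where bit vectors can be
  treated as integer vectors modulo 2.\<close>

lemma (in cring) neg_one_pow_cong:
  assumes "even (a + b)"
  shows "(\<ominus> \<one>) [^] (a :: nat) = (\<ominus> \<one>) [^] (b :: nat)"
proof -
  have "(\<ominus> \<one>) [^] (k + k) = \<one>" for k :: nat
    by (induction k) (simp_all add: l_minus)
  then have "(\<ominus> \<one>) [^] k = (if even k then \<one> else \<ominus> \<one>)" for k :: nat
    by (cases "even k") (auto elim!: evenE oddE simp: mult_2)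
  then show ?thesis using assms by simp
qed

text \<open>The number of inversions in the concatenation of the ordered monomials labelled by x and
  y, that is, of adjacent swaps of different letters needed to sort it.\<close>

definition sign_exponent :: "nat \<Rightarrow> (nat \<Rightarrow> int) \<Rightarrow> (nat \<Rightarrow> int) \<Rightarrow> int"
  where "sign_exponent n x y = (\<Sum>i<n. \<Sum>j<i. x i * y j)"

lemma sign_exponent_nonneg:
  "x \<in> carrier (Z2_pow n) \<Longrightarrow> y \<in> carrier (Z2_pow n) \<Longrightarrow> 0 \<le> sign_exponent n x y"
  unfolding sign_exponent_def by (intro sum_nonneg mult_nonneg_nonneg) (auto intro: Z2_pow_nonneg)

text \<open>The exponent is bilinear modulo 2, so for each pair i, j the expansion contains x_i y_j,
  x_i z_j and y_i z_j twice each.\<close>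

lemma sign_exponent_cocycle:
  assumes "x \<in> carrier (Z2_pow n)" "y \<in> carrier (Z2_pow n)" "z \<in> carrier (Z2_pow n)"
  shows "even (sign_exponent n x y + sign_exponent n (x \<otimes>\<^bsub>Z2_pow n\<^esub> y) z
    + (sign_exponent n y z + sign_exponent n x (y \<otimes>\<^bsub>Z2_pow n\<^esub> z)))"
proof -
  have "even (x i * y j + (x \<otimes>\<^bsub>Z2_pow n\<^esub> y) i * z j + (y i * z j + x i * (y \<otimes>\<^bsub>Z2_pow n\<^esub> z) j))"
    if "i < n" "j < i" for i j
    using that by (auto simp: Z2_pow_mult)
  then show ?thesis
    unfolding sign_exponent_def sum.distrib[symmetric] by (intro dvd_sum) auto
qed

lemma clifford_cochain_alt:
  "clifford_cochain K n q x y = (\<ominus>\<^bsub>K\<^esub> \<one>\<^bsub>K\<^esub>) [^]\<^bsub>K\<^esub> nat (sign_exponent n x y)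
      \<otimes>\<^bsub>K\<^esub> (\<Otimes>\<^bsub>K\<^esub>i\<in>{..<n}. q i [^]\<^bsub>K\<^esub> nat (x i * y i))"
  unfolding clifford_cochain_def sign_exponent_def ..

lemma twisting_clifford:
  assumes K: "cring K" and q: "\<And>i. i < n \<Longrightarrow> q i \<in> carrier K"
  shows "twisting K (Z2_pow n) (clifford_cochain K n q)"
proof -
  interpret K: cring K by (rule K)
  interpret G: comm_group "Z2_pow n" by (rule comm_group_Z2_pow)
  let ?G = "Z2_pow n" and ?F = "clifford_cochain K n q"
  let ?Q = "\<lambda>x y. \<Otimes>\<^bsub>K\<^esub>i\<in>{..<n}. q i [^]\<^bsub>K\<^esub> nat (x i * y i)"
  have Q: "?Q x y \<in> carrier K" for x y using q by (intro K.finprod_closed) auto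
  have Q_mult: "(\<Otimes>\<^bsub>K\<^esub>i\<in>{..<n}. q i [^]\<^bsub>K\<^esub> a i) \<otimes>\<^bsub>K\<^esub> (\<Otimes>\<^bsub>K\<^esub>i\<in>{..<n}. q i [^]\<^bsub>K\<^esub> b i)
      = (\<Otimes>\<^bsub>K\<^esub>i\<in>{..<n}. q i [^]\<^bsub>K\<^esub> (a i + b i))" for a b :: "nat \<Rightarrow> nat"
  proof -
    have "(\<Otimes>\<^bsub>K\<^esub>i\<in>{..<n}. q i [^]\<^bsub>K\<^esub> (a i + b i))
        = (\<Otimes>\<^bsub>K\<^esub>i\<in>{..<n}. q i [^]\<^bsub>K\<^esub> a i \<otimes>\<^bsub>K\<^esub> q i [^]\<^bsub>K\<^esub> b i)"
      using q by (intro K.finprod_cong') (auto simp: K.nat_pow_mult)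
    also have "\<dots> = (\<Otimes>\<^bsub>K\<^esub>i\<in>{..<n}. q i [^]\<^bsub>K\<^esub> a i) \<otimes>\<^bsub>K\<^esub> (\<Otimes>\<^bsub>K\<^esub>i\<in>{..<n}. q i [^]\<^bsub>K\<^esub> b i)"
      using q by (intro K.finprod_multf) auto
    finally show ?thesis by simp
  qed
  show ?thesis
  proof
    show "?F \<in> carrier ?G \<rightarrow> carrier ?G \<rightarrow> carrier K"
      using Q by (auto simp: clifford_cochain_alt)
  next
    fix x y z assume xyz: "x \<in> carrier ?G" "y \<in> carrier ?G" "z \<in> carrier ?G"
    let ?xy = "x \<otimes>\<^bsub>?G\<^esub> y" and ?yz = "y \<otimes>\<^bsub>?G\<^esub> z"
    have c: "?xy \<in> carrier ?G" "?yz \<in> carrier ?G" using xyz by auto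
    let ?e = "\<lambda>x y. nat (sign_exponent n x y)"
    have "even (?e x y + ?e ?xy z + (?e y z + ?e x ?yz))"
      using sign_exponent_cocycle[OF xyz] sign_exponent_nonneg xyz c
      by (simp add: even_nat_iff nat_add_distrib[symmetric])
    then have sign: "(\<ominus>\<^bsub>K\<^esub> \<one>\<^bsub>K\<^esub>) [^]\<^bsub>K\<^esub> (?e x y + ?e ?xy z) = (\<ominus>\<^bsub>K\<^esub> \<one>\<^bsub>K\<^esub>) [^]\<^bsub>K\<^esub> (?e y z + ?e x ?yz)"
      by (rule K.neg_one_pow_cong)
    \<comment> \<open>Unlike the signs, the powers of q_i must agree exactly and not just modulo 2.
      On both sides the exponent of q_i is the number of carries in adding the bits x_i, y_i and
      z_i: it is 1 if at least two of them are 1, and 0 otherwise.\<close>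
    have "?Q x y \<otimes>\<^bsub>K\<^esub> ?Q ?xy z = (\<Otimes>\<^bsub>K\<^esub>i\<in>{..<n}. q i [^]\<^bsub>K\<^esub> (nat (x i * y i) + nat (?xy i * z i)))"
      by (rule Q_mult)
    also have "\<dots> = (\<Otimes>\<^bsub>K\<^esub>i\<in>{..<n}. q i [^]\<^bsub>K\<^esub> (nat (y i * z i) + nat (x i * ?yz i)))"
    proof (rule K.finprod_cong'[OF refl])
      show "q i [^]\<^bsub>K\<^esub> (nat (x i * y i) + nat (?xy i * z i)) = q i [^]\<^bsub>K\<^esub> (nat (y i * z i) + nat (x i * ?yz i))"
        if "i \<in> {..<n}" for i
        using that xyz by (auto simp: Z2_pow_carrier_iff Z2_pow_mult dest!: spec[of _ i])
    qed (use q in auto)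
    also have "\<dots> = ?Q y z \<otimes>\<^bsub>K\<^esub> ?Q x ?yz"
      by (rule Q_mult[symmetric])
    finally have Q_eq: "?Q x y \<otimes>\<^bsub>K\<^esub> ?Q ?xy z = ?Q y z \<otimes>\<^bsub>K\<^esub> ?Q x ?yz" .
    have "?F x y \<otimes>\<^bsub>K\<^esub> ?F ?xy z
        = (\<ominus>\<^bsub>K\<^esub> \<one>\<^bsub>K\<^esub>) [^]\<^bsub>K\<^esub> (?e x y + ?e ?xy z) \<otimes>\<^bsub>K\<^esub> (?Q x y \<otimes>\<^bsub>K\<^esub> ?Q ?xy z)"
      unfolding clifford_cochain_alt using Q by (simp add: K.nat_pow_mult[symmetric] K.m_ac)
    also have "\<dots> = ?F y z \<otimes>\<^bsub>K\<^esub> ?F x ?yz"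
      unfolding clifford_cochain_alt sign Q_eq using Q
      by (simp add: K.nat_pow_mult[symmetric] K.m_ac)
    finally show "?F x y \<otimes>\<^bsub>K\<^esub> ?F ?xy z = ?F y z \<otimes>\<^bsub>K\<^esub> ?F x ?yz" .
  next
    fix x assume "x \<in> carrier ?G"
    have "sign_exponent n \<one>\<^bsub>?G\<^esub> x = 0" "sign_exponent n x \<one>\<^bsub>?G\<^esub> = 0"
      unfolding sign_exponent_def Z2_pow_one by (auto intro!: sum.neutral)
    moreover have "?Q \<one>\<^bsub>?G\<^esub> x = \<one>\<^bsub>K\<^esub>" "?Q x \<one>\<^bsub>?G\<^esub> = \<one>\<^bsub>K\<^esub>"
      unfolding Z2_pow_one by (auto intro!: K.finprod_one_eqI)
    ultimately show "?F \<one>\<^bsub>?G\<^esub> x = \<one>\<^bsub>K\<^esub>" "?F x \<one>\<^bsub>?G\<^esub> = \<one>\<^bsub>K\<^esub>"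
      by (simp_all add: clifford_cochain_alt)
  qed
qed

text \<open>Only the row of index i survives in the double sum. The sign counts the letters that e_i
  must pass to reach its place, and q_i appears when e_i is already there and gets squared.\<close>

lemma clifford_cochain_gen:
  assumes "cring K" "\<And>i. i < n \<Longrightarrow> q i \<in> carrier K" "i < n"
  shows "clifford_cochain K n q (Z2_gen n i) x
    = (\<ominus>\<^bsub>K\<^esub> \<one>\<^bsub>K\<^esub>) [^]\<^bsub>K\<^esub> nat (\<Sum>j<i. x j) \<otimes>\<^bsub>K\<^esub> q i [^]\<^bsub>K\<^esub> nat (x i)"
proof -
  interpret K: cring K by fact
  have "sign_exponent n (Z2_gen n i) x = (\<Sum>a<n. if a = i then \<Sum>j<a. x j else 0)"
    unfolding sign_exponent_def by (intro sum.cong) (auto simp: Z2_gen_def)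
  also have "\<dots> = (\<Sum>j<i. x j)" using assms(3) by simp
  finally have "sign_exponent n (Z2_gen n i) x = (\<Sum>j<i. x j)" .
  moreover have "(\<Otimes>\<^bsub>K\<^esub>a\<in>{..<n}. q a [^]\<^bsub>K\<^esub> nat (Z2_gen n i a * x a))
      = (\<Otimes>\<^bsub>K\<^esub>a\<in>{..<n}. if i = a then q a [^]\<^bsub>K\<^esub> nat (x a) else \<one>\<^bsub>K\<^esub>)"
    using assms(2) by (intro K.finprod_cong') (auto simp: Z2_gen_def)
  moreover have "\<dots> = q i [^]\<^bsub>K\<^esub> nat (x i)"
    using assms(2,3) by (intro K.finprod_singleton) auto
  ultimately show ?thesis unfolding clifford_cochain_alt by simp
qed

text \<open>The exponent is bilinear modulo 2, which gives \<open>R_mult\<close>, and symmetric, so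
  that the product of the two values is a sign with even exponent, which gives
  \<open>R_inverse\<close>.\<close>

lemma symmetric_bicharacter_clifford:
  assumes K: "cring K"
  shows "symmetric_bicharacter K (Z2_pow n) (clifford_braiding K n)"
proof -
  interpret K: cring K by (rule K)
  interpret G: comm_group "Z2_pow n" by (rule comm_group_Z2_pow)
  let ?G = "Z2_pow n" and ?e = "\<lambda>x y. rho n x * rho n y + dot n x y"
  have nonneg: "0 \<le> ?e x y" if "x \<in> carrier ?G" "y \<in> carrier ?G" for x y
    unfolding rho_def dot_def using that Z2_pow_nonneg
    by (intro add_nonneg_nonneg mult_nonneg_nonneg sum_nonneg) auto
  show ?thesis
  proof
    show "finite (carrier ?G)" by (rule finite_Z2_pow)
    show "clifford_braiding K n \<in> carrier ?G \<rightarrow> carrier ?G \<rightarrow> carrier K"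
      by (auto simp: clifford_braiding_def)
  next
    fix x y z assume xyz: "x \<in> carrier ?G" "y \<in> carrier ?G" "z \<in> carrier ?G"
    let ?yz = "y \<otimes>\<^bsub>?G\<^esub> z"
    have "even (\<Sum>i<n. ?yz i + y i + z i)"
      by (rule dvd_sum) (auto simp: Z2_pow_mult)
    then have "even (rho n ?yz + rho n y + rho n z)" by (simp add: rho_def sum.distrib)
    then have "even (rho n x * (rho n ?yz + rho n y + rho n z))" by simp
    moreover have "even (\<Sum>i<n. x i * (?yz i + y i + z i))"
      by (rule dvd_sum) (auto simp: Z2_pow_mult)
    then have "even (dot n x ?yz + dot n x y + dot n x z)"
      by (simp add: dot_def sum.distrib distrib_left)
    ultimately have "even (?e x ?yz + (?e x y + ?e x z))"
      unfolding distrib_left by presburger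
    then have "even (nat (?e x ?yz) + (nat (?e x y) + nat (?e x z)))"
      using nonneg[OF xyz(1,2)] nonneg[OF xyz(1,3)] nonneg[OF xyz(1) G.m_closed[OF xyz(2,3)]]
      by (simp add: even_nat_iff nat_add_distrib[symmetric])
    from K.neg_one_pow_cong[OF this]
    show "clifford_braiding K n x ?yz = clifford_braiding K n x y \<otimes>\<^bsub>K\<^esub> clifford_braiding K n x z"
      unfolding clifford_braiding_def by (simp add: K.nat_pow_mult)
  next
    fix x y assume xy: "x \<in> carrier ?G" "y \<in> carrier ?G"
    have e: "?e y x = ?e x y" by (simp add: dot_def mult.commute)
    have "clifford_braiding K n x y \<otimes>\<^bsub>K\<^esub> clifford_braiding K n y x
        = (\<ominus>\<^bsub>K\<^esub> \<one>\<^bsub>K\<^esub>) [^]\<^bsub>K\<^esub> (nat (?e x y) + nat (?e x y))"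
      unfolding clifford_braiding_def e by (simp add: K.nat_pow_mult)
    also have "\<dots> = (\<ominus>\<^bsub>K\<^esub> \<one>\<^bsub>K\<^esub>) [^]\<^bsub>K\<^esub> (0 :: nat)" by (rule K.neg_one_pow_cong) simp
    finally show "clifford_braiding K n x y \<otimes>\<^bsub>K\<^esub> clifford_braiding K n y x = \<one>\<^bsub>K\<^esub>" by simp
  qed
qed

section \<open>The Clifford algebra\<close>

text \<open>The list of indices is a parameter of its own so that inductions can run over the tails
  \<open>[k..<n]\<close> while the bit vector stays fixed.\<close>

definition ordered_monomial ::
    "('k, 'b, 'c) module_scheme \<Rightarrow> (nat \<Rightarrow> 'b) \<Rightarrow> (nat \<Rightarrow> int) \<Rightarrow> nat list \<Rightarrow> 'b"
  where "ordered_monomial B g x js = foldr (\<lambda>i a. if x i = 1 then g i \<otimes>\<^bsub>B\<^esub> a else a) js \<one>\<^bsub>B\<^esub>"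

lemma ordered_monomial_simps [simp]:
  "ordered_monomial B g x [] = \<one>\<^bsub>B\<^esub>"
  "ordered_monomial B g x (i # js)
    = (if x i = 1 then g i \<otimes>\<^bsub>B\<^esub> ordered_monomial B g x js else ordered_monomial B g x js)"
  by (simp_all add: ordered_monomial_def)

lemma ordered_monomial_cong:
  "(\<And>j. j \<in> set js \<Longrightarrow> x j = y j) \<Longrightarrow> ordered_monomial B g x js = ordered_monomial B g y js"
  by (induction js) auto

context assoc_algebra
begin

lemma ordered_monomial_closed:
  "(\<And>j. j \<in> set js \<Longrightarrow> g j \<in> carrier M) \<Longrightarrow> ordered_monomial M g x js \<in> carrier M"
  by (induction js) auto

text \<open>Downward induction on the start k of the tail, beginning at k = i. There g_i stands at
  its own place: it is inserted if the bit is 0 and squared to q_i if the bit is 1. Prepending a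
  letter g_k with k < i makes g_i pass it, which costs one sign.\<close>

lemma gen_mult_ordered_monomial:
  assumes g: "\<And>i. i < n \<Longrightarrow> g i \<in> carrier M" and q: "\<And>i. i < n \<Longrightarrow> q i \<in> carrier R"
    and square: "\<And>i. i < n \<Longrightarrow> g i \<otimes>\<^bsub>M\<^esub> g i = q i \<odot>\<^bsub>M\<^esub> \<one>\<^bsub>M\<^esub>"
    and anti: "\<And>i j. i < n \<Longrightarrow> j < n \<Longrightarrow> i \<noteq> j \<Longrightarrow> g i \<otimes>\<^bsub>M\<^esub> g j = \<ominus>\<^bsub>M\<^esub> (g j \<otimes>\<^bsub>M\<^esub> g i)"
    and x: "\<And>j. j < n \<Longrightarrow> x j = 0 \<or> x j = 1"
    and i: "i < n" and k: "k \<le> i"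
  shows "g i \<otimes>\<^bsub>M\<^esub> ordered_monomial M g x [k..<n]
    = ((\<ominus> \<one>) [^] nat (\<Sum>j=k..<i. x j) \<otimes> q i [^] nat (x i))
        \<odot>\<^bsub>M\<^esub> ordered_monomial M g (x(i := 1 - x i)) [k..<n]"
  using k
proof (induction k rule: inc_induct)
  case base
  let ?m = "ordered_monomial M g x [Suc i..<n]"
  have m: "?m \<in> carrier M" by (rule ordered_monomial_closed) (use g in auto)
  \<comment> \<open>The tail after i does not contain the letter i, so flipping that bit leaves it
    unchanged.\<close>
  have m': "ordered_monomial M g (x(i := 1 - x i)) [Suc i..<n] = ?m"
    by (rule ordered_monomial_cong) auto
  have "g i \<otimes>\<^bsub>M\<^esub> (g i \<otimes>\<^bsub>M\<^esub> ?m) = q i \<odot>\<^bsub>M\<^esub> ?m"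
    using square[OF i] g[OF i] m q[OF i] by (simp add: m_assoc[symmetric] smult_mult_left)
  moreover have upt: "[i..<n] = i # [Suc i..<n]" using i by (rule upt_conv_Cons)
  ultimately show ?case
    unfolding upt ordered_monomial_simps m' using x[OF i] g[OF i] q[OF i] m by auto
next
  case (step k)
  let ?m = "\<lambda>x. ordered_monomial M g x [Suc k..<n]"
  define x' where "x' = x(i := 1 - x i)"
  note IH = step.IH[folded x'_def]
  have x'k: "x' k = x k" using step.hyps by (simp add: x'_def)
  have upt: "[k..<n] = k # [Suc k..<n]" using step.hyps i by (intro upt_conv_Cons) simp
  let ?s = "(\<ominus> \<one>) [^] nat (\<Sum>j=Suc k..<i. x j) \<otimes> q i [^] nat (x i)"
  have kn: "k < n" using step i by simp
  have m: "?m y \<in> carrier M" for y by (rule ordered_monomial_closed) (use g in auto)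
  have s: "?s \<in> carrier R" using q[OF i] by simp
  have sum: "(\<Sum>j=k..<i. x j) = x k + (\<Sum>j=Suc k..<i. x j)"
    using step.hyps by (simp add: sum.atLeast_Suc_lessThan)
  \<comment> \<open>Needed because \<open>nat\<close> truncates: only for a nonnegative sum does one
    more letter raise the exponent by exactly one.\<close>
  have nonneg: "0 \<le> (\<Sum>j=Suc k..<i. x j)"
  proof (rule sum_nonneg)
    show "0 \<le> x j" if "j \<in> {Suc k..<i}" for j using x[of j] i that by auto
  qed
  show ?case
  proof (cases "x k = 1")
    case True
    have "g i \<otimes>\<^bsub>M\<^esub> (g k \<otimes>\<^bsub>M\<^esub> ?m x) = \<ominus>\<^bsub>M\<^esub> (g k \<otimes>\<^bsub>M\<^esub> g i) \<otimes>\<^bsub>M\<^esub> ?m x"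
      using anti[OF i kn] step.hyps g[OF i] g[OF kn] m by (simp add: m_assoc[symmetric])
    also have "\<dots> = \<ominus>\<^bsub>M\<^esub> (g k \<otimes>\<^bsub>M\<^esub> (?s \<odot>\<^bsub>M\<^esub> ?m x'))"
      using g[OF i] g[OF kn] m IH by (simp add: m_assoc l_minus)
    also have "\<dots> = (\<ominus> ?s) \<odot>\<^bsub>M\<^esub> (g k \<otimes>\<^bsub>M\<^esub> ?m x')"
      using g[OF kn] m[of x'] s by (simp only: smult_mult_right smult_l_minus m_closed)
    also have "\<ominus> ?s = (\<ominus> \<one>) [^] nat (\<Sum>j=k..<i. x j) \<otimes> q i [^] nat (x i)"
    proof -
      have "nat (\<Sum>j=k..<i. x j) = Suc (nat (\<Sum>j=Suc k..<i. x j))"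
        using True nonneg sum by simp
      moreover have "\<ominus> (y \<otimes> z) = y \<otimes> \<ominus> \<one> \<otimes> z" if "y \<in> carrier R" "z \<in> carrier R" for y z
        using that by (simp add: R.l_minus R.r_minus)
      ultimately show ?thesis using q[OF i] by simp
    qed
    finally show ?thesis
      unfolding upt x'_def[symmetric] using True x'k by simp
  next
    case False
    then have "x k = 0" using x[OF kn] by blast
    then show ?thesis
      unfolding upt x'_def[symmetric] using x'k IH sum by simp
  qed
qed

end

abbreviation word_monoid :: "nat \<Rightarrow> nat list monoid"
  where "word_monoid n \<equiv> \<lparr>carrier = lists {..<n}, monoid.mult = (@), one = []\<rparr>"

lemma twisting_words:
  assumes "cring K"
  shows "twisting K (word_monoid n) (\<lambda>u v. \<one>\<^bsub>K\<^esub>)"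
proof -
  interpret K: cring K by fact
  interpret W: monoid "word_monoid n" by (rule monoidI) auto
  show ?thesis by unfold_locales auto
qed

section \<open>Comparison of the quotient of the free algebra with the twisted group algebra\<close>

locale clifford = K: cring K for K :: "('k, 'm) ring_scheme" +
  fixes n :: nat and q :: "nat \<Rightarrow> 'k"
  assumes q_closed: "i < n \<Longrightarrow> q i \<in> carrier K"
begin

sublocale T: twisting K "word_monoid n" "\<lambda>u v. \<one>\<^bsub>K\<^esub>"
  by (rule twisting_words[OF K.is_cring])

sublocale kG: twisting K "Z2_pow n" "clifford_cochain K n q"
  by (rule twisting_clifford[OF K.is_cring q_closed])

sublocale T: assoc_algebra K T.A by (rule T.assoc_algebra_twisted)

sublocale kG: assoc_algebra K kG.A by (rule kG.assoc_algebra_twisted)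

abbreviation "I \<equiv> clifford_ideal K n q"
abbreviation "C \<equiv> clifford_algebra K n q"
abbreviation "c \<equiv> clifford_gen K n q"
abbreviation "b i \<equiv> basis_elt K (Z2_gen n i)"
abbreviation "x i \<equiv> basis_elt K [i]"

lemma x_closed: "i < n \<Longrightarrow> x i \<in> carrier T.A"
  by (rule T.basis_closed) simp

lemma b_closed: "b i \<in> carrier kG.A"
  by (rule kG.basis_closed[OF Z2_gen_closed])

lemma free_algebra: "free_algebra K n = T.A"
  unfolding free_algebra_def ..

lemma C_eq: "C = quotient_module T.A I"
  unfolding clifford_algebra_def free_algebra ..

lemma c_eq: "c i = I +>\<^bsub>T.A\<^esub> x i"
  unfolding clifford_gen_def free_algebra ..

lemma relators_eq: "clifford_relators K n q
    = {x i \<otimes>\<^bsub>T.A\<^esub> x i \<ominus>\<^bsub>T.A\<^esub> q i \<odot>\<^bsub>T.A\<^esub> \<one>\<^bsub>T.A\<^esub> | i. i < n} \<union>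
      {x i \<otimes>\<^bsub>T.A\<^esub> x j \<oplus>\<^bsub>T.A\<^esub> x j \<otimes>\<^bsub>T.A\<^esub> x i | i j. i < n \<and> j < n \<and> i \<noteq> j}"
  unfolding clifford_relators_def free_algebra Let_def ..

lemma relators_closed: "clifford_relators K n q \<subseteq> carrier T.A"
  unfolding relators_eq using x_closed q_closed by auto

lemma ideal_I: "ideal I T.A"
  unfolding clifford_ideal_def free_algebra by (rule T.genideal_ideal[OF relators_closed])

lemma relators_in_I: "clifford_relators K n q \<subseteq> I"
  unfolding clifford_ideal_def free_algebra by (rule T.genideal_self[OF relators_closed])

sublocale C: assoc_algebra K C
  unfolding C_eq by (rule assoc_algebra_quotient[OF T.assoc_algebra_axioms ideal_I])

lemmas I_submodule = ideal_submodule[OF T.assoc_algebra_axioms ideal_I]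

lemmas coset_add = quotient_coset_add[OF T.A.module_axioms I_submodule, folded C_eq]
lemmas coset_smult = quotient_coset_smult[OF T.A.module_axioms I_submodule, folded C_eq]
lemmas coset_eq_iff = quotient_coset_eq_iff[OF T.A.module_axioms I_submodule]
lemmas coset_mult = quotient_coset_mult[OF T.assoc_algebra_axioms ideal_I, folded C_eq]

lemma C_one: "\<one>\<^bsub>C\<^esub> = I +>\<^bsub>T.A\<^esub> \<one>\<^bsub>T.A\<^esub>" and C_zero: "\<zero>\<^bsub>C\<^esub> = I"
  unfolding C_eq quotient_module_simps by auto

lemma carrier_C: "carrier C = (\<lambda>u. I +>\<^bsub>T.A\<^esub> u) ` carrier T.A"
  unfolding C_eq quotient_module_simps ..

lemma proj_linear: "(\<lambda>u. I +>\<^bsub>T.A\<^esub> u) \<in> linear_maps K T.A C"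
  unfolding C_eq by (rule quotient_proj_linear[OF T.A.module_axioms I_submodule])

lemma c_closed: "i < n \<Longrightarrow> c i \<in> carrier C"
  unfolding c_eq using linear_maps_closed[OF proj_linear x_closed] .

lemma c_square:
  assumes "i < n"
  shows "c i \<otimes>\<^bsub>C\<^esub> c i = q i \<odot>\<^bsub>C\<^esub> \<one>\<^bsub>C\<^esub>"
proof -
  note xi = x_closed[OF assms]
  have "x i \<otimes>\<^bsub>T.A\<^esub> x i \<ominus>\<^bsub>T.A\<^esub> q i \<odot>\<^bsub>T.A\<^esub> \<one>\<^bsub>T.A\<^esub> \<in> I"
    using relators_in_I assms unfolding relators_eq by blast
  then have "I +>\<^bsub>T.A\<^esub> (x i \<otimes>\<^bsub>T.A\<^esub> x i) = I +>\<^bsub>T.A\<^esub> (q i \<odot>\<^bsub>T.A\<^esub> \<one>\<^bsub>T.A\<^esub>)"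
    using xi q_closed[OF assms] by (subst coset_eq_iff) auto
  then show ?thesis
    unfolding c_eq C_one using xi q_closed[OF assms] by (simp add: coset_mult coset_smult)
qed

lemma c_anticommute:
  assumes "i < n" "j < n" "i \<noteq> j"
  shows "c i \<otimes>\<^bsub>C\<^esub> c j = \<ominus>\<^bsub>C\<^esub> (c j \<otimes>\<^bsub>C\<^esub> c i)"
proof -
  note xi = x_closed[OF assms(1)] and xj = x_closed[OF assms(2)]
  have r: "x i \<otimes>\<^bsub>T.A\<^esub> x j \<oplus>\<^bsub>T.A\<^esub> x j \<otimes>\<^bsub>T.A\<^esub> x i \<in> I"
    using relators_in_I assms unfolding relators_eq by blast
  have "c i \<otimes>\<^bsub>C\<^esub> c j \<oplus>\<^bsub>C\<^esub> c j \<otimes>\<^bsub>C\<^esub> c i = I +>\<^bsub>T.A\<^esub> (x i \<otimes>\<^bsub>T.A\<^esub> x j \<oplus>\<^bsub>T.A\<^esub> x j \<otimes>\<^bsub>T.A\<^esub> x i)"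
    unfolding c_eq using xi xj by (simp add: coset_mult coset_add)
  also have "\<dots> = \<zero>\<^bsub>C\<^esub>"
    unfolding C_zero by (rule T.a_rcos_zero[OF ideal_I r])
  finally show ?thesis
    using c_closed[OF assms(1)] c_closed[OF assms(2)]
    by (intro C.minus_equality[symmetric]) (auto simp: C.M.add.m_comm)
qed

text \<open>The coefficient is the one in \<open>gen_mult_ordered_monomial\<close> for k = 0. This
  coincidence is what ties the cochain to the Clifford relations.\<close>

lemma b_mult: "i < n \<Longrightarrow> y \<in> carrier (Z2_pow n) \<Longrightarrow> b i \<otimes>\<^bsub>kG.A\<^esub> basis_elt K y
    = ((\<ominus>\<^bsub>K\<^esub> \<one>\<^bsub>K\<^esub>) [^]\<^bsub>K\<^esub> nat (\<Sum>j<i. y j) \<otimes>\<^bsub>K\<^esub> q i [^]\<^bsub>K\<^esub> nat (y i))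
      \<odot>\<^bsub>kG.A\<^esub> basis_elt K (y(i := 1 - y i))"
  using clifford_cochain_gen[OF K.is_cring q_closed, where i = i and x = y]
  by (simp add: kG.basis_mult Z2_gen_closed Z2_gen_mult)

lemma kG_one: "\<one>\<^bsub>kG.A\<^esub> = basis_elt K (\<lambda>j\<in>{..<n}. 0)"
  by (simp add: twisted_algebra_simps(2) Z2_pow_one)

lemma b_square:
  assumes "i < n"
  shows "b i \<otimes>\<^bsub>kG.A\<^esub> b i = q i \<odot>\<^bsub>kG.A\<^esub> \<one>\<^bsub>kG.A\<^esub>"
proof -
  have "(Z2_gen n i)(i := 1 - Z2_gen n i i) = (\<lambda>j\<in>{..<n}. 0)"
    using assms by (auto simp: Z2_gen_def)
  moreover have "(\<Sum>j<i. Z2_gen n i j) = 0"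
    using assms by (intro sum.neutral) (auto simp: Z2_gen_def)
  moreover have "Z2_gen n i i = 1" using assms by (simp add: Z2_gen_def)
  ultimately show ?thesis
    using b_mult[OF assms Z2_gen_closed, of i] q_closed[OF assms] by (simp add: kG_one)
qed

lemma b_anticommute:
  assumes "i < n" "j < n" "i \<noteq> j"
  shows "b i \<otimes>\<^bsub>kG.A\<^esub> b j \<oplus>\<^bsub>kG.A\<^esub> b j \<otimes>\<^bsub>kG.A\<^esub> b i = \<zero>\<^bsub>kG.A\<^esub>"
proof -
  \<comment> \<open>The value of the cochain on the generators i and j: there is an inversion
    exactly when j < i. For distinct indices exactly one of the two orders has it, so the two signs
    cancel.\<close>
  define s where "s i j = (if j < i then \<ominus>\<^bsub>K\<^esub> \<one>\<^bsub>K\<^esub> else \<one>\<^bsub>K\<^esub>)" for i j :: nat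
  let ?e = "\<lambda>i j. basis_elt K ((Z2_gen n j)(i := 1))"
  have *: "b i \<otimes>\<^bsub>kG.A\<^esub> b j = s i j \<odot>\<^bsub>kG.A\<^esub> ?e i j" if "i < n" "j < n" "i \<noteq> j" for i j
  proof -
    have "(\<Sum>k<i. Z2_gen n j k) = (\<Sum>k<i. if k = j then 1 else 0)"
      using that by (intro sum.cong) (auto simp: Z2_gen_def)
    then have "nat (\<Sum>k<i. Z2_gen n j k) = (if j < i then 1 else 0)" by simp
    moreover have "Z2_gen n j i = 0" using that by (simp add: Z2_gen_def)
    ultimately show ?thesis
      using b_mult[OF that(1) Z2_gen_closed, of j] by (simp add: s_def)
  qed
  have e: "(Z2_gen n j)(i := 1) = (Z2_gen n i)(j := 1)"
    using assms by (auto simp: Z2_gen_def fun_eq_iff)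
  have "(Z2_gen n i)(j := 1) = Z2_gen n j \<otimes>\<^bsub>Z2_pow n\<^esub> Z2_gen n i"
    using assms by (subst Z2_gen_mult[OF _ Z2_gen_closed]) (auto simp: Z2_gen_def)
  then have ec: "?e j i \<in> carrier kG.A"
    using kG.basis_closed[OF kG.G.m_closed[OF Z2_gen_closed Z2_gen_closed]] by simp
  have s: "s i j \<in> carrier K" "s j i \<in> carrier K" "s i j \<oplus>\<^bsub>K\<^esub> s j i = \<zero>\<^bsub>K\<^esub>"
    using assms(3) by (auto simp: s_def K.l_neg K.r_neg)
  have "b i \<otimes>\<^bsub>kG.A\<^esub> b j \<oplus>\<^bsub>kG.A\<^esub> b j \<otimes>\<^bsub>kG.A\<^esub> b i = (s i j \<oplus>\<^bsub>K\<^esub> s j i) \<odot>\<^bsub>kG.A\<^esub> ?e j i"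
    unfolding *[OF assms] *[OF assms(2,1) assms(3)[symmetric]] e
    using kG.A.smult_l_distr[OF s(1,2) ec] by simp
  then show ?thesis using s(3) ec by simp
qed

text \<open>\<open>\<phi>\<close> is multiplicative by construction and \<open>\<sigma>\<close> is
  only linear. That they are mutually inverse is checked on spanning sets: classes of words for one
  composite, basis elements of the twisted algebra for the other.\<close>

lemma algebra_iso_exists:
  obtains \<phi> where "\<phi> \<in> algebra_iso K C kG.A" "\<And>i. i < n \<Longrightarrow> \<phi> (c i) = b i"
proof -
  \<comment> \<open>The value of a word at the candidate generators. Since the free algebra has the
    words as basis and concatenation as product, \<open>w\<close> extends to a homomorphism.\<close>
  define w where "w u = foldr (\<lambda>i a. b i \<otimes>\<^bsub>kG.A\<^esub> a) u \<one>\<^bsub>kG.A\<^esub>" for u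
  have w_closed: "w u \<in> carrier kG.A" for u
    unfolding w_def by (induction u) (auto simp: b_closed)
  have w_append: "w (u @ v) = w u \<otimes>\<^bsub>kG.A\<^esub> w v" for u v
    by (induction u) (use w_closed in \<open>auto simp: w_def b_closed kG.m_assoc\<close>)
  obtain \<psi> where \<psi>: "\<psi> \<in> linear_maps K T.A kG.A"
    and \<psi>_word: "\<And>u. u \<in> lists {..<n} \<Longrightarrow> \<psi> (basis_elt K u) = w u"
    using T.lift_basis[OF kG.A.module_axioms, of w] w_closed by auto
  have \<psi>_hom: "\<psi> \<in> ring_hom T.A kG.A"
    by (rule T.ring_hom_on_basis[OF kG.assoc_algebra_axioms \<psi>])
      (use \<psi>_word w_append w_closed in \<open>auto simp: w_def\<close>)
  have \<psi>_gen: "\<psi> (x i) = b i" if "i < n" for i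
    using \<psi>_word[of "[i]"] that b_closed by (simp add: w_def)
  interpret \<psi>: ring_hom_ring T.A kG.A \<psi>
    by (rule ring_hom_ringI2[OF T.ring_axioms kG.ring_axioms \<psi>_hom])
  \<comment> \<open>The kernel of a ring homomorphism is an ideal, so killing the relators is enough
    to kill the ideal they generate.\<close>
  have "clifford_relators K n q \<subseteq> a_kernel T.A kG.A \<psi>"
  proof
    fix r assume r: "r \<in> clifford_relators K n q"
    have "\<psi> r = \<zero>\<^bsub>kG.A\<^esub>"
      using r unfolding relators_eq
    proof (elim UnE CollectE exE conjE)
      fix i assume "r = x i \<otimes>\<^bsub>T.A\<^esub> x i \<ominus>\<^bsub>T.A\<^esub> q i \<odot>\<^bsub>T.A\<^esub> \<one>\<^bsub>T.A\<^esub>" and i: "i < n"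
      then have "\<psi> r = b i \<otimes>\<^bsub>kG.A\<^esub> b i \<ominus>\<^bsub>kG.A\<^esub> q i \<odot>\<^bsub>kG.A\<^esub> \<one>\<^bsub>kG.A\<^esub>"
        using x_closed[OF i] q_closed[OF i]
        by (simp add: a_minus_def linear_maps_smult[OF \<psi>] \<psi>_gen)
      then show ?thesis
        using b_square[OF i] q_closed[OF i] by (simp add: a_minus_def kG.A.M.r_neg)
    next
      fix i j assume "r = x i \<otimes>\<^bsub>T.A\<^esub> x j \<oplus>\<^bsub>T.A\<^esub> x j \<otimes>\<^bsub>T.A\<^esub> x i" and ij: "i < n" "j < n" "i \<noteq> j"
      then have "\<psi> r = \<psi> (x i) \<otimes>\<^bsub>kG.A\<^esub> \<psi> (x j) \<oplus>\<^bsub>kG.A\<^esub> \<psi> (x j) \<otimes>\<^bsub>kG.A\<^esub> \<psi> (x i)"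
        using x_closed[OF ij(1)] x_closed[OF ij(2)]
        by (simp only: \<psi>.hom_add \<psi>.hom_mult T.m_closed)
      then show ?thesis
        unfolding \<psi>_gen[OF ij(1)] \<psi>_gen[OF ij(2)] b_anticommute[OF ij] .
    qed
    then show "r \<in> a_kernel T.A kG.A \<psi>"
      unfolding a_kernel_def' using subsetD[OF relators_closed r] by blast
  qed
  then have "I \<subseteq> a_kernel T.A kG.A \<psi>"
    unfolding clifford_ideal_def free_algebra by (rule T.genideal_minimal[OF \<psi>.kernel_is_ideal])
  then have "\<And>u. u \<in> I \<Longrightarrow> \<psi> u = \<zero>\<^bsub>kG.A\<^esub>" unfolding a_kernel_def' by blast
  then obtain \<phi> where \<phi>: "\<phi> \<in> linear_maps K C kG.A"
    and \<phi>_coset: "\<And>u. u \<in> carrier T.A \<Longrightarrow> \<phi> (I +>\<^bsub>T.A\<^esub> u) = \<psi> u"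
    unfolding C_eq using quotient_lift[OF T.A.module_axioms I_submodule kG.A.module_axioms \<psi>] by blast
  have \<phi>_c: "\<phi> (c i) = b i" if "i < n" for i
    unfolding c_eq using that by (simp add: \<phi>_coset x_closed \<psi>_gen)
  have \<phi>_one: "\<phi> \<one>\<^bsub>C\<^esub> = \<one>\<^bsub>kG.A\<^esub>"
    unfolding C_one by (simp add: \<phi>_coset)
  have \<phi>_mult: "\<phi> (u \<otimes>\<^bsub>C\<^esub> v) = \<phi> u \<otimes>\<^bsub>kG.A\<^esub> \<phi> v" if "u \<in> carrier C" "v \<in> carrier C" for u v
    using that unfolding carrier_C by (auto simp: coset_mult \<phi>_coset)
  \<comment> \<open>The candidate inverse sends a basis element to the product, in increasing order,
    of the generators in its label. It is prescribed on a basis, so linearity comes for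
    free.\<close>
  have "(\<lambda>y. ordered_monomial C c y [0..<n]) \<in> carrier (Z2_pow n) \<rightarrow> carrier C"
    by (intro Pi_I C.ordered_monomial_closed) (simp add: c_closed)
  then obtain \<sigma> where \<sigma>: "\<sigma> \<in> linear_maps K kG.A C"
    and \<sigma>_basis: "\<And>y. y \<in> carrier (Z2_pow n) \<Longrightarrow> \<sigma> (basis_elt K y) = ordered_monomial C c y [0..<n]"
    by (rule kG.lift_basis[OF C.module_axioms]) blast
  \<comment> \<open>The substitute for multiplicativity of \<open>\<sigma>\<close>: left
    multiplication by a generator has the same matrix on basis elements as on ordered
    monomials.\<close>
  have \<sigma>_gen: "c i \<otimes>\<^bsub>C\<^esub> \<sigma> a = \<sigma> (b i \<otimes>\<^bsub>kG.A\<^esub> a)" if i: "i < n" and a: "a \<in> carrier kG.A" for i a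
  proof (rule kG.linear_maps_eq_on_basis[OF C.module_axioms _ _ _ a])
    show "(\<lambda>a. c i \<otimes>\<^bsub>C\<^esub> \<sigma> a) \<in> linear_maps K kG.A C"
      by (rule linear_maps_comp[OF \<sigma> bilinear_maps_right[OF C.mult_bilinear c_closed[OF i]]])
    show "(\<lambda>a. \<sigma> (b i \<otimes>\<^bsub>kG.A\<^esub> a)) \<in> linear_maps K kG.A C"
      by (rule linear_maps_comp[OF bilinear_maps_right[OF kG.mult_bilinear b_closed] \<sigma>])
    fix y assume y: "y \<in> carrier (Z2_pow n)"
    have y': "y(i := 1 - y i) \<in> carrier (Z2_pow n)"
      using kG.G.m_closed[OF Z2_gen_closed[of n i] y] Z2_gen_mult[OF i y] by simp
    have "c i \<otimes>\<^bsub>C\<^esub> ordered_monomial C c y [0..<n]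
        = ((\<ominus>\<^bsub>K\<^esub> \<one>\<^bsub>K\<^esub>) [^]\<^bsub>K\<^esub> nat (\<Sum>j=0..<i. y j) \<otimes>\<^bsub>K\<^esub> q i [^]\<^bsub>K\<^esub> nat (y i))
          \<odot>\<^bsub>C\<^esub> ordered_monomial C c (y(i := 1 - y i)) [0..<n]"
      by (rule C.gen_mult_ordered_monomial[OF c_closed q_closed c_square c_anticommute])
        (use y i in \<open>auto simp: Z2_pow_carrier_iff\<close>)
    then show "c i \<otimes>\<^bsub>C\<^esub> \<sigma> (basis_elt K y) = \<sigma> (b i \<otimes>\<^bsub>kG.A\<^esub> basis_elt K y)"
      using q_closed[OF i] y y'
      by (simp add: b_mult[OF i y] linear_maps_smult[OF \<sigma>] kG.basis_closed \<sigma>_basis lessThan_atLeast0)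
  qed
  have \<sigma>_one: "\<sigma> \<one>\<^bsub>kG.A\<^esub> = \<one>\<^bsub>C\<^esub>"
  proof -
    have "ordered_monomial C c (\<lambda>j\<in>{..<n}. 0) js = \<one>\<^bsub>C\<^esub>" if "set js \<subseteq> {..<n}" for js
      using that by (induction js) auto
    then show ?thesis
      using \<sigma>_basis[OF kG.G.one_closed] by (simp add: kG_one Z2_pow_one atLeast0LessThan)
  qed
  have \<sigma>\<phi>: "\<sigma> (\<phi> u) = u" if u: "u \<in> carrier C" for u
  proof -
    \<comment> \<open>Peeling off the letters of a word from the left uses only
      \<open>\<sigma>_gen\<close>, and \<open>\<sigma>\<close> of the unit for the empty
      word.\<close>
    have word: "\<sigma> (w v) = I +>\<^bsub>T.A\<^esub> basis_elt K v" if "v \<in> lists {..<n}" for v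
      using that
    proof (induction v)
      case Nil
      show ?case using \<sigma>_one C_one by (simp add: w_def twisted_algebra_simps(2))
    next
      case (Cons i v)
      then have i: "i < n" and v: "v \<in> lists {..<n}" by auto
      have "\<sigma> (w (i # v)) = \<sigma> (b i \<otimes>\<^bsub>kG.A\<^esub> w v)" by (simp add: w_def)
      also have "\<dots> = c i \<otimes>\<^bsub>C\<^esub> (I +>\<^bsub>T.A\<^esub> basis_elt K v)"
        using \<sigma>_gen[OF i w_closed[of v]] Cons.IH by simp
      also have "\<dots> = I +>\<^bsub>T.A\<^esub> (x i \<otimes>\<^bsub>T.A\<^esub> basis_elt K v)"
        unfolding c_eq using x_closed[OF i] T.basis_closed v by (intro coset_mult) auto
      also have "x i \<otimes>\<^bsub>T.A\<^esub> basis_elt K v = basis_elt K (i # v)"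
        using T.basis_mult[of "[i]" v] i v T.basis_closed[of "i # v"] by simp
      finally show ?case .
    qed
    obtain f where f: "f \<in> carrier T.A" "u = I +>\<^bsub>T.A\<^esub> f" using u unfolding carrier_C by blast
    have "\<sigma> (\<psi> f) = I +>\<^bsub>T.A\<^esub> f"
      by (rule T.linear_maps_eq_on_basis[OF C.module_axioms linear_maps_comp[OF \<psi> \<sigma>] proj_linear _ f(1)])
        (use word \<psi>_word in simp)
    then show ?thesis using f \<phi>_coset by simp
  qed
  have \<phi>\<sigma>: "\<phi> (\<sigma> a) = a" if a: "a \<in> carrier kG.A" for a
  proof (rule kG.linear_maps_eq_on_basis[OF kG.A.module_axioms linear_maps_comp[OF \<sigma> \<phi>] linear_maps_id _ a])
    fix y assume y: "y \<in> carrier (Z2_pow n)"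
    \<comment> \<open>The bit vector y with its bits below k cleared: the label that belongs to the
      partial monomial over \<open>[k..<n]\<close>. It runs from the zero vector at k = n to y
      itself at k = 0.\<close>
    define Y where "Y k = (\<lambda>j\<in>{..<n}. if j < k then 0 else y j)" for k
    have Y: "Y k \<in> carrier (Z2_pow n)" for k using y by (auto simp: Y_def Z2_pow_carrier_iff)
    have Yn: "Y n = (\<lambda>j\<in>{..<n}. 0)" by (auto simp: Y_def)
    have Y_Suc: "(Y (Suc k))(k := y k) = Y k" if "k < n" for k
      using that by (auto simp: Y_def fun_eq_iff less_Suc_eq)
    have Y_less: "Y k j = 0" if "j < k" "j < n" for k j using that by (simp add: Y_def)
    have "\<phi> (ordered_monomial C c y [k..<n]) = basis_elt K (Y k)" if "k \<le> n" for k
      using that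
    proof (induction k rule: inc_induct)
      case base
      show ?case using \<phi>_one unfolding kG_one Yn[symmetric] by simp
    next
      case (step k)
      have k: "k < n" using step by simp
      have upt: "[k..<n] = k # [Suc k..<n]" using k by (rule upt_conv_Cons)
      show ?case
      proof (cases "y k = 1")
        case True
        have m: "ordered_monomial C c y [Suc k..<n] \<in> carrier C"
          by (rule C.ordered_monomial_closed) (auto intro: c_closed)
        have "\<phi> (ordered_monomial C c y [k..<n]) = b k \<otimes>\<^bsub>kG.A\<^esub> basis_elt K (Y (Suc k))"
          unfolding upt using True step.IH \<phi>_mult[OF c_closed[OF k] m] \<phi>_c[OF k] by simp
        also have "\<dots> = basis_elt K (Y k)"
        proof -
          \<comment> \<open>The new letter k comes before every letter already present, so it passes
            nothing and is not squared. The coefficient is therefore exactly 1, and no scalar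
            accumulates along the monomial.\<close>
          have "(\<Sum>j<k. Y (Suc k) j) = 0" using k Y_less by (intro sum.neutral) auto
          moreover have "Y (Suc k) k = 0" using k Y_less by simp
          moreover have "(Y (Suc k))(k := 1) = Y k" using Y_Suc[OF k] True by simp
          ultimately show ?thesis using b_mult[OF k Y[of "Suc k"]] kG.basis_closed[OF Y] by simp
        qed
        finally show ?thesis .
      next
        case False
        then have "y k = 0" using y k by (auto simp: Z2_pow_carrier_iff)
        moreover have "Y (Suc k) k = 0" using k Y_less by simp
        ultimately have "Y (Suc k) = Y k" using Y_Suc[OF k] by (metis fun_upd_triv)
        then show ?thesis unfolding upt using False step.IH by simp
      qed
    qed
    from this[of 0] have "\<phi> (ordered_monomial C c y [0..<n]) = basis_elt K (Y 0)" by simp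
    moreover have "Y 0 = y"
      using y by (auto simp: Y_def Z2_pow_carrier_iff intro: extensional_restrict)
    ultimately show "\<phi> (\<sigma> (basis_elt K y)) = basis_elt K y" using \<sigma>_basis[OF y] by simp
  qed
  have "bij_betw \<phi> (carrier C) (carrier kG.A)"
    by (rule bij_betwI[of _ _ _ \<sigma>])
      (use \<sigma>\<phi> \<phi>\<sigma> linear_maps_closed[OF \<phi>] linear_maps_closed[OF \<sigma>] in auto)
  moreover have "\<phi> \<in> ring_hom C kG.A"
    by (rule ring_hom_memI)
      (use linear_maps_closed[OF \<phi>] linear_maps_add[OF \<phi>] \<phi>_mult \<phi>_one in auto)
  ultimately have "\<phi> \<in> algebra_iso K C kG.A"
    using \<phi> by (simp add: algebra_iso_def ring_iso_def)
  then show thesis using \<phi>_c that by blast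
qed

end

theorem proposition2p2:
  fixes K :: "('k, 'm) ring_scheme" and V :: "('k, 'v, 'a) module_scheme"
    and Q :: "'v \<Rightarrow> 'k" and e :: "nat \<Rightarrow> 'v" and q :: "nat \<Rightarrow> 'k" and n :: nat
  assumes "field K" and "\<one>\<^bsub>K\<^esub> \<oplus>\<^bsub>K\<^esub> \<one>\<^bsub>K\<^esub> \<noteq> \<zero>\<^bsub>K\<^esub>"
    and "module K V" and "quadratic_form K V Q" and "nondegenerate K V Q"
    and "is_basis K V n e"
    and "\<forall>i<n. \<forall>j<n. i \<noteq> j \<longrightarrow> polar K V Q (e i) (e j) = \<zero>\<^bsub>K\<^esub>"
    and "\<forall>i<n. Q (e i) = q i \<and> q i \<noteq> \<zero>\<^bsub>K\<^esub>"
  shows "\<exists>\<phi>. \<phi> \<in> algebra_iso K (clifford_algebra K n q)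
                 (twisted_algebra K (Z2_pow n) (clifford_cochain K n q))
      \<and> (\<forall>i<n. \<phi> (clifford_gen K n q i) = basis_elt K (Z2_gen n i))
      \<and> algebra_in_symmetric_category K (Z2_pow n) (clifford_braiding K n) TYPE('w)
           (transported_grading K (clifford_algebra K n q)
             (twisted_algebra K (Z2_pow n) (clifford_cochain K n q)) \<phi>)"
proof -
  interpret K: field K by fact
  \<comment> \<open>The quadratic space enters here: q_i is the value of the form at a vector of the
    space, hence a scalar of the field.\<close>
  have "q i \<in> carrier K" if "i < n" for i
    using assms(4,6,8) that unfolding quadratic_form_def is_basis_def by (metis PiE)
  then interpret clifford K n q by unfold_locales
  interpret R: symmetric_bicharacter K "Z2_pow n" "clifford_braiding K n"
    by (rule symmetric_bicharacter_clifford[OF K.is_cring])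
  obtain \<phi> where \<phi>: "\<phi> \<in> algebra_iso K C kG.A" "\<And>i. i < n \<Longrightarrow> \<phi> (c i) = b i"
    using algebra_iso_exists by blast
  then show ?thesis
    unfolding algebra_in_symmetric_category_def
    using R.defines_symmetric_category
      kG.graded_algebra_transported[OF finite_Z2_pow C.assoc_algebra_axioms \<phi>(1)] by blast
qed

end
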